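(* Let $\alpha\in(0,1)$ and let $\beta=[0;a_1,a_2,\dots]\in(0,1]$ be an irrational number of intermediate $\alpha$-type with $\lim_{n\to\infty}a_n=+\infty$ (so that $\Omega_1(\beta)=\{1/n:n\in\mathbb N\}\cup\{0\}$). Fix $k\in\mathbb{N}$, let $l=l(k)=\min\{i\in\mathbb{N}: a_m\ge k\text{ for all }m\ge i\}$, for each $j\ge l$ let $n_{k,j}\in\mathbb{N}$ be the unique integer with $T_1^{n_{k,j}}(\beta)=[0;k,a_{j+1},a_{j+2},\dots]$, and set $$\mathscr{S}_{k,j}=\frac{(a_{j+1})^{\alpha}\ln(n_{k,j})}{(q_j)^{2(1-\alpha)}}.$$ If $\limsup_{j\to\infty}\mathscr{S}_{k,j}=0$, then $\lim_{n\to\infty}\ln(n)\,\mathcal{P}_1^n(v_{\beta,\alpha})(1/k)=\big(\int v_{\beta,\alpha}\,\mathrm{d}\lambda\big)h_1(1/k)$. Otherwise, $$\liminf_{n\to\infty}\ln(n)\,\mathcal{P}_1^n(v_{\beta,\alpha})(1/k)=\Big(\int v_{\beta,\alpha}\,\mathrm{d}\lambda\Big)h_1(1/k)\quad\text{and}\quad \limsup_{n\to\infty}\ln(n)\,\mathcal{P}_1^n(v_{\beta,\alpha})(1/k)>\int v_{\beta,\alpha}\,\mathrm{d}\lambda.$$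
   Context: $T_1$ is the Farey map: $T_1(x)=\frac{x}{1-x}$ for $0\le x\le1/2$, $T_1(x)=\frac{1-x}{x}$ for $1/2<x\le1$, inverse branches $f_{1,0}(x)=\frac x{1+x}$, $f_{1,1}(x)=\frac1{1+x}$; $\mathcal{P}_1(f)=|f_{1,0}'|\,f\circ f_{1,0}+|f_{1,1}'|\,f\circ f_{1,1}$; $h_1(x)=1/x$; $\lambda$ Lebesgue measure; $v_{\beta,\alpha}(x)=|\beta-x|^{-\alpha}$. $\Omega_1(\beta)$ is the $\omega$-limit set of $\beta$ under $T_1$. Continued fraction convergent denominators: $q_{-1}=0$, $q_0=1$, $q_n=a_nq_{n-1}+q_{n-2}$. For irrational $\beta=[0;a_1,a_2,\dots]$, with $s_{n,j}/t_{n,j}=[0;a_1,\dots,a_{n-1},j]$ in lowest terms ($1\le j\le a_n$), $\beta$ is of intermediate $\alpha$-type if $\sum_{n\ge1}\sum_{j=1}^{a_n}t_{n,j}^{-2(1-\alpha)+\epsilon}<\infty$ for some $\epsilon>0$. *)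

theory Defs
  imports "HOL-Analysis.Analysis"
begin

definition farey :: "real \<Rightarrow> real" where
  "farey x = (if x \<le> 1/2 then x / (1 - x) else (1 - x) / x)"

definition f10 :: "real \<Rightarrow> real" where "f10 x = x / (1 + x)"
definition f11 :: "real \<Rightarrow> real" where "f11 x = 1 / (1 + x)"

text \<open>Transfer operator P_1; |f10'(x)| = |f11'(x)| = 1/(1+x)^2.\<close>
definition P1 :: "(real \<Rightarrow> real) \<Rightarrow> real \<Rightarrow> real" where
  "P1 f x = \<bar>1 / (1 + x)^2\<bar> * f (f10 x) + \<bar>- 1 / (1 + x)^2\<bar> * f (f11 x)"

definition h1 :: "real \<Rightarrow> real" where "h1 x = 1 / x"

definition vfun :: "real \<Rightarrow> real \<Rightarrow> real \<Rightarrow> real" where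
  "vfun \<beta> \<alpha> x = \<bar>\<beta> - x\<bar> powr (- \<alpha>)"

definition gauss :: "real \<Rightarrow> real" where "gauss x = frac (1 / x)"

definition cf_a :: "real \<Rightarrow> nat \<Rightarrow> nat" where
  "cf_a \<beta> n = (if n = 0 then 0 else nat \<lfloor>1 / (gauss ^^ (n - 1)) \<beta>\<rfloor>)"

fun cf_q :: "real \<Rightarrow> nat \<Rightarrow> nat" where
  "cf_q \<beta> 0 = 1"
| "cf_q \<beta> (Suc 0) = cf_a \<beta> 1"
| "cf_q \<beta> (Suc (Suc n)) = cf_a \<beta> (Suc (Suc n)) * cf_q \<beta> (Suc n) + cf_q \<beta> n"

fun cf_eval :: "nat list \<Rightarrow> rat" where
  "cf_eval [] = 0"
| "cf_eval (b # bs) = 1 / (of_nat b + cf_eval bs)"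

definition cf_t :: "real \<Rightarrow> nat \<Rightarrow> nat \<Rightarrow> int" where
  "cf_t \<beta> n j = snd (quotient_of (cf_eval (map (cf_a \<beta>) [1..<n] @ [j])))"

definition intermediate_type :: "real \<Rightarrow> real \<Rightarrow> bool" where
  "intermediate_type \<alpha> \<beta> \<longleftrightarrow> (\<exists>\<epsilon>>0. summable (\<lambda>n.
      \<Sum>j = 1..cf_a \<beta> (Suc n). real_of_int (cf_t \<beta> (Suc n) j) powr (- 2 * (1 - \<alpha>) + \<epsilon>)))"

definition lk :: "real \<Rightarrow> nat \<Rightarrow> nat" where
  "lk \<beta> k = (LEAST i. i \<ge> 1 \<and> (\<forall>m\<ge>i. cf_a \<beta> m \<ge> k))"

text \<open>n_{k,j}: the unique n with T_1^n(beta) = [0; k, a_{j+1}, a_{j+2}, ...] = 1/(k + G^j(beta)).\<close>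
definition nkj :: "real \<Rightarrow> nat \<Rightarrow> nat \<Rightarrow> nat" where
  "nkj \<beta> k j = (THE n. (farey ^^ n) \<beta> = 1 / (real k + (gauss ^^ j) \<beta>))"

definition Skj :: "real \<Rightarrow> real \<Rightarrow> nat \<Rightarrow> nat \<Rightarrow> real" where
  "Skj \<alpha> \<beta> k j = real (cf_a \<beta> (Suc j)) powr \<alpha> * ln (real (nkj \<beta> k j))
                    / real (cf_q \<beta> j) powr (2 * (1 - \<alpha>))"

end

theory Submission
  imports Defs "HOL-Real_Asymp.Real_Asymp"
begin

text \<open>
  Call \<open>f\<close> admissible if \<open>f / h1\<close>, i.e. \<open>x * f x\<close>, is increasing and concave on \<open>[0,1]\<close>; the transfer
  operator preserves this class. For admissible \<open>f\<close> the numbers \<open>u n = (P1 ^^ n) f 1\<close> decrease, and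
  \<open>(P1 ^^ n) f\<close> looks like \<open>u n / x\<close> for \<open>x\<close> well above \<open>1/n\<close>. Since \<open>P1\<close> preserves the integral, this
  forces \<open>ln n * u n\<close> to converge to the integral of \<open>f\<close>. The functions \<open>1 - x^m / (m+1)\<close> are
  admissible, so by Weierstrass approximation \<open>ln n * (P1 ^^ n) f (1/k)\<close> converges to \<open>k\<close> times the
  integral of \<open>f\<close> for every continuous \<open>f\<close>.

  For \<open>v = vfun \<beta> \<alpha>\<close>, sort the preimages of \<open>1/k\<close> under the \<open>n\<close>-th iterate by the time at which their
  itinerary leaves that of \<open>\<beta>\<close>. Those leaving at time \<open>i < n\<close> contribute a function bounded by a summable
  weight times \<open>x powr - p\<close> with \<open>p < 1\<close>, which is admissible up to a shift; the intermediate type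
  condition makes the total contribution of late \<open>i\<close> negligible even after multiplication by \<open>ln n\<close>.
  The one preimage that never leaves contributes a term comparable to \<open>Skj \<alpha> \<beta> k j\<close> if \<open>n = nkj \<beta> k j\<close>,
  and a negligible one otherwise.
\<close>

section \<open>The transfer operator\<close>

text \<open>The logarithm comes from the infinite invariant density \<open>h1\<close>: if the n-th
  iterate is comparable to u n / x on [1/n, 1], its integral there is u n * ln n, and conservation
  of the integral determines u n. For continuous f this settles the limit, but \<open>v\<close> is
  unbounded, and approximation by continuous functions then yields only lower estimates. The inverse
  branch through \<beta> carries the singularity; at each step the sibling branch is separated from
  the orbit point \<open>pt i\<close> by 1/2, but not uniformly in i. Hence a term leaving at time i
  has to be controlled for all i < n at once after multiplication by ln n. Since ln n is at most a
  constant times ln (i + 2) * ln (n - i + 1), one factor is paid by the decay of the remaining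
  iterations, for which the bound on admissible functions must depend on the integral alone, and the
  other by the slack in the intermediate type condition. The points 1/k are rational, so their
  preimages never hit \<beta>, where \<open>v\<close> has the default value 0.\<close>

lemma P1_eq: "P1 f x = (f (x / (1 + x)) + f (1 / (1 + x))) / (1 + x)\<^sup>2"
  by (simp add: P1_def f10_def f11_def add_divide_distrib)

lemma P1_pow_Suc: "(P1 ^^ Suc n) f x
    = ((P1 ^^ n) f (x / (1 + x)) + (P1 ^^ n) f (1 / (1 + x))) / (1 + x)\<^sup>2"
  by (simp add: P1_eq)

text \<open>An iterate at a point of S only sees values of f on S. The choice \<open>{0<..1}\<close>
  avoids the default value of a negative power at 0, and the rational points avoid the default value
  of \<open>v\<close> at \<beta>.\<close>

definition branch_closed :: "real set \<Rightarrow> bool" where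
  "branch_closed S \<longleftrightarrow> (\<forall>x\<in>S. 0 \<le> x \<and> x / (1 + x) \<in> S \<and> 1 / (1 + x) \<in> S)"

lemma branch_closed_Icc: "branch_closed {0..1}"
  by (auto simp: branch_closed_def divide_simps)

lemma branch_closed_Ioc: "branch_closed {0<..1}"
  by (auto simp: branch_closed_def divide_simps)

lemma branch_closed_Rats: "branch_closed ({0..1} \<inter> \<rat>)"
  by (auto simp: branch_closed_def divide_simps)

lemma P1_pow_mono:
  assumes "branch_closed S" "\<And>x. x \<in> S \<Longrightarrow> f x \<le> g x" "x \<in> S"
  shows "(P1 ^^ n) f x \<le> (P1 ^^ n) g x"
  using assms(3)
proof (induction n arbitrary: x)
  case (Suc n)
  then show ?case
    using assms(1) unfolding P1_pow_Suc branch_closed_def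
    by (intro divide_right_mono add_mono) auto
qed (use assms in auto)

lemma P1_pow_cong:
  assumes "branch_closed S" "\<And>x. x \<in> S \<Longrightarrow> f x = g x" "x \<in> S"
  shows "(P1 ^^ n) f x = (P1 ^^ n) g x"
  using assms by (intro antisym P1_pow_mono[of S]) auto

lemma P1_pow_add: "(P1 ^^ n) (\<lambda>x. f x + g x) x = (P1 ^^ n) f x + (P1 ^^ n) g x"
  by (induction n arbitrary: x) (simp_all add: P1_eq add_divide_distrib)

lemma P1_pow_cmult: "(P1 ^^ n) (\<lambda>x. c * f x) x = c * (P1 ^^ n) f x"
  by (induction n arbitrary: x) (simp_all add: P1_eq algebra_simps add_divide_distrib)

lemma P1_pow_diff: "(P1 ^^ n) (\<lambda>x. f x - g x) x = (P1 ^^ n) f x - (P1 ^^ n) g x"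
  using P1_pow_add[of n f "\<lambda>x. (-1) * g x" x] P1_pow_cmult[of n "-1" g x] by simp

lemma P1_pow_zero: "(P1 ^^ n) (\<lambda>x. 0) x = 0"
  using P1_pow_cmult[of n 0 "\<lambda>x. 0" x] by simp

lemma P1_pow_sum: "(P1 ^^ n) (\<lambda>x. \<Sum>i\<in>A. f i x) x = (\<Sum>i\<in>A. (P1 ^^ n) (f i) x)"
  by (induction A rule: infinite_finite_induct) (simp_all add: P1_pow_zero P1_pow_add)

lemma P1_pow_nonneg:
  assumes "branch_closed S" "\<And>x. x \<in> S \<Longrightarrow> 0 \<le> f x" "x \<in> S"
  shows "0 \<le> (P1 ^^ n) f x"
  using P1_pow_mono[of S "\<lambda>x. 0" f x n] assms by (simp add: P1_pow_zero)

lemma continuous_on_P1: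
  assumes "continuous_on {0..1} f"
  shows "continuous_on {0..1} (P1 f)"
proof -
  have *: "P1 f = (\<lambda>x. (f (x / (1 + x)) + f (1 / (1 + x))) / (1 + x)\<^sup>2)"
    by (simp add: fun_eq_iff P1_eq)
  show ?thesis
    unfolding *
    by (intro continuous_intros continuous_on_compose2[OF assms]) (auto simp: divide_simps)
qed

lemma continuous_on_P1_pow:
  "continuous_on {0..1} f \<Longrightarrow> continuous_on {0..1} ((P1 ^^ n) f)"
  by (induction n) (auto intro: continuous_on_P1)

text \<open>Each inverse branch is a change of variables onto one half of the interval. The branch 1
  / (1 + x) reverses orientation, and the sign of its derivative is removed by negating the
  substitution formula.\<close>

lemma integral_P1:
  assumes f: "continuous_on {0..1} f"
  shows "integral {0..1} (P1 f) = integral {0..1} f"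
proof -
  have 1: "((\<lambda>x. (1 / (1 + x)\<^sup>2) *\<^sub>R f (x / (1 + x))) has_integral
      integral {0 / (1 + 0)..1 / (1 + 1)} f) {0..1::real}"
    by (rule has_integral_substitution[where c = 0 and d = 1])
       (auto intro!: derivative_eq_intros f simp: divide_simps power2_eq_square)
  have "((\<lambda>x. (- 1 / (1 + x)\<^sup>2) *\<^sub>R f (1 / (1 + x))) has_integral
      (integral {1 / (1 + 0)..1 / (1 + 1)} f - integral {1 / (1 + 1)..1 / (1 + 0)} f)) {0..1::real}"
    by (rule has_integral_substitution_general[where c = 0 and d = 1 and s = "{}"])
       (auto intro!: derivative_eq_intros continuous_intros f simp: divide_simps power2_eq_square)
  from has_integral_neg[OF this]
  have 2: "((\<lambda>x. (1 / (1 + x)\<^sup>2) *\<^sub>R f (1 / (1 + x))) has_integral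
      integral {1/2..1} f) {0..1::real}"
    by simp
  have "(P1 f has_integral (integral {0..1/2} f + integral {1/2..1} f)) {0..1}"
    using has_integral_add[OF 1 2]
    by (simp add: P1_eq[abs_def] add_divide_distrib)
  moreover have "integral {0..1/2} f + integral {1/2..1} f = integral {0..1} f"
    by (rule Henstock_Kurzweil_Integration.integral_combine)
      (auto intro: integrable_continuous_real f)
  ultimately show ?thesis by (simp add: has_integral_iff)
qed

lemma integral_P1_pow:
  "continuous_on {0..1} f \<Longrightarrow> integral {0..1} ((P1 ^^ n) f) = integral {0..1} f"
  by (induction n) (simp_all add: integral_P1 continuous_on_P1_pow)

section \<open>Admissible functions\<close>

text \<open>Monotonicity of x * f x compares f with multiples of 1/x. Concavity, as x * f x vanishes
  at 0, makes f itself decreasing. The two are preserved jointly: each is used in proving the other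
  for \<open>P1 f\<close>.\<close>

definition admissible :: "(real \<Rightarrow> real) \<Rightarrow> bool" where
  "admissible f \<longleftrightarrow> continuous_on {0..1} f \<and> mono_on {0..1} (\<lambda>x. x * f x)
     \<and> concave_on {0..1} (\<lambda>x. x * f x)"

text \<open>On [0, 1/2], F is a sum of two products of nonnegative concave functions with opposite
  monotonicity, and such products are concave. Composing the increasing concave F with the concave
  map x / (1 + x) keeps concavity.\<close>

lemma admissible_P1:
  assumes "admissible f"
  shows "admissible (P1 f)"
proof -
  define g where "g x = x * f x" for x
  \<comment> \<open>In the coordinate \<open>a = x / (1 + x)\<close> the operator acts on \<open>x * f x\<close> as \<open>F\<close>.\<close>
  define F where "F a = g a * (1 - a) + a * g (1 - a)" for a
  have mono: "g x \<le> g y" if "0 \<le> x" "x \<le> y" "y \<le> 1" for x y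
    using assms that by (auto simp: admissible_def g_def mono_on_def)
  have conc: "concave_on {0..1} g"
    using assms by (simp add: admissible_def g_def[abs_def])
  have g0: "g 0 = 0" by (simp add: g_def)
  have nonneg: "0 \<le> g x" if "0 \<le> x" "x \<le> 1" for x
    using mono[of 0 x] that g0 by simp
  have conc_half: "concave_on {0..1/2} g"
    using conc unfolding concave_on_def by (rule convex_on_subset) auto
  have Fconc: "concave_on {0..1/2} F"
    unfolding F_def[abs_def]
  proof (rule concave_on_add)
    show "concave_on {0..1/2} (\<lambda>x. g x * (1 - x))"
      by (rule concave_on_mul[OF conc_half])
         (auto intro!: concave_on_diff monotone_onI mono nonneg
           simp: concave_on_const convex_on_ident)
    have refl: "concave_on {0..1/2} (\<lambda>x. g (1 - x))"
    proof (rule concave_on_linorderI)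
      fix t x y :: real
      assume *: "t > 0" "t < 1" "x \<in> {0..1/2}" "y \<in> {0..1/2}"
      have "g ((1 - t) *\<^sub>R (1 - x) + t *\<^sub>R (1 - y)) \<ge> (1 - t) * g (1 - x) + t * g (1 - y)"
        by (rule concave_onD[OF conc]) (use * in auto)
      then show "g (1 - ((1 - t) *\<^sub>R x + t *\<^sub>R y)) \<ge> (1 - t) * g (1 - x) + t * g (1 - y)"
        by (simp add: algebra_simps)
    qed auto
    show "concave_on {0..1/2} (\<lambda>x. x * g (1 - x))"
      by (rule concave_on_mul[OF _ refl])
         (auto intro!: monotone_onI mono nonneg simp: concave_on_ident)
  qed
  \<comment> \<open>Both b and 1 - b are convex combinations of a and 1 - a, with the weights t and
    1 - t exchanged. Adding the two concavity inequalities gives g a + g (1 - a) \<le> g b + g (1 -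
    b).\<close>
  have slope: "g (1 - a) - g (1 - b) \<le> g b - g a" if "0 \<le> a" "a < b" "b \<le> 1/2" for a b
  proof -
    define t where "t = (b - a) / (1 - 2 * a)"
    have t: "0 \<le> t" "t \<le> 1" using that by (auto simp: t_def divide_simps)
    have te: "t * (1 - 2 * a) = b - a" using that by (simp add: t_def)
    have 1: "g ((1 - t) *\<^sub>R a + t *\<^sub>R (1 - a)) \<ge> (1 - t) * g a + t * g (1 - a)"
      by (rule concave_onD[OF conc]) (use t that in auto)
    have 2: "g ((1 - t) *\<^sub>R (1 - a) + t *\<^sub>R a) \<ge> (1 - t) * g (1 - a) + t * g a"
      by (rule concave_onD[OF conc]) (use t that in auto)
    have e1: "(1 - t) *\<^sub>R a + t *\<^sub>R (1 - a) = b"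
      using te by (simp add: algebra_simps)
    have e2: "(1 - t) *\<^sub>R (1 - a) + t *\<^sub>R a = 1 - b"
      using te by (simp add: algebra_simps)
    show ?thesis using 1 2 unfolding e1 e2 by (simp add: algebra_simps)
  qed
  have Fmono: "F a \<le> F b" if "0 \<le> a" "a \<le> b" "b \<le> 1/2" for a b
  proof (cases "a = b")
    case False
    then have ab: "a < b" using that by simp
    have "F b - F a = (1 - b) * (g b - g a) + (b - a) * (g (1 - b) - g a)
        - a * (g (1 - a) - g (1 - b))"
      by (simp add: F_def algebra_simps)
    \<comment> \<open>\<open>slope\<close> bounds the loss on the reflected interval by the gain g b
      - g a, and a \<le> 1 - b because a and b are at most 1/2.\<close>
    moreover have "a * (g (1 - a) - g (1 - b)) \<le> (1 - b) * (g b - g a)"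
      using that ab slope[of a b] mono[of a b] by (intro order.trans[OF mult_left_mono[OF slope[of a b]]] mult_right_mono) auto
    moreover have "0 \<le> (b - a) * (g (1 - b) - g a)"
      using that mono[of a "1 - b"] by auto
    ultimately show ?thesis by linarith
  qed auto
  have key: "x * P1 f x = F (x / (1 + x))" if "x \<in> {0..1}" for x
  proof -
    have "1 - x / (1 + x) = 1 / (1 + x)" using that by (simp add: field_simps)
    then show ?thesis
      using that unfolding F_def P1_eq g_def
      by (simp add: divide_simps power2_eq_square) (simp add: algebra_simps)
  qed
  have a_mono: "x / (1 + x) \<le> y / (1 + y)" if "0 \<le> x" "x \<le> y" for x y :: real
    using that by (simp add: divide_simps algebra_simps)
  have a_conc: "concave_on {0..1} (\<lambda>x::real. x / (1 + x))"
    unfolding concave_on_def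
  proof (rule f''_ge0_imp_convex[where f' = "\<lambda>x. - 1 / (1 + x)\<^sup>2" and f'' = "\<lambda>x. 2 / (1 + x)^3"])
    fix x :: real assume "x \<in> {0..1}"
    then have [simp]: "1 + x \<noteq> 0" by auto
    show "((\<lambda>x. - (x / (1 + x))) has_real_derivative - 1 / (1 + x)\<^sup>2) (at x)"
      by (auto intro!: derivative_eq_intros simp: field_simps power2_eq_square)
    show "((\<lambda>x. - 1 / (1 + x)\<^sup>2) has_real_derivative 2 / (1 + x) ^ 3) (at x)"
      by (auto intro!: derivative_eq_intros simp: divide_simps)
         (simp add: power2_eq_square power3_eq_cube power4_eq_xxxx algebra_simps)
  qed auto
  show ?thesis
    unfolding admissible_def
  proof (intro conjI)
    show "continuous_on {0..1} (P1 f)"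
      using assms by (auto simp: admissible_def intro: continuous_on_P1)
    show "mono_on {0..1} (\<lambda>x. x * P1 f x)"
      by (intro monotone_onI, subst (1 2) key)
        (auto intro!: Fmono a_mono simp: divide_simps)
    show "concave_on {0..1} (\<lambda>x. x * P1 f x)"
    proof (rule concave_on_linorderI)
      fix t x y :: real
      assume *: "t > 0" "t < 1" "x \<in> {0..1}" "y \<in> {0..1}"
      define m where "m = (1 - t) *\<^sub>R x + t *\<^sub>R y"
      have m: "m \<in> {0..1}" using * convexD_alt[of "{0..1::real}" x y t] by (auto simp: m_def)
      have h: "z / (1 + z) \<in> {0..1/2}" if "z \<in> {0..1}" for z :: real
        using that by (auto simp: divide_simps)
      have a1: "m / (1 + m) \<ge> (1 - t) * (x / (1 + x)) + t * (y / (1 + y))"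
        unfolding m_def by (rule concave_onD[OF a_conc]) (use * in auto)
      have "(1 - t) * F (x / (1 + x)) + t * F (y / (1 + y))
          \<le> F ((1 - t) *\<^sub>R (x / (1 + x)) + t *\<^sub>R (y / (1 + y)))"
        by (rule concave_onD[OF Fconc]) (use * h in auto)
      also have "\<dots> \<le> F (m / (1 + m))"
        using a1 h[OF m] h[OF *(3)] h[OF *(4)] * by (intro Fmono) auto
      finally show "(1 - t) * (x * P1 f x) + t * (y * P1 f y)
         \<le> ((1 - t) *\<^sub>R x + t *\<^sub>R y) * P1 f ((1 - t) *\<^sub>R x + t *\<^sub>R y)"
        using key[OF *(3)] key[OF *(4)] key[OF m] by (simp add: m_def)
    qed auto
  qed
qed

lemma admissible_P1_pow: "admissible f \<Longrightarrow> admissible ((P1 ^^ n) f)"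
  by (induction n) (auto intro: admissible_P1)

lemma admissible_continuous: "admissible f \<Longrightarrow> continuous_on {0..1} f"
  by (simp add: admissible_def)

lemma admissible_mono: "admissible f \<Longrightarrow> 0 \<le> x \<Longrightarrow> x \<le> y \<Longrightarrow> y \<le> 1 \<Longrightarrow> x * f x \<le> y * f y"
  by (auto simp: admissible_def mono_on_def)

text \<open>f x is the slope of the chord from the origin to the graph of the concave function x * f
  x.\<close>

lemma admissible_antimono_pos:
  assumes "admissible f" "0 < x" "x \<le> y" "y \<le> 1"
  shows "f y \<le> f x"
proof -
  define t where "t = x / y"
  have t: "0 < t" "t \<le> 1" "t * y = x" using assms by (auto simp: t_def)
  have "(1 - t) * (0 * f 0) + t * (y * f y)
      \<le> ((1 - t) *\<^sub>R 0 + t *\<^sub>R y) * f ((1 - t) *\<^sub>R 0 + t *\<^sub>R y)"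
    by (rule concave_onD[of "{0..1}" "\<lambda>x. x * f x"]) (use assms t in \<open>auto simp: admissible_def\<close>)
  then have "x * f y \<le> x * f x" using t by (simp add: mult.assoc[symmetric])
  then show ?thesis using assms by simp
qed

text \<open>The function x * f x forgets the value f 0; continuity recovers it as a limit of values
  at positive points.\<close>

lemma admissible_le_at_0:
  assumes "admissible f" "0 \<le> x" "x \<le> 1"
  shows "f x \<le> f 0"
proof (cases "x = 0")
  case False
  have lim: "(\<lambda>n. x / real (Suc n)) \<longlonglongrightarrow> 0" by real_asymp
  have "(\<lambda>n. f (x / real (Suc n))) \<longlonglongrightarrow> f 0"
    by (rule continuous_on_tendsto_compose[OF admissible_continuous[OF assms(1)] lim])
       (use assms in \<open>auto simp: divide_simps\<close>)
  moreover have "f x \<le> f (x / real (Suc n))" for n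
  proof -
    have "x / real (Suc n) \<le> x / 1" using assms by (intro divide_left_mono) auto
    then show ?thesis using assms False by (intro admissible_antimono_pos[OF assms(1)]) auto
  qed
  ultimately show ?thesis by (metis LIMSEQ_le_const)
qed auto

lemma admissible_nonneg:
  assumes "admissible f" "0 \<le> x" "x \<le> 1"
  shows "0 \<le> f x"
proof -
  have "0 \<le> f x" if "0 < x" "x \<le> 1" for x
    using admissible_mono[OF assms(1), of 0 x] that by (simp add: zero_le_mult_iff)
  from this[of x] this[of 1] show ?thesis
    using admissible_le_at_0[OF assms(1), of 1] assms by (cases "x = 0") auto
qed

section \<open>Values at 0 and 1, and the upper estimate for admissible functions\<close>

lemma P1_pow_at_1: "(P1 ^^ Suc n) f 1 = (P1 ^^ n) f (1 / 2) / 2"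
  by (simp add: P1_eq)

text \<open>0 is the neutral fixed point of \<open>f10\<close>, with derivative 1 there, and
  \<open>f11\<close> maps 0 to 1. So each application adds the current value at 1.\<close>

lemma P1_pow_at_0: "(P1 ^^ n) f 0 = f 0 + (\<Sum>j<n. (P1 ^^ j) f 1)"
  by (induction n) (simp_all add: P1_eq)

lemma admissible_P1_pow_1_decseq: "admissible f \<Longrightarrow> decseq (\<lambda>n. (P1 ^^ n) f 1)"
  unfolding decseq_Suc_iff P1_pow_at_1
  using admissible_mono[OF admissible_P1_pow, of f "1/2" 1] by fastforce

lemma admissible_at_1_le_integral:
  assumes "admissible f"
  shows "f 1 \<le> integral {0..1} f"
proof -
  have "f 1 \<le> f x" if "x \<in> {0..1}" for x
    using admissible_antimono_pos[OF assms, of x 1] admissible_le_at_0[OF assms, of 1] that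
    by (cases "x = 0") auto
  then have "integral {0..1} (\<lambda>x::real. f 1) \<le> integral {0..1} f"
    by (intro integral_le integrable_continuous_real admissible_continuous assms continuous_intros)
  then show ?thesis by simp
qed

lemma has_integral_inverse:
  assumes "0 < a" "a \<le> 1"
  shows "((\<lambda>x::real. c / x) has_integral (c * ln (1 / a))) {a..1}"
proof -
  have "((\<lambda>x. c / x) has_integral (c * ln 1 - c * ln a)) {a..1}"
    using assms
    by (intro fundamental_theorem_of_calculus)
       (auto intro!: derivative_eq_intros simp flip: has_real_derivative_iff_has_vector_derivative)
  then show ?thesis using assms by (simp add: ln_div)
qed

text \<open>The preimages of 1/K are 1/(K + 1) and K/(K + 1). Solving for the value at the first
  one, the second is controlled by the value at 1 because x times the iterate is increasing.\<close>

lemma P1_pow_step: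
  assumes "admissible f"
  shows "(P1 ^^ n) f (1 / real (Suc (Suc m))) / (real (Suc (Suc m)))\<^sup>2
    \<ge> (P1 ^^ Suc n) f (1 / real (Suc m)) / (real (Suc m))\<^sup>2
        - (P1 ^^ n) f 1 / (real (Suc m) * real (Suc (Suc m)))"
proof -
  define K where "K = real (Suc m)"
  have K: "K > 0" "real (Suc (Suc m)) = K + 1" by (auto simp: K_def)
  have e: "1 / K / (1 + 1 / K) = 1 / (K + 1)" "1 / (1 + 1 / K) = K / (K + 1)"
    using K by (auto simp: field_simps)
  have "K / (K + 1) * (P1 ^^ n) f (K / (K + 1)) \<le> 1 * (P1 ^^ n) f 1"
    using K by (intro admissible_mono admissible_P1_pow assms) (auto simp: field_simps)
  then have "(P1 ^^ n) f (K / (K + 1)) / (K + 1)\<^sup>2 \<le> (P1 ^^ n) f 1 / (K * (K + 1))"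
    using K by (simp add: divide_simps power2_eq_square) (simp add: algebra_simps)
  moreover have "(P1 ^^ Suc n) f (1 / K) / K\<^sup>2
      = (P1 ^^ n) f (1 / (K + 1)) / (K + 1)\<^sup>2 + (P1 ^^ n) f (K / (K + 1)) / (K + 1)\<^sup>2"
  proof -
    have "(1 + 1 / K)\<^sup>2 * K\<^sup>2 = (K + 1)\<^sup>2"
      using K by (simp add: power_mult_distrib[symmetric] field_simps)
    then show ?thesis
      unfolding P1_pow_Suc e by (simp add: add_divide_distrib)
  qed
  ultimately show ?thesis unfolding K K_def[symmetric] by linarith
qed

text \<open>Repeating the step moves from 1/(m + 1) up to 1 at the price of m further iterations. If
  the values at 1 were a constant u, \<open>sum_inverse_products\<close> would turn the right-hand
  side into u / (m + 1), the behaviour of u / x.\<close>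

lemma P1_pow_lower:
  assumes "admissible f"
  shows "(P1 ^^ n) f (1 / real (Suc m)) / (real (Suc m))\<^sup>2
    \<ge> (P1 ^^ (n + m)) f 1
        - (\<Sum>i<m. (P1 ^^ (n + m - Suc i)) f 1 / (real (Suc i) * real (Suc (Suc i))))"
proof (induction m arbitrary: n)
  case (Suc m)
  show ?case
    using P1_pow_step[OF assms, of n m] Suc.IH[of "Suc n"] by (simp add: algebra_simps)
qed simp

lemma sum_inverse_products: "(\<Sum>i<m. 1 / (real (Suc i) * real (Suc (Suc i)))) = 1 - 1 / real (Suc m)"
proof (induction m)
  case (Suc m)
  have "1 / (real (Suc m) * real (Suc (Suc m))) = 1 / real (Suc m) - 1 / real (Suc (Suc m))"
    by (simp add: divide_simps)
  then show ?case using Suc by simp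
qed simp

lemma sum_inverse_le_ln: "(\<Sum>i<m. 1 / real (Suc (Suc i))) \<le> ln (real (Suc m))"
proof (induction m)
  case (Suc m)
  have "ln (real (Suc m) / real (Suc (Suc m))) \<le> real (Suc m) / real (Suc (Suc m)) - 1"
    by (intro ln_le_minus_one) auto
  then have "1 / real (Suc (Suc m)) \<le> ln (real (Suc (Suc m))) - ln (real (Suc m))"
    by (simp add: ln_div field_simps)
  then show ?case using Suc by simp
qed simp

text \<open>A shift by i is a sum of i unit shifts, and each of these telescopes to at most u
  N.\<close>

lemma sum_decseq_shift_le:
  fixes u :: "nat \<Rightarrow> real"
  assumes "decseq u" "\<And>n. 0 \<le> u n"
  shows "(\<Sum>n=N..<M. u (n + p) - u (n + p + i)) \<le> real i * u N"
proof (induction i)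
  case (Suc i)
  have "(\<Sum>n=N..<M. u (n + p + i) - u (n + p + Suc i)) \<le> u N"
  proof (cases "N \<le> M")
    case True
    have "(\<Sum>n=N..<M. u (n + p + i) - u (n + p + Suc i))
        = - (\<Sum>n=N..<M. u (Suc n + p + i) - u (n + p + i))"
      by (simp add: sum_negf[symmetric])
    also have "\<dots> = u (N + p + i) - u (M + p + i)"
      using sum_Suc_diff'[OF True, of "\<lambda>n. u (n + p + i)"] by simp
    also have "\<dots> \<le> u N" using assms(2)[of "M + p + i"] decseqD[OF assms(1), of N "N + p + i"] by simp
    finally show ?thesis .
  qed (use assms in auto)
  moreover have "(\<Sum>n=N..<M. u (n + p) - u (n + p + Suc i))
     = (\<Sum>n=N..<M. u (n + p) - u (n + p + i)) + (\<Sum>n=N..<M. u (n + p + i) - u (n + p + Suc i))"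
    by (simp add: sum.distrib[symmetric])
  ultimately show ?case unfolding of_nat_Suc distrib_right mult_1 using Suc.IH by linarith
qed simp

text \<open>The time delays in \<open>P1_pow_lower\<close> enter through differences of u. Summed
  over N \<le> n < 2 * N, a delay of i + 1 costs at most (i + 1) * u N. Against the weights 1 / ((i
  + 1) * (i + 2)) this leaves a harmonic sum, hence the factor ln (m + 1).\<close>

lemma sum_P1_pow_lower:
  assumes "admissible f"
  shows "(\<Sum>n=N..<2*N. (P1 ^^ n) f (1 / real (Suc m)) / real (Suc m))
    \<ge> real N * (P1 ^^ (2 * N + m)) f 1 - real (Suc m) * ln (real (Suc m)) * (P1 ^^ N) f 1"
proof -
  define u where "u n = (P1 ^^ n) f 1" for n
  define K where "K = real (Suc m)"
  define c where "c i = 1 / (real (Suc i) * real (Suc (Suc i)))" for i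
  have K: "K > 0" by (simp add: K_def)
  have u: "decseq u" "\<And>n. 0 \<le> u n"
    using admissible_P1_pow_1_decseq[OF assms] admissible_nonneg[OF admissible_P1_pow[OF assms]]
    by (auto simp: u_def[abs_def])
  have c: "sum c {..<m} = 1 - 1 / K"
    using sum_inverse_products[of m] by (simp add: c_def[abs_def] K_def)
  have 1: "(P1 ^^ n) f (1 / K) / K\<^sup>2 \<ge> u (n + m) / K - (\<Sum>i<m. c i * (u (n + m - Suc i) - u (n + m)))" for n
  proof -
    have "(\<Sum>i<m. c i * (u (n + m - Suc i) - u (n + m)))
       = (\<Sum>i<m. c i * u (n + m - Suc i)) - sum c {..<m} * u (n + m)"
      by (simp add: right_diff_distrib sum_subtractf sum_distrib_right)
    moreover have "(P1 ^^ n) f (1 / K) / K\<^sup>2 \<ge> u (n + m) - (\<Sum>i<m. c i * u (n + m - Suc i))"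
      using P1_pow_lower[OF assms, of n m] by (simp add: u_def c_def K_def)
    ultimately show ?thesis unfolding c by (simp add: algebra_simps)
  qed
  have 2: "(\<Sum>n=N..<2*N. u (n + m - Suc i) - u (n + m)) \<le> real (Suc i) * u N" if "i < m" for i
  proof -
    have "(\<Sum>n=N..<2*N. u (n + (m - Suc i)) - u (n + (m - Suc i) + Suc i)) \<le> real (Suc i) * u N"
      by (rule sum_decseq_shift_le[OF u])
    then show ?thesis using that by simp
  qed
  have "(\<Sum>n=N..<2*N. \<Sum>i<m. c i * (u (n + m - Suc i) - u (n + m)))
      = (\<Sum>i<m. c i * (\<Sum>n=N..<2*N. u (n + m - Suc i) - u (n + m)))"
    by (subst sum.swap) (simp add: sum_distrib_left)
  also have "\<dots> \<le> (\<Sum>i<m. c i * (real (Suc i) * u N))"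
    by (intro sum_mono mult_left_mono 2) (auto simp: c_def)
  also have "\<dots> = (\<Sum>i<m. 1 / real (Suc (Suc i))) * u N"
    unfolding sum_distrib_right by (intro sum.cong) (auto simp: c_def divide_simps)
  also have "\<dots> \<le> ln K * u N"
    unfolding K_def by (intro mult_right_mono sum_inverse_le_ln u)
  finally have 3: "(\<Sum>n=N..<2*N. \<Sum>i<m. c i * (u (n + m - Suc i) - u (n + m))) \<le> ln K * u N" .
  have "real (card {N..<2*N}) * (u (2 * N + m) / K) \<le> (\<Sum>n=N..<2*N. u (n + m) / K)"
    using K u by (intro sum_bounded_below divide_right_mono decseqD[OF u(1)]) auto
  then have 4: "real N * u (2 * N + m) / K \<le> (\<Sum>n=N..<2*N. u (n + m) / K)" by simp
  have "real N * u (2 * N + m) / K - ln K * u N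
     \<le> (\<Sum>n=N..<2*N. u (n + m) / K - (\<Sum>i<m. c i * (u (n + m - Suc i) - u (n + m))))"
    using 3 4 unfolding sum_subtractf by linarith
  also have "\<dots> \<le> (\<Sum>n=N..<2*N. (P1 ^^ n) f (1 / K) / K\<^sup>2)"
    by (intro sum_mono 1)
  also have "\<dots> = (\<Sum>n=N..<2*N. (P1 ^^ n) f (1 / K) / K) / K"
    by (simp add: sum_divide_distrib power2_eq_square)
  finally have "(real N * u (2 * N + m) / K - ln K * u N) * K
      \<le> (\<Sum>n=N..<2*N. (P1 ^^ n) f (1 / K) / K) / K * K"
    using K by (intro mult_right_mono) auto
  moreover have "(real N * u (2 * N + m) / K - ln K * u N) * K
      = real N * u (2 * N + m) - K * ln K * u N"
    using K by (simp add: field_simps)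
  moreover have "(\<Sum>n=N..<2*N. (P1 ^^ n) f (1 / K) / K) / K * K
      = (\<Sum>n=N..<2*N. (P1 ^^ n) f (1 / K) / K)"
    using K by simp
  ultimately show ?thesis
    unfolding K_def[symmetric] u_def[symmetric] by linarith
qed

text \<open>Averaging over \<open>n\<close> replaces a bound on the increments \<open>u n - u (n + 1)\<close>, which monotonicity of \<open>u\<close>
  alone does not give.\<close>

lemma admissible_average_bound:
  assumes "admissible f"
  shows "ln (real (Suc m)) * (real N * (P1 ^^ (2 * N + m)) f 1
      - real (Suc m) * ln (real (Suc m)) * (P1 ^^ N) f 1) \<le> real N * integral {0..1} f"
proof -
  define K where "K = real (Suc m)"
  have K: "K \<ge> 1" by (simp add: K_def)
  \<comment> \<open>On [1/K, 1] the iterate lies above the multiple of 1/x that agrees with it at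
    1/K, and that multiple cannot exceed the conserved total integral.\<close>
  have 1: "(P1 ^^ n) f (1 / K) / K * ln K \<le> integral {0..1} f" for n
  proof -
    let ?g = "(P1 ^^ n) f"
    have admissible: "admissible ?g" by (rule admissible_P1_pow[OF assms])
    have int: "?g integrable_on {0..1}"
      by (intro integrable_continuous_real admissible_continuous admissible)
    have int1: "?g integrable_on {1/K..1}"
      by (rule integrable_subinterval_real[OF int]) (use K in auto)
    have "(?g (1 / K) / K) / x \<le> ?g x" if "x \<in> {1/K..1}" for x
    proof -
      have "0 < 1 / K" using K by simp
      then have "0 < x" using that by (simp add: less_le_trans[of 0 "1 / K"])
      moreover have "1 / K * ?g (1 / K) \<le> x * ?g x"
        using that K by (intro admissible_mono admissible) auto
      ultimately show ?thesis using pos_divide_le_eq[of x "?g (1 / K) / K" "?g x"] by (simp add: mult.commute)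
    qed
    then have "?g (1 / K) / K * ln (1 / (1 / K)) \<le> integral {1/K..1} ?g"
      using K int1 by (intro has_integral_le[OF has_integral_inverse integrable_integral]) auto
    also have "\<dots> \<le> integral {0..1} ?g"
      using K admissible_nonneg[OF admissible] by (intro integral_subset_le int int1) auto
    also have "\<dots> = integral {0..1} f"
      by (intro integral_P1_pow admissible_continuous assms)
    finally show ?thesis by simp
  qed
  have "ln K * (real N * (P1 ^^ (2 * N + m)) f 1 - K * ln K * (P1 ^^ N) f 1)
    \<le> ln K * (\<Sum>n=N..<2*N. (P1 ^^ n) f (1 / K) / K)"
    using sum_P1_pow_lower[OF assms, of N m] K by (intro mult_left_mono) (auto simp: K_def)
  also have "\<dots> = (\<Sum>n=N..<2*N. (P1 ^^ n) f (1 / K) / K * ln K)"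
    by (simp add: sum_distrib_left mult.commute)
  also have "\<dots> \<le> real (card {N..<2*N}) * integral {0..1} f"
    by (intro sum_bounded_above 1)
  finally show ?thesis by (simp add: K_def)
qed

text \<open>In the averaged estimate N is taken about n/3 and K = m + 1 about N powr (1 - e). An
  exponent below 1 makes K * (ln K)^2 negligible against N and costs only a factor close to 1 in ln
  K. The threshold for n depends on e and not on f, which the uniform bound below relies on.\<close>

lemma admissible_upper_bound:
  assumes e: "0 < e" "e < 1/2"
  shows "\<forall>\<^sub>F n in sequentially. \<forall>f. admissible f \<longrightarrow>
    ln (real n) * (P1 ^^ n) f 1 \<le> (1 + e) / (1 - 2 * e) * integral {0..1} f"
proof -
  have ev1: "eventually (\<lambda>n. ln ((real n / 3 - 1) powr (1 - e) - 1) \<ge> (1 - 2 * e) * ln (real n)) sequentially"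
    using e by real_asymp
  have ev2: "eventually (\<lambda>n. (real n / 3) powr (1 - e) * (ln ((real n / 3) powr (1 - e)))\<^sup>2 \<le> e * (real n / 3 - 1)) sequentially"
    using e by real_asymp
  have ev3: "eventually (\<lambda>n. (real n / 3 - 1) powr (1 - e) \<ge> 2) sequentially"
    using e by real_asymp
  show ?thesis
    using ev1 ev2 ev3 eventually_ge_at_top[of 6]
  proof eventually_elim
    case (elim n)
    \<comment> \<open>A third of n leaves room for 2 * N + m \<le> n, as m \<le> N; then the value
      at time n is at most that at time 2 * N + m.\<close>
    define N where "N = n div 3"
    define x where "x = real N powr (1 - e)"
    define m where "m = nat \<lfloor>x\<rfloor> - 1"
    have N: "real n / 3 - 1 \<le> real N" "real N \<le> real n / 3" "1 \<le> N"
      using elim(4) unfolding N_def by linarith+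
    have x: "(real n / 3 - 1) powr (1 - e) \<le> x" "x \<le> (real n / 3) powr (1 - e)"
      using N e elim(4) by (auto simp: x_def intro!: powr_mono2)
    have Suc: "real (Suc m) = real_of_int \<lfloor>x\<rfloor>" using x elim(3) unfolding m_def by linarith
    have K: "x - 1 \<le> real (Suc m)" "real (Suc m) \<le> x" unfolding Suc by linarith+
    have K1: "1 \<le> real (Suc m)" by simp
    have L: "(1 - 2 * e) * ln (real n) \<le> ln (real (Suc m))"
      using elim(1,3) x K by (intro order.trans[OF elim(1)]) (simp add: ln_le_cancel_iff del: of_nat_Suc)
    have "ln (real (Suc m)) \<le> ln ((real n / 3) powr (1 - e))"
      using K K1 x elim(4) by (subst ln_le_cancel_iff) (auto simp del: of_nat_Suc)
    then have "real (Suc m) * (ln (real (Suc m)))\<^sup>2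
        \<le> (real n / 3) powr (1 - e) * (ln ((real n / 3) powr (1 - e)))\<^sup>2"
      using K K1 x by (intro mult_mono power_mono) (auto simp del: of_nat_Suc ln_powr)
    also have "\<dots> \<le> e * real N" using elim(2) N e by (intro order.trans[OF elim(2)] mult_left_mono) auto
    finally have R: "real (Suc m) * (ln (real (Suc m)))\<^sup>2 \<le> e * real N" .
    have "x \<le> real N powr 1" unfolding x_def using N e by (intro powr_mono) auto
    then have mN: "m \<le> N" using K N by (simp add: of_nat_Suc)
    show ?case
    proof (intro allI impI)
      fix f assume f: "admissible f"
      define u where "u n = (P1 ^^ n) f 1" for n
      let ?I = "integral {0..1} f"
      have u: "decseq u" "\<And>n. 0 \<le> u n"
        using admissible_P1_pow_1_decseq[OF f] admissible_nonneg[OF admissible_P1_pow[OF f]]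
        by (auto simp: u_def[abs_def])
      have uN: "u N \<le> ?I"
        using decseqD[OF u(1), of 0 N] admissible_at_1_le_integral[OF f] by (simp add: u_def)
      have "2 * N + m \<le> n" using mN unfolding N_def by linarith
      then have un: "u n \<le> u (2 * N + m)" by (rule decseqD[OF u(1)])
      have "real N * (ln (real (Suc m)) * u (2 * N + m))
          \<le> real N * ?I + (real (Suc m) * (ln (real (Suc m)))\<^sup>2) * u N"
        using admissible_average_bound[OF f, of m N] unfolding u_def
        by (simp add: algebra_simps power2_eq_square)
      also have "\<dots> \<le> real N * ?I + (e * real N) * ?I"
        using u(2)[of N] e by (intro add_left_mono mult_mono[OF R uN]) auto
      also have "\<dots> = real N * ((1 + e) * ?I)" by (simp add: algebra_simps)
      finally have A: "ln (real (Suc m)) * u (2 * N + m) \<le> (1 + e) * ?I"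
        using N by simp
      have "(1 - 2 * e) * (ln (real n) * u n) \<le> ln (real (Suc m)) * u (2 * N + m)"
        unfolding mult.assoc[symmetric] using L un u by (intro mult_mono) auto
      with A have "(1 - 2 * e) * (ln (real n) * u n) \<le> (1 + e) * ?I" by linarith
      then show "ln (real n) * (P1 ^^ n) f 1 \<le> (1 + e) / (1 - 2 * e) * ?I"
        using e unfolding u_def by (simp add: field_simps)
    qed
  qed
qed

text \<open>The conserved integral is split at 1/n. Below 1/n the iterate is at most its value at 0,
  which \<open>P1_pow_at_0\<close> turns into a Cesaro mean of the values at 1; above 1/n it is at
  most its value at 1 divided by x.\<close>

lemma admissible_lower_bound:
  assumes f: "admissible f" and n: "n \<ge> 1"
  shows "integral {0..1} f \<le> (f 0 + (\<Sum>j<n. (P1 ^^ j) f 1)) / real n + ln (real n) * (P1 ^^ n) f 1"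
proof -
  let ?g = "(P1 ^^ n) f" and ?d = "1 / real n"
  have admissible: "admissible ?g" by (rule admissible_P1_pow[OF f])
  have d: "0 < ?d" "?d \<le> 1" using n by auto
  have int: "?g integrable_on {0..1}"
    by (intro integrable_continuous_real admissible_continuous admissible)
  have "?g x \<le> ?g 0" if "x \<in> {0..?d}" for x
    using that order.trans[of x ?d 1] d(2) by (intro admissible_le_at_0[OF admissible]) auto
  then have "integral {0..?d} ?g \<le> integral {0..?d} (\<lambda>x. ?g 0)"
    using d
    by (intro integral_le integrable_subinterval_real[OF int]) auto
  also have "\<dots> = (f 0 + (\<Sum>j<n. (P1 ^^ j) f 1)) / real n"
    using d by (simp add: P1_pow_at_0)
  finally have 1: "integral {0..?d} ?g \<le> (f 0 + (\<Sum>j<n. (P1 ^^ j) f 1)) / real n" .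
  have int1: "?g integrable_on {?d..1}"
    using d by (intro integrable_subinterval_real[OF int]) auto
  have "?g x \<le> ?g 1 / x" if "x \<in> {?d..1}" for x
  proof -
    have "0 < x" using that d(1) by (simp add: less_le_trans[of 0 ?d])
    then show ?thesis using admissible_mono[OF admissible, of x 1] that by (simp add: field_simps)
  qed
  then have "integral {?d..1} ?g \<le> ?g 1 * ln (1 / ?d)"
    using d int1 by (intro has_integral_le[OF integrable_integral has_integral_inverse]) auto
  then have 2: "integral {?d..1} ?g \<le> ln (real n) * ?g 1" by (simp add: mult.commute)
  have "integral {0..1} f = integral {0..1} ?g"
    by (rule integral_P1_pow[symmetric, OF admissible_continuous[OF f]])
  also have "\<dots> = integral {0..?d} ?g + integral {?d..1} ?g"
    using d int by (intro Henstock_Kurzweil_Integration.integral_combine[symmetric]) auto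
  finally show ?thesis using 1 2 by linarith
qed

lemma decseq_average_tendsto_0:
  fixes u :: "nat \<Rightarrow> real"
  assumes u: "decseq u" "u \<longlonglongrightarrow> 0"
  shows "(\<lambda>n. (c + (\<Sum>j<n. u j)) / real n) \<longlonglongrightarrow> 0"
proof -
  have nonneg: "0 \<le> u n" for n using decseq_ge[OF u] .
  have bound: "(\<Sum>j<n. u j) \<le> real m * u 0 + real n * u m" for n m
  proof -
    have "(\<Sum>j<n. u j) \<le> (\<Sum>j<n. (if j < m then u 0 else 0) + u m)"
    proof (intro sum_mono)
      fix j show "u j \<le> (if j < m then u 0 else 0) + u m"
        using decseqD[OF u(1), of 0 j] decseqD[OF u(1), of m j] nonneg[of m] by auto
    qed
    also have "\<dots> = real (card ({..<n} \<inter> {j. j < m})) * u 0 + real n * u m"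
      by (simp add: sum.distrib sum.If_cases)
    also have "real (card ({..<n} \<inter> {j. j < m})) * u 0 \<le> real m * u 0"
      using nonneg card_mono[of "{..<m}" "{..<n} \<inter> {j. j < m}"]
      by (intro mult_right_mono) auto
    finally show ?thesis by simp
  qed
  have "(\<lambda>n. (\<Sum>j<n. u j) / real n) \<longlonglongrightarrow> 0"
  proof (rule order_tendstoI)
    fix a :: real assume "a < 0"
    then show "\<forall>\<^sub>F n in sequentially. a < (\<Sum>j<n. u j) / real n"
      using nonneg by (auto intro!: always_eventually less_le_trans[of a 0] divide_nonneg_nonneg sum_nonneg)
  next
    fix a :: real assume a: "a > 0"
    have "\<forall>\<^sub>F m in sequentially. u m < a / 2"
      using u(2) a by (intro order_tendstoD) auto
    then obtain m where m: "u m < a / 2" by (auto simp: eventually_sequentially)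
    have "(\<lambda>n. real m * u 0 / real n) \<longlonglongrightarrow> 0" by real_asymp
    then have "\<forall>\<^sub>F n in sequentially. real m * u 0 / real n < a / 2"
      using a by (intro order_tendstoD) auto
    then show "\<forall>\<^sub>F n in sequentially. (\<Sum>j<n. u j) / real n < a"
      using eventually_gt_at_top[of 0]
    proof eventually_elim
      case (elim n)
      have "(\<Sum>j<n. u j) / real n \<le> (real m * u 0 + real n * u m) / real n"
        by (intro divide_right_mono bound) auto
      also have "\<dots> = real m * u 0 / real n + u m" using elim by (simp add: add_divide_distrib)
      finally show ?case using elim m by linarith
    qed
  qed
  moreover have "(\<lambda>n. c / real n) \<longlonglongrightarrow> 0" by real_asymp
  ultimately show ?thesis
    using tendsto_add[of "\<lambda>n. c / real n" 0 _ "\<lambda>n. (\<Sum>j<n. u j) / real n" 0]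
    by (simp add: add_divide_distrib)
qed

text \<open>One constant serves every f and every n. The shift by 3 keeps the logarithm positive
  from n = 0 on.\<close>

lemma admissible_uniform_bound:
  obtains C where "C > 0"
    "\<And>f n. admissible f \<Longrightarrow> ln (real n + 3) * (P1 ^^ n) f 1 \<le> C * integral {0..1} f"
proof -
  have ev: "\<forall>\<^sub>F n in sequentially. ln (real n + 3) \<le> 2 * ln (real n)" by real_asymp
  from eventually_conj[OF this admissible_upper_bound[of "1/4"]]
  obtain n0 where n0: "\<And>n. n \<ge> n0 \<Longrightarrow> ln (real n + 3) \<le> 2 * ln (real n)"
      "\<And>n f. n \<ge> n0 \<Longrightarrow> admissible f \<Longrightarrow> ln (real n) * (P1 ^^ n) f 1 \<le> 5/2 * integral {0..1} f"
    by (auto simp: eventually_sequentially)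
  \<comment> \<open>With e = 1/4 the upper bound has the constant 5/2, doubled by replacing ln (n +
    3) with 2 * ln n. The finitely many n below n0 are covered by the second entry, since the value
    at 1 never exceeds the integral.\<close>
  define C where "C = max 5 (ln (real n0 + 3))"
  show ?thesis
  proof (rule that)
    show "C > 0" by (simp add: C_def)
    fix f n assume f: "admissible f"
    have I: "0 \<le> integral {0..1} f"
      using admissible_at_1_le_integral[OF f] admissible_nonneg[OF f, of 1] by simp
    have u: "0 \<le> (P1 ^^ n) f 1" using admissible_nonneg[OF admissible_P1_pow[OF f]] by simp
    show "ln (real n + 3) * (P1 ^^ n) f 1 \<le> C * integral {0..1} f"
    proof (cases "n \<ge> n0")
      case True
      have "ln (real n + 3) * (P1 ^^ n) f 1 \<le> 2 * ln (real n) * (P1 ^^ n) f 1"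
        by (intro mult_right_mono n0 True u)
      also have "\<dots> \<le> 5 * integral {0..1} f" using n0(2)[OF True f] by simp
      also have "\<dots> \<le> C * integral {0..1} f" using I by (intro mult_right_mono) (auto simp: C_def)
      finally show ?thesis .
    next
      case False
      have "(P1 ^^ n) f 1 \<le> (P1 ^^ 0) f 1"
        using decseqD[OF admissible_P1_pow_1_decseq[OF f], of 0 n] by simp
      then have "(P1 ^^ n) f 1 \<le> integral {0..1} f" using admissible_at_1_le_integral[OF f] by simp
      then show ?thesis using False u by (intro mult_mono) (auto simp: C_def le_max_iff_disj)
    qed
  qed
qed

lemma admissible_tendsto_at_1:
  assumes f: "admissible f"
  shows "(\<lambda>n. ln (real n) * (P1 ^^ n) f 1) \<longlonglongrightarrow> integral {0..1} f"
proof -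
  let ?I = "integral {0..1} f" and ?u = "\<lambda>n. (P1 ^^ n) f 1"
  obtain C where C: "C > 0" "\<And>f n. admissible f \<Longrightarrow> ln (real n + 3) * (P1 ^^ n) f 1 \<le> C * integral {0..1} f"
    using admissible_uniform_bound by blast
  have lim: "(\<lambda>n. c / ln (real n + 3)) \<longlonglongrightarrow> 0" for c :: real by real_asymp
  have "?u \<longlonglongrightarrow> 0"
  proof (rule tendsto_sandwich[where f = "\<lambda>_. 0" and h = "\<lambda>n. C * ?I / ln (real n + 3)"])
    show "(\<lambda>n. C * ?I / ln (real n + 3)) \<longlonglongrightarrow> 0" by (rule lim)
    show "\<forall>\<^sub>F n in sequentially. ?u n \<le> C * ?I / ln (real n + 3)"
      using C(2)[OF f] by (intro always_eventually allI) (simp add: field_simps)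
    show "\<forall>\<^sub>F n in sequentially. 0 \<le> ?u n"
      using admissible_nonneg[OF admissible_P1_pow[OF f]] by simp
  qed auto
  then have avg: "(\<lambda>n. (f 0 + (\<Sum>j<n. ?u j)) / real n) \<longlonglongrightarrow> 0"
    by (intro decseq_average_tendsto_0 admissible_P1_pow_1_decseq f)
  show ?thesis
  proof (rule order_tendstoI)
    fix a assume "a < ?I"
    then have "\<forall>\<^sub>F n in sequentially. (f 0 + (\<Sum>j<n. ?u j)) / real n < ?I - a"
      using avg by (intro order_tendstoD) auto
    then show "\<forall>\<^sub>F n in sequentially. a < ln (real n) * ?u n"
      using eventually_ge_at_top[of 1]
      by eventually_elim (use admissible_lower_bound[OF f] in fastforce)
  next
    fix a assume a: "?I < a"
    have "((\<lambda>e. (1 + e) / (1 - 2 * e) * ?I) \<longlongrightarrow> (1 + 0) / (1 - 2 * 0) * ?I) (at_right 0)"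
      by (intro tendsto_intros) auto
    then have "\<forall>\<^sub>F e in at_right 0. (1 + e) / (1 - 2 * e) * ?I < a"
      using a by (intro order_tendstoD(2)) auto
    moreover have "\<forall>\<^sub>F e in at_right (0::real). e \<in> {0<..<1/2}"
      by (rule eventually_at_right_real) auto
    ultimately have "\<forall>\<^sub>F e in at_right 0. (1 + e) / (1 - 2 * e) * ?I < a \<and> 0 < e \<and> e < 1/2"
      by eventually_elim auto
    then obtain e where e: "(1 + e) / (1 - 2 * e) * ?I < a" "0 < e" "e < 1/2"
      using eventually_happens'[OF trivial_limit_at_right_real] by blast
    show "\<forall>\<^sub>F n in sequentially. ln (real n) * ?u n < a"
      using admissible_upper_bound[OF e(2,3)] by eventually_elim (use e f in fastforce)
  qed
qed

lemma tendsto_ln_shift: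
  assumes "(\<lambda>n. ln (real n) * u n) \<longlonglongrightarrow> l"
  shows "(\<lambda>n. ln (real n) * u (n + m)) \<longlonglongrightarrow> l"
proof -
  have 1: "(\<lambda>n. ln (real (n + m)) * u (n + m)) \<longlonglongrightarrow> l"
    using assms by (rule LIMSEQ_ignore_initial_segment)
  have 2: "(\<lambda>n. ln (real n) / ln (real (n + m))) \<longlonglongrightarrow> 1" by real_asymp
  have "\<forall>\<^sub>F n in sequentially. ln (real n) / ln (real (n + m)) * (ln (real (n + m)) * u (n + m))
      = ln (real n) * u (n + m)"
    using eventually_gt_at_top[of 1] by eventually_elim auto
  with tendsto_mult[OF 2 1] show ?thesis by (simp add: tendsto_cong)
qed

section \<open>Equidistribution of preimages of \<open>1/k\<close>\<close>

definition equidist :: "nat \<Rightarrow> (real \<Rightarrow> real) \<Rightarrow> bool" where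
  "equidist k f \<longleftrightarrow>
     (\<lambda>n. ln (real n) * (P1 ^^ n) f (1 / real k)) \<longlonglongrightarrow> real k * integral {0..1} f"

text \<open>The recursion of \<open>P1\<close> at 1/k determines the value at 1/(k + 1) once the
  other preimage y = k/(k + 1) is known. As y lies in [1/2, 1], y times the iterate at y is squeezed
  between the values at 1 for times n + 1 and n.\<close>

lemma admissible_equidist:
  assumes f: "admissible f" and k: "k \<ge> 1"
  shows "equidist k f"
  using k
proof (induction k rule: nat_induct_at_least)
  case base
  show ?case using admissible_tendsto_at_1[OF f] by (simp add: equidist_def)
next
  case (Suc k)
  let ?I = "integral {0..1} f"
  define K where "K = real k"
  have K: "K \<ge> 1" "real (Suc k) = K + 1" using Suc.hyps by (auto simp: K_def)
  have 1: "(\<lambda>n. ln (real n) * (P1 ^^ (n + 1)) f (1 / K)) \<longlonglongrightarrow> K * ?I"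
    using Suc.IH unfolding equidist_def K_def by (rule tendsto_ln_shift)
  let ?y = "K / (K + 1)"
  have y: "1/2 \<le> ?y" "?y \<le> 1" using K by (auto simp: field_simps)
  have 2: "(\<lambda>n. ln (real n) * (?y * (P1 ^^ n) f ?y)) \<longlonglongrightarrow> ?I"
  proof (rule tendsto_sandwich)
    show "(\<lambda>n. ln (real n) * (P1 ^^ (n + 1)) f 1) \<longlonglongrightarrow> ?I"
      by (rule tendsto_ln_shift[OF admissible_tendsto_at_1[OF f]])
    show "(\<lambda>n. ln (real n) * (P1 ^^ n) f 1) \<longlonglongrightarrow> ?I" by (rule admissible_tendsto_at_1[OF f])
    show "\<forall>\<^sub>F n in sequentially. ln (real n) * (P1 ^^ (n + 1)) f 1 \<le> ln (real n) * (?y * (P1 ^^ n) f ?y)"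
      using eventually_ge_at_top[of 1]
    proof eventually_elim
      case (elim n)
      have "1/2 * (P1 ^^ n) f (1/2) \<le> ?y * (P1 ^^ n) f ?y"
        using y by (intro admissible_mono admissible_P1_pow f) auto
      then have "(P1 ^^ (n + 1)) f 1 \<le> ?y * (P1 ^^ n) f ?y"
        using P1_pow_at_1[of n f] unfolding Suc_eq_plus1 by linarith
      then show ?case using elim by (intro mult_left_mono) auto
    qed
    show "\<forall>\<^sub>F n in sequentially. ln (real n) * (?y * (P1 ^^ n) f ?y) \<le> ln (real n) * (P1 ^^ n) f 1"
      using eventually_ge_at_top[of 1]
    proof eventually_elim
      case (elim n)
      have "?y * (P1 ^^ n) f ?y \<le> 1 * (P1 ^^ n) f 1"
        using y K by (intro admissible_mono admissible_P1_pow f) auto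
      then show ?case using elim by (intro mult_left_mono) auto
    qed
  qed
  have e: "(P1 ^^ n) f (1 / (K + 1))
      = (K + 1)\<^sup>2 / K\<^sup>2 * (P1 ^^ (n + 1)) f (1 / K) - (K + 1) / K * (?y * (P1 ^^ n) f ?y)" for n
  proof -
    have e: "1 / K / (1 + 1 / K) = 1 / (K + 1)" "1 / (1 + 1 / K) = K / (K + 1)"
      using K by (auto simp: field_simps)
    have "1 + 1 / K = (K + 1) / K" using K by (simp add: field_simps)
    then have "(1 + 1 / K)\<^sup>2 = (K + 1)\<^sup>2 / K\<^sup>2" by (simp add: power_divide)
    then have "(K + 1)\<^sup>2 / K\<^sup>2 * (P1 ^^ Suc n) f (1 / K) = (P1 ^^ n) f (1 / (K + 1)) + (P1 ^^ n) f ?y"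
      unfolding P1_pow_Suc e using K by simp
    then show ?thesis using K by simp
  qed
  have "(\<lambda>n. (K + 1)\<^sup>2 / K\<^sup>2 * (ln (real n) * (P1 ^^ (n + 1)) f (1 / K))
      - (K + 1) / K * (ln (real n) * (?y * (P1 ^^ n) f ?y)))
    \<longlonglongrightarrow> (K + 1)\<^sup>2 / K\<^sup>2 * (K * ?I) - (K + 1) / K * ?I"
    by (intro tendsto_intros 1 2)
  moreover have "(K + 1)\<^sup>2 / K\<^sup>2 * (K * ?I) - (K + 1) / K * ?I = (K + 1) * ?I"
    using K by (simp add: field_simps power2_eq_square)
  ultimately show ?case
    unfolding equidist_def K(2) e by (simp add: algebra_simps)
qed

section \<open>From admissible to continuous functions\<close>

lemma goodI:
  assumes "continuous_on {0..1} f"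
    and D1: "\<And>x. x \<in> {0..1} \<Longrightarrow> ((\<lambda>x. x * f x) has_real_derivative g' x) (at x)"
    and D2: "\<And>x. x \<in> {0..1} \<Longrightarrow> (g' has_real_derivative g'' x) (at x)"
    and "\<And>x. x \<in> {0..1} \<Longrightarrow> g' x \<ge> 0" "\<And>x. x \<in> {0..1} \<Longrightarrow> g'' x \<le> 0"
  shows "admissible f"
  unfolding admissible_def
proof (intro conjI)
  show "mono_on {0..1} (\<lambda>x. x * f x)"
  proof (intro monotone_onI)
    fix x y :: real assume xy: "x \<in> {0..1}" "y \<in> {0..1}" "x \<le> y"
    show "x * f x \<le> y * f y"
    proof (rule DERIV_nonneg_imp_nondecreasing[OF xy(3), of "\<lambda>x. x * f x"])
      fix z assume "x \<le> z" "z \<le> y"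
      then have "z \<in> {0..1}" using xy by auto
      then show "\<exists>D. ((\<lambda>x. x * f x) has_real_derivative D) (at z) \<and> 0 \<le> D"
        using assms by blast
    qed
  qed
  show "concave_on {0..1} (\<lambda>x. x * f x)"
    unfolding concave_on_def
  proof (rule f''_ge0_imp_convex[where f' = "\<lambda>x. - g' x" and f'' = "\<lambda>x. - g'' x"])
    fix x :: real assume x: "x \<in> {0..1}"
    show "((\<lambda>x. - (x * f x)) has_real_derivative - g' x) (at x)"
      using D1[OF x] by (rule DERIV_minus)
    show "((\<lambda>x. - g' x) has_real_derivative - g'' x) (at x)"
      using D2[OF x] by (rule DERIV_minus)
  qed (use assms in auto)
qed (use assms in auto)

lemma admissible_const_1: "admissible (\<lambda>x. 1)"
  by (rule goodI[where g' = "\<lambda>x. 1" and g'' = "\<lambda>x. 0"]) (auto intro!: derivative_eq_intros)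

text \<open>A power x ^ m has the wrong convexity, so it is subtracted from a constant. The
  coefficient 1 / (m + 1) gives x * f x the derivative 1 - x ^ m, which stays nonnegative up to x =
  1. With constants these functions span all polynomials.\<close>

lemma admissible_one_minus_power: "admissible (\<lambda>x. 1 - x ^ m / real (Suc m))"
proof (rule goodI[where g' = "\<lambda>x. 1 - x ^ m" and g'' = "\<lambda>x. - (real m * x ^ (m - 1))"])
  fix x :: real assume x: "x \<in> {0..1}"
  have e: "(\<lambda>x. x * (1 - x ^ m / real (Suc m))) = (\<lambda>x. x - x ^ Suc m / real (Suc m))"
    by (auto simp: algebra_simps)
  show "((\<lambda>x. x * (1 - x ^ m / real (Suc m))) has_real_derivative 1 - x ^ m) (at x)"
    unfolding e by (rule derivative_eq_intros refl | simp)+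
  show "((\<lambda>x. 1 - x ^ m) has_real_derivative - (real m * x ^ (m - 1))) (at x)"
    by (auto intro!: derivative_eq_intros)
  show "1 - x ^ m \<ge> 0" using x by (simp add: power_le_one)
qed (auto intro!: continuous_intros)

text \<open>The shift by r restores continuity at 0. After a power of x + r is factored out of each
  derivative, both signs reduce to p * x \<le> x.\<close>

lemma admissible_shifted_powr:
  assumes r: "0 < r" and p: "0 < p" "p < 1"
  shows "admissible (\<lambda>x. (x + r) powr (- p))"
proof -
  define A B where "A = - p - 1" and "B = - p - 2"
  have AB: "- p - 1 = A" "A - 1 = B" "1 + A = - p" "1 + B = A" by (simp_all add: A_def B_def)
  show ?thesis
  proof (rule goodI[where g' = "\<lambda>x. (x + r) powr (- p) - p * (x * (x + r) powr A)"
        and g'' = "\<lambda>x. p * ((p + 1) * x * (x + r) powr B) - 2 * p * (x + r) powr A"])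
    fix x :: real assume x: "x \<in> {0..1}"
    have xr: "x + r > 0" using x r by auto
    have D: "((\<lambda>x. (x + r) powr q) has_real_derivative q * (x + r) powr (q - 1)) (at x)" for q
      using DERIV_fun_powr[of "\<lambda>x. x + r" 1 x q] xr by (auto intro!: derivative_eq_intros)
    have D1: "((\<lambda>x. (x + r) powr (- p)) has_real_derivative (- p) * (x + r) powr A) (at x)"
      using D[of "- p"] unfolding AB .
    have D2: "((\<lambda>x. (x + r) powr A) has_real_derivative A * (x + r) powr B) (at x)"
      using D[of A] unfolding AB .
    show "((\<lambda>x. x * (x + r) powr (- p)) has_real_derivative
        (x + r) powr (- p) - p * (x * (x + r) powr A)) (at x)"
      by (rule DERIV_cong, (rule D1 DERIV_mult DERIV_ident)+) simp
    show "((\<lambda>x. (x + r) powr (- p) - p * (x * (x + r) powr A)) has_real_derivative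
        p * ((p + 1) * x * (x + r) powr B) - 2 * p * (x + r) powr A) (at x)"
      by (rule DERIV_cong, (rule D1 D2 DERIV_diff DERIV_cmult DERIV_mult DERIV_ident)+)
        (simp add: A_def algebra_simps)
    have 1: "(x + r) powr (- p) = (x + r) * (x + r) powr A"
      using powr_mult_base[of "x + r" A] xr unfolding AB by simp
    have 2: "(x + r) powr A = (x + r) * (x + r) powr B"
      using powr_mult_base[of "x + r" B] xr unfolding AB by simp
    have px: "p * x \<le> x" using x p by (simp add: mult_left_le_one_le)
    have "0 \<le> ((x + r) - p * x) * (x + r) powr A"
      using px r by (intro mult_nonneg_nonneg) auto
    then show "(x + r) powr (- p) - p * (x * (x + r) powr A) \<ge> 0"
      unfolding 1 by (simp only: left_diff_distrib mult.assoc)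
    have "0 \<le> p * ((2 * (x + r) - (p + 1) * x) * (x + r) powr B)"
      using px r p x by (intro mult_nonneg_nonneg) (auto simp: algebra_simps)
    then show "p * ((p + 1) * x * (x + r) powr B) - 2 * p * (x + r) powr A \<le> 0"
      unfolding 2 by (simp only: left_diff_distrib right_diff_distrib mult.assoc mult.left_commute)
  qed (use r in \<open>auto intro!: continuous_intros\<close>)
qed

lemma equidist_add:
  assumes "continuous_on {0..1} f" "continuous_on {0..1} g" "equidist k f" "equidist k g"
  shows "equidist k (\<lambda>x. f x + g x)"
proof -
  have "integral {0..1} (\<lambda>x. f x + g x) = integral {0..1} f + integral {0..1} g"
    by (intro Henstock_Kurzweil_Integration.integral_add integrable_continuous_real assms)
  then show ?thesis
    using tendsto_add[OF assms(3,4)[unfolded equidist_def]]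
    by (simp add: equidist_def P1_pow_add distrib_left)
qed

lemma equidist_cmult: "equidist k f \<Longrightarrow> equidist k (\<lambda>x. c * f x)"
  unfolding equidist_def P1_pow_cmult
  by (drule tendsto_mult_left[of _ _ _ c]) (simp add: mult.left_commute)

lemma equidist_power:
  assumes "k \<ge> 1"
  shows "equidist k (\<lambda>x. x ^ m)"
proof -
  have "equidist k (\<lambda>x. 1 + (-1) * (1 - x ^ m / real (Suc m)))"
    by (intro equidist_add equidist_cmult admissible_equidist admissible_const_1 admissible_one_minus_power assms
        continuous_intros) auto
  then have "equidist k (\<lambda>x. real (Suc m) * (1 + (-1) * (1 - x ^ m / real (Suc m))))"
    by (rule equidist_cmult)
  moreover have "(\<lambda>x. real (Suc m) * (1 + (-1) * (1 - x ^ m / real (Suc m)))) = (\<lambda>x. x ^ m)"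
    by (simp add: fun_eq_iff field_simps)
  ultimately show ?thesis by simp
qed

lemma equidist_polynomial:
  assumes "k \<ge> 1"
  shows "equidist k (\<lambda>x. \<Sum>i\<le>n. a i * x ^ i)"
proof (induction n)
  case 0
  show ?case using equidist_cmult[OF equidist_power[OF assms, of 0], of "a 0"] by simp
next
  case (Suc n)
  show ?case
    unfolding sum.atMost_Suc
    by (intro equidist_add Suc equidist_cmult equidist_power assms continuous_intros)
qed

theorem equidist_continuous:
  assumes f: "continuous_on {0..1} f" and k: "k \<ge> 1"
  shows "equidist k f"
  unfolding equidist_def
proof (rule LIMSEQ_I)
  fix r :: real assume r: "r > 0"
  let ?x = "1 / real k" and ?I = "integral {0..1}"
  have x: "?x \<in> {0..1}" using k by auto
  \<comment> \<open>An error e in f changes the scaled iterate by at most 2 * k * e = r/2 and the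
    limit by at most k * e = r/4; the last r/4 is left for the convergence of the
    polynomial.\<close>
  define e where "e = r / (4 * real k)"
  have e: "e > 0" using r k by (simp add: e_def)
  obtain p where p: "real_polynomial_function p" "\<And>x. x \<in> {0..1} \<Longrightarrow> \<bar>f x - p x\<bar> < e"
    using Stone_Weierstrass_real_polynomial_function[OF _ f e] by auto
  have near: "f x \<le> p x + e * 1" "p x \<le> f x + e * 1" if "x \<in> {0..1}" for x
    using p(2)[OF that] by linarith+
  obtain a N where pa: "p = (\<lambda>x. \<Sum>i\<le>N. a i * x ^ i)"
    using p(1) unfolding real_polynomial_function_iff_sum by blast
  have contp: "continuous_on {0..1} p" unfolding pa by (intro continuous_intros)
  have "equidist k p" unfolding pa by (rule equidist_polynomial[OF k])
  then have "\<forall>\<^sub>F n in sequentially. \<bar>ln (real n) * (P1 ^^ n) p ?x - real k * ?I p\<bar> < r / 4"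
    using r unfolding equidist_def dist_real_def[symmetric] by (intro tendstoD) auto
  moreover have "equidist k (\<lambda>x. 1)" by (rule admissible_equidist[OF admissible_const_1 k])
  then have "\<forall>\<^sub>F n in sequentially. ln (real n) * (P1 ^^ n) (\<lambda>x. 1) ?x < 2 * real k"
    using k unfolding equidist_def by (intro order_tendstoD) auto
  ultimately have "\<forall>\<^sub>F n in sequentially. norm (ln (real n) * (P1 ^^ n) f ?x - real k * ?I f) < r"
    using eventually_ge_at_top[of 1]
  proof eventually_elim
    case (elim n)
    have ln: "ln (real n) \<ge> 0" using elim by simp
    have "(P1 ^^ n) f ?x \<le> (P1 ^^ n) (\<lambda>x. p x + e * 1) ?x"
      by (rule P1_pow_mono[OF branch_closed_Icc near(1) x])
    then have 1: "ln (real n) * ((P1 ^^ n) f ?x - (P1 ^^ n) p ?x) \<le> ln (real n) * (e * (P1 ^^ n) (\<lambda>x. 1) ?x)"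
      unfolding P1_pow_add P1_pow_cmult using ln by (intro mult_left_mono) auto
    have "(P1 ^^ n) p ?x \<le> (P1 ^^ n) (\<lambda>x. f x + e * 1) ?x"
      by (rule P1_pow_mono[OF branch_closed_Icc near(2) x])
    then have 2: "ln (real n) * ((P1 ^^ n) p ?x - (P1 ^^ n) f ?x) \<le> ln (real n) * (e * (P1 ^^ n) (\<lambda>x. 1) ?x)"
      unfolding P1_pow_add P1_pow_cmult using ln by (intro mult_left_mono) auto
    have "ln (real n) * (e * (P1 ^^ n) (\<lambda>x. 1) ?x) = e * (ln (real n) * (P1 ^^ n) (\<lambda>x. 1) ?x)"
      by simp
    also have "\<dots> \<le> e * (2 * real k)" using elim e by (intro mult_left_mono) auto
    also have "\<dots> = r / 2" using k by (simp add: e_def)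
    finally have 3: "ln (real n) * (e * (P1 ^^ n) (\<lambda>x. 1) ?x) \<le> r / 2" .
    have "\<bar>?I f - ?I p\<bar> = \<bar>?I (\<lambda>x. f x - p x)\<bar>"
      using f contp by (simp add: Henstock_Kurzweil_Integration.integral_diff integrable_continuous_real)
    also have "\<dots> \<le> e * (1 - 0)"
      unfolding real_norm_def[symmetric] using p(2)
      by (intro integral_bound continuous_intros f contp) (auto intro: less_imp_le)
    finally have "real k * \<bar>?I f - ?I p\<bar> \<le> real k * e" by (intro mult_left_mono) auto
    also have "\<dots> = r / 4" using k by (simp add: e_def)
    finally have 4: "\<bar>real k * ?I f - real k * ?I p\<bar> \<le> r / 4"
      by (simp add: right_diff_distrib[symmetric] abs_mult)
    have "\<bar>ln (real n) * (P1 ^^ n) f ?x - ln (real n) * (P1 ^^ n) p ?x\<bar> \<le> r / 2"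
      using 1 2 3 unfolding right_diff_distrib by linarith
    then show ?case using 4 elim(1) unfolding real_norm_def by linarith
  qed
  then show "\<exists>no. \<forall>n\<ge>no. norm (ln (real n) * (P1 ^^ n) f ?x - real k * ?I f) < r"
    by (simp add: eventually_sequentially)
qed

section \<open>Iterates of negative powers\<close>

lemma P1_pow_tendsto:
  assumes "branch_closed S" "\<And>x. x \<in> S \<Longrightarrow> ((\<lambda>r. f r x) \<longlongrightarrow> g x) F" "x \<in> S"
  shows "((\<lambda>r. (P1 ^^ n) (f r) x) \<longlongrightarrow> (P1 ^^ n) g x) F"
  using assms(3)
proof (induction n arbitrary: x)
  case (Suc n)
  then show ?case
    using assms(1) unfolding P1_pow_Suc branch_closed_def
    by (intro tendsto_intros) force+
qed (use assms in auto)

lemma integral_shifted_powr_le: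
  fixes p r :: real
  assumes "0 < r" "r \<le> 1" "0 < p" "p < 1"
  shows "integral {0..1} (\<lambda>x. (x + r) powr (- p)) \<le> 2 / (1 - p)"
proof -
  have "((\<lambda>x. (x + r) powr (- p)) has_integral
      ((1 + r) powr (1 - p) / (1 - p) - (0 + r) powr (1 - p) / (1 - p))) {0..1}"
  proof (rule fundamental_theorem_of_calculus[where f = "\<lambda>x. (x + r) powr (1 - p) / (1 - p)"])
    fix x :: real assume "x \<in> {0..1}"
    then have "x + r > 0" using assms by auto
    then have "((\<lambda>x. (x + r) powr (1 - p)) has_real_derivative (1 - p) * (x + r) powr (- p)) (at x within {0..1})"
      using DERIV_fun_powr[of "\<lambda>x. x + r" 1 x "1 - p"]
      by (auto intro!: derivative_eq_intros intro: has_field_derivative_at_within)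
    from DERIV_cdivide[OF this, of "1 - p"]
    show "((\<lambda>x. (x + r) powr (1 - p) / (1 - p)) has_vector_derivative (x + r) powr (- p)) (at x within {0..1})"
      using assms by (simp add: has_real_derivative_iff_has_vector_derivative)
  qed simp
  then have "integral {0..1} (\<lambda>x. (x + r) powr (- p))
     = ((1 + r) powr (1 - p) - r powr (1 - p)) / (1 - p)"
    by (simp add: integral_unique diff_divide_distrib)
  also have "\<dots> \<le> (1 + r) powr 1 / (1 - p)"
    using assms by (intro divide_right_mono order.trans[OF _ powr_mono[of "1 - p" 1 "1 + r"]]) auto
  also have "\<dots> \<le> 2 / (1 - p)" using assms by (intro divide_right_mono) auto
  finally show ?thesis .
qed

text \<open>The uniform bound passes to the limit r \<rightarrow> 0, because the integrals of the
  shifted powers are bounded independently of r. Pointwise convergence holds on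
  \<open>{0<..1}\<close> and is enough, an iterate being a finite combination of point
  values.\<close>

lemma P1_pow_powr_bound:
  assumes p: "0 < p" "p < 1"
  obtains C where "C > 0"
    "\<And>n k. k \<ge> 1 \<Longrightarrow> (P1 ^^ n) (\<lambda>x. x powr (- p)) (1 / real k) \<le> C * real k / ln (real n + 3)"
proof -
  obtain C where C: "C > 0" "\<And>f n. admissible f \<Longrightarrow> ln (real n + 3) * (P1 ^^ n) f 1 \<le> C * integral {0..1} f"
    using admissible_uniform_bound by blast
  show ?thesis
  proof (rule that[of "C * (2 / (1 - p))"])
    show "C * (2 / (1 - p)) > 0" using C p by simp
    fix n k :: nat assume k: "k \<ge> 1"
    have ln: "ln (real n + 3) > 0" by simp
    have lim: "((\<lambda>r. (P1 ^^ n) (\<lambda>x. (x + r) powr (- p)) (1 / real k)) \<longlongrightarrow>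
        (P1 ^^ n) (\<lambda>x. x powr (- p)) (1 / real k)) (at_right 0)"
    proof (rule P1_pow_tendsto[OF branch_closed_Ioc])
      fix x :: real assume "x \<in> {0<..1}"
      then have "((\<lambda>r. (x + r) powr (- p)) \<longlongrightarrow> (x + 0) powr (- p)) (at_right 0)"
        by (intro tendsto_intros) auto
      then show "((\<lambda>r. (x + r) powr (- p)) \<longlongrightarrow> x powr (- p)) (at_right 0)" by simp
    qed (use k in auto)
    have "\<forall>\<^sub>F r in at_right (0::real). r \<in> {0<..<1}"
      by (rule eventually_at_right_real) auto
    then have ev: "\<forall>\<^sub>F r in at_right 0. (P1 ^^ n) (\<lambda>x. (x + r) powr (- p)) (1 / real k)
        \<le> C * (2 / (1 - p)) * real k / ln (real n + 3)"
    proof eventually_elim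
      case (elim r)
      let ?f = "\<lambda>x. (x + r) powr (- p)"
      have admissible: "admissible ?f" using elim p by (intro admissible_shifted_powr) auto
      have "1 / real k * (P1 ^^ n) ?f (1 / real k) \<le> 1 * (P1 ^^ n) ?f 1"
        using k by (intro admissible_mono admissible_P1_pow admissible) auto
      then have 1: "(P1 ^^ n) ?f (1 / real k) \<le> real k * (P1 ^^ n) ?f 1"
        using k by (simp add: field_simps)
      have "ln (real n + 3) * (P1 ^^ n) ?f 1 \<le> C * integral {0..1} ?f"
        by (rule C(2)[OF admissible])
      also have "\<dots> \<le> C * (2 / (1 - p))"
        using elim p C(1) by (intro mult_left_mono integral_shifted_powr_le) auto
      finally have "(P1 ^^ n) ?f 1 \<le> C * (2 / (1 - p)) / ln (real n + 3)"
        unfolding pos_le_divide_eq[OF ln] by (simp only: mult.commute)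
      then have "real k * (P1 ^^ n) ?f 1 \<le> real k * (C * (2 / (1 - p)) / ln (real n + 3))"
        by (intro mult_left_mono) auto
      with 1 show ?case by (simp add: mult_ac)
    qed
    show "(P1 ^^ n) (\<lambda>x. x powr (- p)) (1 / real k) \<le> C * (2 / (1 - p)) * real k / ln (real n + 3)"
      by (rule tendsto_upperbound[OF lim ev]) auto
  qed
qed

section \<open>The orbit of \<open>\<beta>\<close> and its inverse branches\<close>

definition branch :: "bool \<Rightarrow> real \<Rightarrow> real" where
  "branch b z = (if b then 1 / (1 + z) else z / (1 + z))"

lemma branch_range: "z \<in> {0..1} \<Longrightarrow> branch b z \<in> {0..1}"
  by (auto simp: branch_def divide_simps)

lemma branch_dist:
  assumes "y \<ge> 0" "z \<ge> 0"
  shows "\<bar>branch b y - branch b z\<bar> = \<bar>y - z\<bar> / ((1 + y) * (1 + z))"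
proof -
  have "branch b y - branch b z = (if b then z - y else y - z) / ((1 + y) * (1 + z))"
    using assms by (simp add: branch_def divide_simps) (simp add: algebra_simps)
  then show ?thesis using assms by (auto simp: abs_mult abs_minus_commute)
qed

locale irrational_point =
  fixes \<beta> :: real
  assumes beta: "0 < \<beta>" "\<beta> < 1" "\<beta> \<notin> \<rat>"
begin

definition pt :: "nat \<Rightarrow> real" where "pt i = (farey ^^ i) \<beta>"

definition right :: "nat \<Rightarrow> bool" where "right i \<longleftrightarrow> pt i > 1/2"

text \<open>The inverse branch of \<open>farey ^^ i\<close> through \<open>\<beta>\<close> is a Moebius map whose denominator at \<open>z\<close> is
  \<open>c * z + d\<close> with \<open>(c, d) = den i\<close>.\<close>

primrec den :: "nat \<Rightarrow> real \<times> real" where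
  "den 0 = (0, 1)"
| "den (Suc i) = (if right i then (snd (den i), fst (den i) + snd (den i))
                  else (fst (den i) + snd (den i), snd (den i)))"

abbreviation cc :: "nat \<Rightarrow> real" where "cc i \<equiv> fst (den i)"
abbreviation dd :: "nat \<Rightarrow> real" where "dd i \<equiv> snd (den i)"
text \<open>The denominator at z = 1. Within a continued fraction block it runs through the
  expressions (s + 1) * \<open>cf_q\<close> + \<open>cf_qprev\<close> that bound \<open>cf_t\<close>
  (see \<open>tt_orbit\<close> and \<open>cf_t_le\<close>); this is where the type condition
  enters.\<close>

definition tt :: "nat \<Rightarrow> real" where "tt i = cc i + dd i"

primrec inv_branch :: "nat \<Rightarrow> real \<Rightarrow> real" where
  "inv_branch 0 z = z"
| "inv_branch (Suc i) z = inv_branch i (branch (right i) z)"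

lemma pt_props: "pt i \<notin> \<rat> \<and> 0 < pt i \<and> pt i < 1"
proof (induction i)
  case 0
  show ?case using beta by (simp add: pt_def)
next
  case (Suc i)
  then have y: "pt i \<notin> \<rat>" "0 < pt i" "pt i < 1" by auto
  have ne: "pt i \<noteq> 1/2" using y(1) Rats_divide[of 1 "2::real"] by (metis Rats_1 Rats_number_of)
  have S: "pt (Suc i) = farey (pt i)" by (simp add: pt_def)
  have irr: "farey (pt i) \<notin> \<rat>"
  proof
    assume r: "farey (pt i) \<in> \<rat>"
    have "pt i = (if pt i \<le> 1/2 then farey (pt i) / (1 + farey (pt i)) else 1 / (1 + farey (pt i)))"
      using y by (auto simp: farey_def field_simps)
    with r have "pt i \<in> \<rat>" by (metis Rats_1 Rats_add Rats_divide)
    then show False using y by simp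
  qed
  moreover have "0 < farey (pt i)" "farey (pt i) < 1"
    using y ne by (auto simp: farey_def field_simps)
  ultimately show ?case by (simp add: S)
qed

lemma pt_irrational: "pt i \<notin> \<rat>" and pt_pos: "0 < pt i" and pt_less_1: "pt i < 1"
  using pt_props by auto

lemma pt_neq_half: "pt i \<noteq> 1/2"
  using pt_irrational[of i] Rats_divide[of 1 "2::real"] by (metis Rats_1 Rats_number_of)

lemma pt_branch: "pt i = branch (right i) (pt (Suc i))"
proof -
  have S: "pt (Suc i) = farey (pt i)" by (simp add: pt_def)
  show ?thesis
    unfolding S using pt_pos[of i] pt_less_1[of i]
    by (auto simp: right_def branch_def farey_def field_simps)
qed

lemma den_bounds: "0 \<le> cc i \<and> 1 \<le> dd i"
  by (induction i) auto

lemma cc_nonneg: "0 \<le> cc i" and dd_ge_1: "1 \<le> dd i"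
  using den_bounds by auto

lemma den_pos: "z \<ge> 0 \<Longrightarrow> 0 < cc i * z + dd i"
  using cc_nonneg[of i] dd_ge_1[of i] by (simp add: add_nonneg_pos)

lemma tt_Suc: "tt (Suc i) = tt i + dd i"
  by (simp add: tt_def)

lemma tt_ge: "real i + 1 \<le> tt i"
proof (induction i)
  case (Suc i)
  then show ?case using dd_ge_1[of i] by (simp add: tt_Suc)
qed (simp add: tt_def)

lemma tt_pos: "0 < tt i" using tt_ge[of i] by linarith

lemma den_le_tt: "0 \<le> z \<Longrightarrow> z \<le> 1 \<Longrightarrow> cc i * z + dd i \<le> tt i"
  using mult_left_le[of z "cc i"] cc_nonneg[of i] by (simp add: tt_def)

lemma den_ge_tt: "0 \<le> z \<Longrightarrow> z \<le> 1 \<Longrightarrow> z * tt i \<le> cc i * z + dd i"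
  using mult_left_le[of z "dd i"] dd_ge_1[of i] by (simp add: tt_def algebra_simps)

lemma den_Suc_branch:
  assumes "z \<ge> 0"
  shows "cc i * branch (right i) z + dd i = (cc (Suc i) * z + dd (Suc i)) / (1 + z)"
  using assms by (simp add: branch_def divide_simps) (simp add: algebra_simps)

text \<open>This is the distance formula for a Moebius map of determinant 1 or -1. It holds for a
  single branch by \<open>branch_dist\<close>, and the denominators multiply along compositions by
  \<open>den_Suc_branch\<close>.\<close>

lemma inv_branch_dist:
  assumes "z \<in> {0..1}"
  shows "\<bar>\<beta> - inv_branch i z\<bar> = \<bar>pt i - z\<bar> / ((cc i * z + dd i) * (cc i * pt i + dd i))"
  using assms
proof (induction i arbitrary: z)
  case 0
  show ?case by (simp add: pt_def)
next
  case (Suc i)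
  let ?b = "right i" and ?y = "pt (Suc i)"
  have z: "z \<ge> 0" "1 + z > 0" using Suc.prems by auto
  have y: "?y \<ge> 0" "1 + ?y > 0" using pt_pos[of "Suc i"] by auto
  have "\<bar>\<beta> - inv_branch (Suc i) z\<bar> = \<bar>branch ?b ?y - branch ?b z\<bar>
      / ((cc i * branch ?b z + dd i) * (cc i * branch ?b ?y + dd i))"
    using Suc.IH[OF branch_range[OF Suc.prems]] pt_branch[of i] by simp
  also have "\<dots> = \<bar>?y - z\<bar> / ((1 + ?y) * (1 + z))
      / ((cc (Suc i) * z + dd (Suc i)) / (1 + z) * ((cc (Suc i) * ?y + dd (Suc i)) / (1 + ?y)))"
    unfolding den_Suc_branch[OF z(1)] den_Suc_branch[OF y(1)] branch_dist[OF y(1) z(1)] ..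
  also have "\<dots> = \<bar>?y - z\<bar> / ((cc (Suc i) * z + dd (Suc i)) * (cc (Suc i) * ?y + dd (Suc i)))"
  proof -
    have "(A / (Y * Z)) / (C / Z * (D / Y)) = A / (C * D)" if "Y \<noteq> 0" "Z \<noteq> 0" for A C D Y Z :: real
      using that by (simp add: divide_simps)
    then show ?thesis using y z by simp
  qed
  finally show ?case .
qed

text \<open>\<open>main_part i f\<close> is the summand of \<open>(P1 ^^ i) f\<close> belonging to the inverse branch through \<open>\<beta>\<close>;
  \<open>side_part i f\<close> is what splits off from it at the next application of \<open>P1\<close>.\<close>

definition main_part :: "nat \<Rightarrow> (real \<Rightarrow> real) \<Rightarrow> real \<Rightarrow> real" where
  "main_part i f z = f (inv_branch i z) / (cc i * z + dd i)\<^sup>2"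

definition side_part :: "nat \<Rightarrow> (real \<Rightarrow> real) \<Rightarrow> real \<Rightarrow> real" where
  "side_part i f z = main_part i f (branch (\<not> right i) z) / (1 + z)\<^sup>2"

lemma main_part_Suc:
  assumes "z \<ge> 0"
  shows "main_part (Suc i) f z = main_part i f (branch (right i) z) / (1 + z)\<^sup>2"
  unfolding main_part_def den_Suc_branch[OF assms] using assms
  by (simp add: power_divide)

lemma P1_main_part:
  assumes "z \<ge> 0"
  shows "P1 (main_part i f) z = main_part (Suc i) f z + side_part i f z"
  unfolding main_part_Suc[OF assms] side_part_def
  by (cases "right i") (simp_all add: P1_eq branch_def add_divide_distrib)

text \<open>What splits off at application i + 1 is transported by the remaining n - (i + 1)
  applications.\<close>

lemma P1_pow_decompose:
  assumes "x \<in> {0..1}"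
  shows "(P1 ^^ n) f x = main_part n f x + (\<Sum>i<n. (P1 ^^ (n - Suc i)) (side_part i f) x)"
  using assms
proof (induction n arbitrary: x)
  case 0
  show ?case by (simp add: main_part_def)
next
  case (Suc n)
  have "(P1 ^^ Suc n) f x = (P1 ^^ 1) ((P1 ^^ n) f) x" by simp
  also have "\<dots> = (P1 ^^ 1) (\<lambda>x. main_part n f x + (\<Sum>i<n. (P1 ^^ (n - Suc i)) (side_part i f) x)) x"
    by (rule P1_pow_cong[OF branch_closed_Icc Suc.IH Suc.prems])
  also have "\<dots> = main_part (Suc n) f x + side_part n f x
      + (\<Sum>i<n. (P1 ^^ 1) ((P1 ^^ (n - Suc i)) (side_part i f)) x)"
    unfolding P1_pow_add P1_pow_sum using Suc.prems by (simp add: P1_main_part)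
  also have "(\<Sum>i<n. (P1 ^^ 1) ((P1 ^^ (n - Suc i)) (side_part i f)) x)
      = (\<Sum>i<n. (P1 ^^ (Suc n - Suc i)) (side_part i f) x)"
  proof (intro sum.cong refl)
    fix i assume "i \<in> {..<n}"
    then have "Suc n - Suc i = Suc (n - Suc i)" by auto
    then show "(P1 ^^ 1) ((P1 ^^ (n - Suc i)) (side_part i f)) x = (P1 ^^ (Suc n - Suc i)) (side_part i f) x"
      by simp
  qed
  finally show ?case by simp
qed

end

section \<open>Continued fraction digits along the orbit\<close>

text \<open>\<open>cf_eval\<close> with the last tail left free as y: appending a digit becomes a
  substitution for y, which makes induction from the right possible.\<close>

fun cf_tail :: "nat list \<Rightarrow> rat \<Rightarrow> rat" where
  "cf_tail [] y = y"
| "cf_tail (b # bs) y = 1 / (of_nat b + cf_tail bs y)"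

lemma cf_eval_snoc: "cf_eval (xs @ [j]) = cf_tail xs (1 / of_nat j)"
  by (induction xs) simp_all

lemma cf_tail_snoc: "cf_tail (xs @ [b]) y = cf_tail xs (1 / (of_nat b + y))"
  by (induction xs) simp_all

lemma quotient_of_denom_le:
  assumes "Q > 0"
  shows "snd (quotient_of (of_nat P / of_nat Q)) \<le> int Q"
proof -
  obtain n d where nd: "quotient_of (of_nat P / of_nat Q) = (n, d)" by force
  have d: "d > 0" using quotient_of_denom_pos[OF nd] .
  have "(of_nat P / of_nat Q :: rat) = of_int n / of_int d" using quotient_of_div[OF nd] .
  then have "of_nat P * of_int d = (of_int n * of_nat Q :: rat)"
    using d assms by (simp add: field_simps)
  then have "of_int (int P * d) = (of_int (n * int Q) :: rat)" by simp
  then have "int P * d = n * int Q" unfolding of_int_eq_iff .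
  then have "d dvd n * int Q" by (metis dvd_triv_right)
  moreover have "coprime d n" using quotient_of_coprime[OF nd] by (simp add: coprime_commute)
  ultimately have "d dvd int Q" by (simp add: coprime_dvd_mult_right_iff)
  then show ?thesis using assms nd by (simp add: zdvd_imp_le)
qed

context irrational_point
begin

definition xg :: "nat \<Rightarrow> real" where "xg j = (gauss ^^ j) \<beta>"

text \<open>The Farey time at which j Gauss steps are complete; the next one takes
  \<open>cf_a \<beta> (Suc j)\<close> Farey steps.\<close>

definition blk :: "nat \<Rightarrow> nat" where "blk j = (\<Sum>m<j. cf_a \<beta> (Suc m))"

text \<open>\<open>q\<^bsub>j-1\<^esub>\<close>, with the convention \<open>q\<^bsub>-1\<^esub> = 0\<close>.\<close>

definition cf_qprev :: "nat \<Rightarrow> nat" where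
  "cf_qprev j = (case j of 0 \<Rightarrow> 0 | Suc m \<Rightarrow> cf_q \<beta> m)"

lemma xg_props: "xg j \<notin> \<rat> \<and> 0 < xg j \<and> xg j < 1"
proof (induction j)
  case 0
  show ?case using beta by (simp add: xg_def)
next
  case (Suc j)
  have S: "xg (Suc j) = 1 / xg j - of_int \<lfloor>1 / xg j\<rfloor>" by (simp add: xg_def gauss_def frac_def)
  have irr: "xg (Suc j) \<notin> \<rat>"
  proof
    assume "xg (Suc j) \<in> \<rat>"
    then have "xg (Suc j) + of_int \<lfloor>1 / xg j\<rfloor> \<in> \<rat>" by (intro Rats_add) auto
    then have "1 / xg j \<in> \<rat>" by (simp add: S)
    then have "1 / (1 / xg j) \<in> \<rat>" by (rule Rats_divide[OF Rats_1])
    then show False using Suc by simp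
  qed
  moreover have "0 \<le> xg (Suc j)" "xg (Suc j) < 1" unfolding S by linarith+
  moreover have "xg (Suc j) \<noteq> 0" using irr by auto
  ultimately show ?case by auto
qed

lemma xg_pos: "0 < xg j" and xg_less_1: "xg j < 1"
  using xg_props by auto

lemma cf_a_xg: "1 / xg j = real (cf_a \<beta> (Suc j)) + xg (Suc j)"
  and cf_a_ge_1: "cf_a \<beta> (Suc j) \<ge> 1"
proof -
  have "1 / xg j > 1" using xg_pos[of j] xg_less_1[of j] by simp
  then have fl: "\<lfloor>1 / xg j\<rfloor> \<ge> 1" by linarith
  have a: "cf_a \<beta> (Suc j) = nat \<lfloor>1 / xg j\<rfloor>" by (simp add: cf_a_def xg_def)
  show "cf_a \<beta> (Suc j) \<ge> 1" using fl unfolding a by linarith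
  have "xg (Suc j) = 1 / xg j - of_int \<lfloor>1 / xg j\<rfloor>" by (simp add: xg_def gauss_def frac_def)
  then show "1 / xg j = real (cf_a \<beta> (Suc j)) + xg (Suc j)" using fl unfolding a by (simp add: of_nat_nat del: one_le_floor)
qed

lemma cf_q_rec: "cf_q \<beta> (Suc j) = cf_a \<beta> (Suc j) * cf_q \<beta> j + cf_qprev j"
  by (cases j) (simp_all add: cf_qprev_def)

lemma cf_q_ge_1: "cf_q \<beta> j \<ge> 1"
proof (induction j)
  case (Suc j)
  have "1 * 1 \<le> cf_a \<beta> (Suc j) * cf_q \<beta> j" by (intro mult_le_mono cf_a_ge_1 Suc)
  then show ?case unfolding cf_q_rec by linarith
qed simp

lemma blk_Suc: "blk (Suc j) = blk j + cf_a \<beta> (Suc j)"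
  by (simp add: blk_def)

lemma blk_ge: "j \<le> blk j"
proof (induction j)
  case (Suc j)
  then show ?case using cf_a_ge_1[of j] by (simp add: blk_Suc)
qed simp

lemma blk_strict_mono: "strict_mono blk"
  unfolding strict_mono_Suc_iff using cf_a_ge_1 by (auto simp: blk_Suc Suc_le_eq)

text \<open>While the leading digit exceeds 1, the left branch of the Farey map sends 1/y to 1/(y -
  1), and the pair (c, d) becomes (c + d, d).\<close>

lemma orbit_step:
  assumes "pt (blk j) = xg j" "cc (blk j) = real (cf_qprev j)" "dd (blk j) = real (cf_q \<beta> j)"
    "s < cf_a \<beta> (Suc j)"
  shows "pt (blk j + s) = 1 / (1 / xg j - real s)
    \<and> cc (blk j + s) = real s * real (cf_q \<beta> j) + real (cf_qprev j)
    \<and> dd (blk j + s) = real (cf_q \<beta> j)"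
  using assms(4)
proof (induction s)
  case 0
  show ?case using assms by simp
next
  case (Suc s)
  let ?y = "1 / xg j - real s"
  have "real s + 2 \<le> real (cf_a \<beta> (Suc j))" using Suc.prems by linarith
  then have y: "?y > 2" using cf_a_xg[of j] xg_pos[of "Suc j"] by linarith
  have IH: "pt (blk j + s) = 1 / ?y" using Suc by auto
  have lt: "pt (blk j + s) < 1/2" unfolding IH using y by (simp add: field_simps)
  then have nr: "\<not> right (blk j + s)" by (simp add: right_def)
  have "pt (blk j + Suc s) = farey (1 / ?y)" using IH by (simp add: pt_def)
  also have "\<dots> = (1 / ?y) / (1 - 1 / ?y)" using lt unfolding IH by (simp add: farey_def)
  also have "\<dots> = 1 / (?y - 1)" using y by (simp add: field_simps)
  finally have "pt (blk j + Suc s) = 1 / (1 / xg j - real (Suc s))" by simp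
  then show ?case using Suc nr by (simp add: algebra_simps)
qed

text \<open>The last step of a block has leading digit 1 and takes the right branch. It removes the
  digit and turns (c, d) into (d, c + d), which is the recursion for \<open>cf_q\<close>.\<close>

lemma orbit_block:
  "pt (blk j) = xg j \<and> cc (blk j) = real (cf_qprev j) \<and> dd (blk j) = real (cf_q \<beta> j)"
proof (induction j)
  case 0
  show ?case by (simp add: blk_def pt_def xg_def cf_qprev_def)
next
  case (Suc j)
  define s where "s = cf_a \<beta> (Suc j) - 1"
  have s: "cf_a \<beta> (Suc j) = Suc s" using cf_a_ge_1[of j] by (simp add: s_def)
  have st: "pt (blk j + s) = 1 / (1 / xg j - real s)"
    "cc (blk j + s) = real s * real (cf_q \<beta> j) + real (cf_qprev j)"
    "dd (blk j + s) = real (cf_q \<beta> j)"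
    using orbit_step[of j s] Suc s by auto
  have B: "blk (Suc j) = Suc (blk j + s)" by (simp add: blk_Suc s)
  have p: "pt (blk j + s) = 1 / (1 + xg (Suc j))"
    unfolding st(1) using cf_a_xg[of j] by (simp add: s)
  have gt: "pt (blk j + s) > 1/2"
    unfolding p using xg_pos[of "Suc j"] xg_less_1[of "Suc j"] by (simp add: field_simps)
  then have r: "right (blk j + s)" by (simp add: right_def)
  have "pt (blk (Suc j)) = farey (pt (blk j + s))" unfolding B by (simp add: pt_def)
  also have "\<dots> = (1 - pt (blk j + s)) / pt (blk j + s)" using gt by (simp add: farey_def)
  also have "\<dots> = xg (Suc j)" unfolding p using xg_pos[of "Suc j"] by (simp add: field_simps)
  finally have "pt (blk (Suc j)) = xg (Suc j)" .
  moreover have "cf_qprev (Suc j) = cf_q \<beta> j" by (simp add: cf_qprev_def)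
  moreover have "real (cf_q \<beta> (Suc j)) = (1 + real s) * real (cf_q \<beta> j) + real (cf_qprev j)"
    unfolding cf_q_rec s by (simp add: algebra_simps)
  ultimately show ?case
    using st r unfolding B by (simp add: algebra_simps)
qed

lemma orbit:
  assumes "s < cf_a \<beta> (Suc j)"
  shows "pt (blk j + s) = 1 / (real (cf_a \<beta> (Suc j) - s) + xg (Suc j))"
    "cc (blk j + s) = real s * real (cf_q \<beta> j) + real (cf_qprev j)"
    "dd (blk j + s) = real (cf_q \<beta> j)"
proof -
  show "pt (blk j + s) = 1 / (real (cf_a \<beta> (Suc j) - s) + xg (Suc j))"
    using orbit_step[of j s] orbit_block[of j] assms cf_a_xg[of j] by (simp add: of_nat_diff algebra_simps)
qed (use orbit_step[of j s] orbit_block[of j] assms in auto)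

lemma tt_orbit:
  assumes "s < cf_a \<beta> (Suc j)"
  shows "tt (blk j + s) = real (Suc s * cf_q \<beta> j + cf_qprev j)"
  using orbit[OF assms] by (simp add: tt_def algebra_simps)

lemma blk_decompose: "\<exists>j s. s < cf_a \<beta> (Suc j) \<and> i = blk j + s"
proof (induction i)
  case 0
  have "0 < cf_a \<beta> (Suc 0) \<and> 0 = blk 0 + 0" using cf_a_ge_1[of 0] by (simp add: blk_def)
  then show ?case by blast
next
  case (Suc i)
  then obtain j s where js: "s < cf_a \<beta> (Suc j)" "i = blk j + s" by blast
  show ?case
  proof (cases "Suc s < cf_a \<beta> (Suc j)")
    case True
    then show ?thesis using js by (intro exI[of _ j] exI[of _ "Suc s"]) auto
  next
    case False
    then have "Suc i = blk (Suc j) + 0" using js by (simp add: blk_Suc)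
    moreover have "0 < cf_a \<beta> (Suc (Suc j))" using cf_a_ge_1[of "Suc j"] by simp
    ultimately show ?thesis by blast
  qed
qed

lemma right_orbit:
  assumes "s < cf_a \<beta> (Suc j)" "right (blk j + s)"
  shows "Suc s = cf_a \<beta> (Suc j)"
proof (rule ccontr)
  assume "Suc s \<noteq> cf_a \<beta> (Suc j)"
  then have "2 \<le> real (cf_a \<beta> (Suc j) - s)" using assms(1) by linarith
  then have "2 < real (cf_a \<beta> (Suc j) - s) + xg (Suc j)" using xg_pos[of "Suc j"] by linarith
  then have "pt (blk j + s) < 1/2" unfolding orbit(1)[OF assms(1)] by (simp add: field_simps)
  then show False using assms(2) by (simp add: right_def)
qed

text \<open>The numerators remain existential, because \<open>cf_t\<close> reads off a denominator
  only.\<close>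

lemma cf_tail_moebius:
  "\<exists>p p' :: nat. \<forall>y\<ge>0. cf_tail (map (cf_a \<beta>) [1..<Suc m]) y
     = (of_nat p' * y + of_nat p) / (of_nat (cf_qprev m) * y + of_nat (cf_q \<beta> m))"
proof (induction m)
  case 0
  show ?case by (rule exI[of _ 0], rule exI[of _ 1]) (simp add: cf_qprev_def)
next
  case (Suc m)
  then obtain p p' :: nat where p: "\<And>y. y \<ge> 0 \<Longrightarrow> cf_tail (map (cf_a \<beta>) [1..<Suc m]) y
     = (of_nat p' * y + of_nat p) / (of_nat (cf_qprev m) * y + of_nat (cf_q \<beta> m))" by blast
  let ?a = "cf_a \<beta> (Suc m)"
  have "cf_tail (map (cf_a \<beta>) [1..<Suc (Suc m)]) y
     = (of_nat p * y + of_nat (p' + p * ?a)) / (of_nat (cf_qprev (Suc m)) * y + of_nat (cf_q \<beta> (Suc m)))"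
    if y: "y \<ge> 0" for y
  proof -
    have "of_nat 1 \<le> (of_nat ?a :: rat)" using cf_a_ge_1[of m] by (intro of_nat_mono)
    then have ay: "of_nat ?a + y > 0" using y by simp
    have "cf_tail (map (cf_a \<beta>) [1..<Suc (Suc m)]) y
      = cf_tail (map (cf_a \<beta>) [1..<Suc m]) (1 / (of_nat ?a + y))"
      by (simp add: cf_tail_snoc)
    also have "\<dots> = (of_nat p' * (1 / (of_nat ?a + y)) + of_nat p)
        / (of_nat (cf_qprev m) * (1 / (of_nat ?a + y)) + of_nat (cf_q \<beta> m))"
      by (rule p) (use ay in auto)
    also have "\<dots> = ((of_nat p' * (1 / (of_nat ?a + y)) + of_nat p) * (of_nat ?a + y))
        / ((of_nat (cf_qprev m) * (1 / (of_nat ?a + y)) + of_nat (cf_q \<beta> m)) * (of_nat ?a + y))"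
      using ay by simp
    also have "(of_nat p' * (1 / (of_nat ?a + y)) + of_nat p) * (of_nat ?a + y)
        = of_nat p * y + of_nat (p' + p * ?a)"
      using ay by (simp add: field_simps)
    also have "(of_nat (cf_qprev m) * (1 / (of_nat ?a + y)) + of_nat (cf_q \<beta> m)) * (of_nat ?a + y)
        = of_nat (cf_qprev (Suc m)) * y + of_nat (cf_q \<beta> (Suc m))"
      using ay unfolding cf_q_rec by (simp add: field_simps cf_qprev_def)
    finally show ?thesis .
  qed
  then show ?case by blast
qed

text \<open>The continued fraction numerators and denominators are in fact coprime, but the inequality is all
  that matters since \<open>cf_t\<close> enters with a negative exponent.\<close>

lemma cf_t_le:
  assumes "j \<ge> 1"
  shows "cf_t \<beta> (Suc m) j \<le> int (j * cf_q \<beta> m + cf_qprev m)"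
proof -
  obtain p p' :: nat where p: "\<And>y. y \<ge> 0 \<Longrightarrow> cf_tail (map (cf_a \<beta>) [1..<Suc m]) y
     = (of_nat p' * y + of_nat p) / (of_nat (cf_qprev m) * y + of_nat (cf_q \<beta> m))"
    using cf_tail_moebius by blast
  have j: "(of_nat j :: rat) > 0" using assms by simp
  have "cf_eval (map (cf_a \<beta>) [1..<Suc m] @ [j])
      = (of_nat p' * (1 / of_nat j) + of_nat p) / (of_nat (cf_qprev m) * (1 / of_nat j) + of_nat (cf_q \<beta> m))"
    unfolding cf_eval_snoc by (rule p) simp
  also have "\<dots> = ((of_nat p' * (1 / of_nat j) + of_nat p) * of_nat j)
      / ((of_nat (cf_qprev m) * (1 / of_nat j) + of_nat (cf_q \<beta> m)) * of_nat j)"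
    using j by simp
  also have "(of_nat p' * (1 / of_nat j) + of_nat p) * of_nat j = (of_nat (p' + p * j) :: rat)"
    using j by (simp add: field_simps)
  also have "(of_nat (cf_qprev m) * (1 / of_nat j) + of_nat (cf_q \<beta> m)) * of_nat j
      = (of_nat (j * cf_q \<beta> m + cf_qprev m) :: rat)"
    using j by (simp add: field_simps)
  finally have "cf_t \<beta> (Suc m) j
      = snd (quotient_of (of_nat (p' + p * j) / of_nat (j * cf_q \<beta> m + cf_qprev m)))"
    unfolding cf_t_def by simp
  moreover have "j * cf_q \<beta> m + cf_qprev m > 0"
    using assms cf_q_ge_1[of m] by simp
  ultimately show ?thesis using quotient_of_denom_le by metis
qed

lemma cf_t_pos: "cf_t \<beta> n j > 0"
  unfolding cf_t_def by (metis prod.collapse quotient_of_denom_pos)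

end

section \<open>Contributions of the side branches\<close>

text \<open>With x = i + 2 and y = n - i + 1, both at least 2, n \<le> x + y \<le> x * y; and a sum
  of two logarithms, each at least ln 2, is at most 2 / ln 2 times their product. The product
  separates the time before leaving the orbit from the time after it.\<close>

lemma ln_le_product:
  assumes "i < n"
  shows "ln (real n) \<le> 2 / ln 2 * (ln (real i + 2) * ln (real (n - i) + 1))"
proof -
  let ?x = "real i + 2" and ?y = "real (n - i) + 1"
  have xy: "?x \<ge> 2" "?y \<ge> 2" using assms by auto
  have l: "ln 2 \<le> ln ?x" "ln 2 \<le> ln ?y" using xy by auto
  have "real n \<le> ?x + ?y" using assms by (simp add: of_nat_diff)
  also have "\<dots> \<le> ?x * ?y"
  proof -
    have "x + y \<le> x * y" if "x \<ge> 2" "y \<ge> 2" for x y :: real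
      using mult_mono[of 1 "x - 1" 1 "y - 1"] that by (simp add: algebra_simps)
    then show ?thesis using xy .
  qed
  finally have "ln (real n) \<le> ln (?x * ?y)" using assms by (subst ln_le_cancel_iff) auto
  also have "\<dots> = ln ?x + ln ?y" using xy by (intro ln_mult_pos) auto
  finally have 1: "ln (real n) \<le> ln ?x + ln ?y" .
  have "ln 2 * ln ?x \<le> ln ?x * ln ?y" "ln 2 * ln ?y \<le> ln ?x * ln ?y"
    using l ln_gt_zero[of "2::real"] mult_mono[OF l(1) order.refl[of "ln ?y"]]
      mult_mono[OF order.refl[of "ln ?x"] l(2)] by (auto simp: mult.commute)
  then have "ln 2 * ln (real n) \<le> 2 * (ln ?x * ln ?y)"
    using mult_left_mono[OF 1, of "ln 2"] ln_gt_zero[of "2::real"] unfolding distrib_left by linarith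
  then show ?thesis using pos_le_divide_eq[of "ln (2::real)"] by (simp add: mult.commute)
qed

lemma ln_le_powr:
  assumes "0 < e" "e \<le> 1" "1 \<le> t" "real i + 1 \<le> t"
  shows "ln (real i + 2) \<le> 2 / e * t powr e"
proof -
  have "ln (real i + 2) \<le> ln (2 * t)" using assms by (subst ln_le_cancel_iff) auto
  also have "\<dots> \<le> (2 * t) powr e / e" using assms by (intro ln_powr_bound) auto
  also have "\<dots> = 2 powr e / e * t powr e" using assms by (simp add: powr_mult)
  also have "\<dots> \<le> 2 powr 1 / e * t powr e"
    using assms by (intro mult_right_mono divide_right_mono powr_mono) auto
  finally show ?thesis by simp
qed

locale typed_point = irrational_point +
  fixes \<alpha> :: real
  assumes alpha: "0 < \<alpha>" "\<alpha> < 1"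
    and type: "intermediate_type \<alpha> \<beta>"
    and digits: "filterlim (cf_a \<beta>) at_top sequentially"
begin

abbreviation v :: "real \<Rightarrow> real" where "v \<equiv> vfun \<beta> \<alpha>"

lemma digits_eventually: "\<forall>\<^sub>F j in sequentially. K \<le> cf_a \<beta> (Suc j)"
proof -
  have "\<forall>\<^sub>F j in sequentially. K \<le> cf_a \<beta> j" using digits by (simp add: filterlim_at_top)
  then show ?thesis using eventually_sequentially_Suc[of "\<lambda>j. K \<le> cf_a \<beta> j"] by simp
qed

text \<open>Once the digits are at least 2, each \<open>cf_q\<close> is at least twice its
  predecessor.\<close>

lemma summable_cf_q_powr:
  assumes p: "p > 0"
  shows "summable (\<lambda>j. real (cf_q \<beta> j) powr (- p))"
proof -
  obtain J where J: "\<And>j. j \<ge> J \<Longrightarrow> 2 \<le> cf_a \<beta> (Suc j)"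
    using digits_eventually[of 2] by (auto simp: eventually_sequentially)
  show ?thesis
  proof (rule summable_ratio_test[of "2 powr (- p)" J])
    show "2 powr (- p) < 1" using p by (simp add: powr_less_one)
    fix j assume "j \<ge> J"
    then have "2 * cf_q \<beta> j \<le> cf_a \<beta> (Suc j) * cf_q \<beta> j" by (intro mult_right_mono J) auto
    then have "2 * cf_q \<beta> j \<le> cf_q \<beta> (Suc j)" unfolding cf_q_rec by linarith
    then have "2 * real (cf_q \<beta> j) \<le> real (cf_q \<beta> (Suc j))" by linarith
    then have "real (cf_q \<beta> (Suc j)) powr (- p) \<le> (2 * real (cf_q \<beta> j)) powr (- p)"
      using p cf_q_ge_1[of j] by (intro powr_mono2') auto
    then show "norm (real (cf_q \<beta> (Suc j)) powr (- p)) \<le> 2 powr (- p) * norm (real (cf_q \<beta> j) powr (- p))"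
      by (simp add: powr_mult)
  qed
qed

text \<open>Up to constants, \<open>weight i\<close> bounds the contribution of the preimages that leave the orbit of \<open>\<beta>\<close>
  after exactly \<open>i\<close> steps.\<close>

definition weight :: "nat \<Rightarrow> real" where
  "weight i = (if right i then tt i powr (- (1 - \<alpha>) / 2) * dd i powr (- (3 * (1 - \<alpha>) / 2))
     else tt i powr (- 2 * (1 - \<alpha>)))"

lemma weight_nonneg: "0 \<le> weight i"
  by (simp add: weight_def)

text \<open>At a left step the logarithm costs tt powr e, and the rest is compared with the term of
  index s + 1 in the type condition; the exponent is negative, so \<open>cf_t_le\<close> points the
  right way. At a right step, the last one of its block, the small negative power of tt absorbs the
  logarithm and a power of \<open>cf_q\<close> remains.\<close>

lemma weight_bound:
  assumes e: "0 < e" "e \<le> 1 - \<alpha>" and s: "s < cf_a \<beta> (Suc j)"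
  shows "weight (blk j + s) * ln (real (blk j + s) + 2)
    \<le> 2 / e * real_of_int (cf_t \<beta> (Suc j) (Suc s)) powr (- 2 * (1 - \<alpha>) + e)
      + (if Suc s = cf_a \<beta> (Suc j) then 4 / (1 - \<alpha>) * real (cf_q \<beta> j) powr (- (3 * (1 - \<alpha>) / 2)) else 0)"
proof -
  let ?i = "blk j + s"
  have t: "1 \<le> tt ?i" "real ?i + 1 \<le> tt ?i" using tt_ge[of ?i] by auto
  have ln: "0 \<le> ln (real ?i + 2)" by simp
  show ?thesis
  proof (cases "right ?i")
    case True
    have "tt ?i powr (- (1 - \<alpha>) / 2) * ln (real ?i + 2)
       \<le> tt ?i powr (- (1 - \<alpha>) / 2) * (2 / ((1 - \<alpha>) / 2) * tt ?i powr ((1 - \<alpha>) / 2))"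
      using alpha t by (intro mult_left_mono ln_le_powr) auto
    also have "\<dots> = 4 / (1 - \<alpha>) * tt ?i powr (- (1 - \<alpha>) / 2 + (1 - \<alpha>) / 2)"
      unfolding powr_add by simp
    also have "- (1 - \<alpha>) / 2 + (1 - \<alpha>) / 2 = 0" by (simp add: field_simps)
    finally have 1: "tt ?i powr (- (1 - \<alpha>) / 2) * ln (real ?i + 2) \<le> 4 / (1 - \<alpha>)" using t by simp
    have "weight ?i * ln (real ?i + 2)
        = (tt ?i powr (- (1 - \<alpha>) / 2) * ln (real ?i + 2)) * dd ?i powr (- (3 * (1 - \<alpha>) / 2))"
      using True by (simp add: weight_def mult_ac)
    also have "\<dots> \<le> 4 / (1 - \<alpha>) * dd ?i powr (- (3 * (1 - \<alpha>) / 2))"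
      by (intro mult_right_mono 1) auto
    finally show ?thesis
      using right_orbit[OF s True] orbit(3)[OF s] e by (simp add: add_increasing)
  next
    case False
    have ct: "1 \<le> real_of_int (cf_t \<beta> (Suc j) (Suc s))" using cf_t_pos[of "Suc j" "Suc s"] by simp
    have "real_of_int (cf_t \<beta> (Suc j) (Suc s)) \<le> real_of_int (int (Suc s * cf_q \<beta> j + cf_qprev j))"
      using cf_t_le[of "Suc s" j] unfolding of_int_le_iff by simp
    then have ct2: "real_of_int (cf_t \<beta> (Suc j) (Suc s)) \<le> tt ?i"
      unfolding tt_orbit[OF s] by simp
    have "weight ?i * ln (real ?i + 2) \<le> tt ?i powr (- 2 * (1 - \<alpha>)) * (2 / e * tt ?i powr e)"
      unfolding weight_def if_not_P[OF False]
      using alpha t e by (intro mult_left_mono ln_le_powr) auto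
    also have "\<dots> = 2 / e * tt ?i powr (- 2 * (1 - \<alpha>) + e)"
      unfolding powr_add by simp
    also have "\<dots> \<le> 2 / e * real_of_int (cf_t \<beta> (Suc j) (Suc s)) powr (- 2 * (1 - \<alpha>) + e)"
      using e ct ct2 alpha by (intro mult_left_mono powr_mono2') auto
    finally show ?thesis using alpha by (simp add: add_increasing2)
  qed
qed

lemma summable_weight: "summable (\<lambda>i. weight i * ln (real i + 2))"
proof -
  obtain e0 where e0: "e0 > 0" "summable (\<lambda>n. \<Sum>j = 1..cf_a \<beta> (Suc n).
      real_of_int (cf_t \<beta> (Suc n) j) powr (- 2 * (1 - \<alpha>) + e0))"
    using type unfolding intermediate_type_def by blast
  \<comment> \<open>The cap keeps the exponent -2 * (1 - \<alpha>) + e negative; lowering e0 to e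
    only shrinks the terms, as \<open>cf_t\<close> is at least 1.\<close>
  define e where "e = min e0 (1 - \<alpha>)"
  have e: "0 < e" "e \<le> 1 - \<alpha>" "e \<le> e0" using e0 alpha by (auto simp: e_def)
  define T where "T n = (\<Sum>j = 1..cf_a \<beta> (Suc n). real_of_int (cf_t \<beta> (Suc n) j) powr (- 2 * (1 - \<alpha>) + e))" for n
  define Q where "Q n = real (cf_q \<beta> n) powr (- (3 * (1 - \<alpha>) / 2))" for n
  have ct: "1 \<le> real_of_int (cf_t \<beta> n j)" for n j using cf_t_pos[of n j] by simp
  have T: "summable T"
  proof (rule summable_comparison_test'[OF e0(2)])
    fix n
    have "T n \<ge> 0" unfolding T_def by (intro sum_nonneg) auto
    then show "norm (T n) \<le> (\<Sum>j = 1..cf_a \<beta> (Suc n).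
      real_of_int (cf_t \<beta> (Suc n) j) powr (- 2 * (1 - \<alpha>) + e0))"
      unfolding T_def using e ct by (auto intro!: sum_mono powr_mono)
  qed
  have Q: "summable Q" unfolding Q_def using alpha by (intro summable_cf_q_powr) auto
  have nonneg: "T n \<ge> 0" "Q n \<ge> 0" for n by (auto simp: T_def Q_def sum_nonneg)
  let ?B = "\<lambda>i. weight i * ln (real i + 2)"
  have Bnn: "?B i \<ge> 0" for i by (intro mult_nonneg_nonneg weight_nonneg) auto
  have block: "(\<Sum>s<cf_a \<beta> (Suc j). ?B (blk j + s)) \<le> 2 / e * T j + 4 / (1 - \<alpha>) * Q j" for j
  proof -
    let ?a = "cf_a \<beta> (Suc j)"
    have "(\<Sum>s<?a. ?B (blk j + s)) \<le> (\<Sum>s<?a. 2 / e * real_of_int (cf_t \<beta> (Suc j) (Suc s)) powr (- 2 * (1 - \<alpha>) + e)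
      + (if Suc s = ?a then 4 / (1 - \<alpha>) * Q j else 0))"
      unfolding Q_def using weight_bound[OF e(1,2)] by (intro sum_mono) auto
    also have "\<dots> = 2 / e * (\<Sum>s<?a. real_of_int (cf_t \<beta> (Suc j) (Suc s)) powr (- 2 * (1 - \<alpha>) + e))
        + (\<Sum>s<?a. if Suc s = ?a then 4 / (1 - \<alpha>) * Q j else 0)"
      by (simp add: sum.distrib sum_distrib_left)
    also have "(\<Sum>s<?a. real_of_int (cf_t \<beta> (Suc j) (Suc s)) powr (- 2 * (1 - \<alpha>) + e)) = T j"
      unfolding T_def One_nat_def sum.atLeast1_atMost_eq ..
    also have "(\<Sum>s<?a. if Suc s = ?a then 4 / (1 - \<alpha>) * Q j else 0)
        = (\<Sum>s<?a. if s = ?a - 1 then 4 / (1 - \<alpha>) * Q j else 0)"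
      using cf_a_ge_1[of j] by (intro sum.cong) auto
    also have "\<dots> = 4 / (1 - \<alpha>) * Q j" using cf_a_ge_1[of j] by simp
    finally show ?thesis by simp
  qed
  have blocks: "sum ?B {..<blk J} \<le> (\<Sum>j<J. 2 / e * T j + 4 / (1 - \<alpha>) * Q j)" for J
  proof (induction J)
    case 0
    show ?case by (simp add: blk_def)
  next
    case (Suc J)
    have "sum ?B {..<blk (Suc J)} = sum ?B {..<blk J} + sum ?B {blk J..<blk J + cf_a \<beta> (Suc J)}"
      unfolding blk_Suc by (subst sum.union_disjoint[symmetric]) (auto intro!: sum.cong)
    also have "sum ?B {blk J..<blk J + cf_a \<beta> (Suc J)} = (\<Sum>s<cf_a \<beta> (Suc J). ?B (blk J + s))"
      using sum.shift_bounds_nat_ivl[of ?B 0 "blk J" "cf_a \<beta> (Suc J)"]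
      by (simp add: atLeast0LessThan add.commute)
    finally show ?case using Suc block[of J] by simp
  qed
  have sm: "summable (\<lambda>j. 2 / e * T j + 4 / (1 - \<alpha>) * Q j)"
    by (intro summable_add summable_mult T Q)
  show ?thesis
  proof (rule summableI_nonneg_bounded)
    fix n
    have "sum ?B {..<n} \<le> sum ?B {..<blk n}"
      using blk_ge[of n] Bnn by (intro sum_mono2) auto
    also have "\<dots> \<le> (\<Sum>j<n. 2 / e * T j + 4 / (1 - \<alpha>) * Q j)" by (rule blocks)
    also have "\<dots> \<le> (\<Sum>j. 2 / e * T j + 4 / (1 - \<alpha>) * Q j)"
      using nonneg e alpha by (intro sum_le_suminf sm) auto
    finally show "sum ?B {..<n} \<le> (\<Sum>j. 2 / e * T j + 4 / (1 - \<alpha>) * Q j)" .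
  qed (rule Bnn)
qed

lemma main_part_v:
  assumes "z \<in> {0..1}"
  shows "main_part i v z
    = (cc i * pt i + dd i) powr \<alpha> * (cc i * z + dd i) powr (- (2 - \<alpha>)) * \<bar>pt i - z\<bar> powr (- \<alpha>)"
proof -
  let ?A = "cc i * z + dd i" and ?B = "cc i * pt i + dd i"
  have pos: "?A > 0" "?B > 0" using den_pos[of z i] den_pos[of "pt i" i] assms pt_pos[of i] by auto
  have "main_part i v z = (\<bar>pt i - z\<bar> / (?A * ?B)) powr (- \<alpha>) / ?A\<^sup>2"
    unfolding main_part_def vfun_def inv_branch_dist[OF assms] ..
  also have "\<dots> = \<bar>pt i - z\<bar> powr (- \<alpha>) / (?A powr (- \<alpha>) * ?B powr (- \<alpha>)) / ?A powr 2"
    using pos by (simp add: powr_divide powr_mult)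
  also have "\<dots> = ?B powr \<alpha> * (?A powr \<alpha> / ?A powr 2) * \<bar>pt i - z\<bar> powr (- \<alpha>)"
    by (simp add: powr_minus divide_simps)
  also have "?A powr \<alpha> / ?A powr 2 = ?A powr (\<alpha> - 2)" by (rule powr_diff[symmetric])
  finally show ?thesis by simp
qed

lemma main_part_v_nonneg: "0 \<le> main_part i v z"
  by (simp add: main_part_def vfun_def)

lemma side_part_v_nonneg: "0 \<le> side_part i v z"
  by (simp add: side_part_def main_part_v_nonneg)

lemma main_part_v_le:
  assumes z: "z \<in> {0..1}" and l: "0 < l" "l \<le> cc i * z + dd i" and dist: "0 < \<delta>" "\<delta> \<le> \<bar>pt i - z\<bar>"
  shows "main_part i v z \<le> tt i powr \<alpha> * l powr (- (2 - \<alpha>)) * \<delta> powr (- \<alpha>)"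
  unfolding main_part_v[OF z]
  using alpha l dist pt_pos[of i] pt_less_1[of i] den_le_tt[of "pt i" i] den_pos[of "pt i" i]
  by (intro mult_mono powr_mono2 powr_mono2') (auto simp: less_imp_le)

end

lemma powr_divide_minus:
  fixes a b q :: real
  assumes "a \<ge> 0" "b > 0"
  shows "(a / b) powr (- q) = a powr (- q) * b powr q"
  using assms by (simp add: powr_divide powr_minus field_simps)

context typed_point
begin

text \<open>The sibling branch takes values y = 1 / (1 + z) in [1/2, 1], where the denominator is
  comparable to tt. As \<open>pt i\<close> may be close to 1/2, only the distance from y to 1/2 is
  available; it vanishes at z = 1 and causes the factor in 1 - z.\<close>

lemma side_part_left:
  assumes nr: "\<not> right i" and z: "0 \<le> z" "z < 1"
  shows "side_part i v z \<le> 16 * tt i powr (- 2 * (1 - \<alpha>)) * (1 - z) powr (- \<alpha>)"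
proof -
  define y where "y = 1 / (1 + z)"
  have y: "1/2 \<le> y" "y \<le> 1" using z by (auto simp: y_def field_simps)
  have t: "tt i > 0" by (rule tt_pos)
  have dist: "(1 - z) / 4 \<le> \<bar>pt i - y\<bar>"
  proof -
    have "y - 1/2 = (1 - z) / (2 * (1 + z))" using z by (simp add: y_def field_simps)
    also have "\<dots> \<ge> (1 - z) / 4" using z by (intro divide_left_mono) auto
    finally have "(1 - z) / 4 \<le> y - 1/2" .
    then show ?thesis using nr unfolding right_def by linarith
  qed
  have l: "tt i / 2 \<le> cc i * y + dd i"
  proof -
    have "1/2 * tt i \<le> y * tt i" using y t by (intro mult_right_mono) auto
    also have "\<dots> \<le> cc i * y + dd i" using y by (intro den_ge_tt) auto
    finally show ?thesis by simp
  qed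
  have "side_part i v z = main_part i v y / (1 + z)\<^sup>2"
    using nr by (simp add: side_part_def branch_def y_def)
  also have "\<dots> \<le> main_part i v y / 1"
    using z by (intro divide_left_mono main_part_v_nonneg) (auto simp: one_le_power)
  also have "\<dots> \<le> tt i powr \<alpha> * (tt i / 2) powr (- (2 - \<alpha>)) * ((1 - z) / 4) powr (- \<alpha>)"
    using main_part_v_le[OF _ _ l _ dist] y z t by simp
  also have "\<dots> = (2 powr (2 - \<alpha>) * 4 powr \<alpha>) * (tt i powr \<alpha> * tt i powr (- (2 - \<alpha>))) * (1 - z) powr (- \<alpha>)"
    using powr_divide_minus[of "tt i" 2 "2 - \<alpha>"] powr_divide_minus[of "1 - z" 4 \<alpha>] t z by simp
  also have "tt i powr \<alpha> * tt i powr (- (2 - \<alpha>)) = tt i powr (- 2 * (1 - \<alpha>))"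
    unfolding powr_add[symmetric] by (simp add: algebra_simps)
  \<comment> \<open>The constant 16 is 2^2 * 4: the first factor stems from halving the denominator,
    the second from the distance (1 - z) / 4.\<close>
  also have "2 powr (2 - \<alpha>) * 4 powr \<alpha> \<le> 2 powr 2 * (4::real) powr 1"
    using alpha by (intro mult_mono powr_mono) auto
  finally show ?thesis by (simp add: mult_right_mono)
qed

text \<open>Here the sibling image is at most 1/2, so its distance from \<open>pt i\<close> is at
  least 1/6, but near z = 0 its denominator may drop from the size of tt to that of dd. The exponent
  2 - \<alpha> is therefore split into (1 + \<alpha>)/2, spent on tt * z, and 3 * (1 - \<alpha>)/2,
  spent on dd. The first part must exceed \<alpha>, to leave a negative power of tt, and stay below
  1, to be integrable in z; it is the midpoint.\<close>

lemma side_part_right: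
  assumes r: "right i" "2/3 \<le> pt i" and z: "0 < z" "z \<le> 1"
  shows "side_part i v z \<le> 6 * weight i * z powr (- ((1 + \<alpha>) / 2))"
proof -
  define y where "y = z / (1 + z)"
  let ?A = "tt i * z + dd i"
  have y: "0 \<le> y" "y \<le> 1/2" using z by (auto simp: y_def field_simps)
  have t: "tt i > 0" by (rule tt_pos)
  have d: "dd i > 0" using dd_ge_1[of i] by simp
  have A: "?A > 0" using t d z by (simp add: add_pos_pos)
  have l: "cc i * y + dd i = ?A / (1 + z)"
    using z by (simp add: y_def tt_def field_simps)
  have "side_part i v z = main_part i v y / (1 + z) powr 2"
    using r z by (simp add: side_part_def branch_def y_def)
  also have "\<dots> \<le> (tt i powr \<alpha> * (?A / (1 + z)) powr (- (2 - \<alpha>)) * (1/6) powr (- \<alpha>)) / (1 + z) powr 2"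
    using y r A z by (intro divide_right_mono main_part_v_le) (auto simp: l)
  also have "\<dots> = 6 powr \<alpha> * ((1 + z) powr (2 - \<alpha>) / (1 + z) powr 2) * (tt i powr \<alpha> * ?A powr (- (2 - \<alpha>)))"
    using powr_divide_minus[of ?A "1 + z" "2 - \<alpha>"] powr_divide_minus[of 1 6 \<alpha>] A z by simp
  also have "(1 + z) powr (2 - \<alpha>) / (1 + z) powr 2 = (1 + z) powr (- \<alpha>)"
    unfolding powr_diff[symmetric] by simp
  also have "6 powr \<alpha> * (1 + z) powr (- \<alpha>) * (tt i powr \<alpha> * ?A powr (- (2 - \<alpha>)))
      \<le> 6 powr 1 * 1 * (tt i powr \<alpha> * ?A powr (- (2 - \<alpha>)))"
    using alpha z by (intro mult_right_mono mult_mono powr_mono) (auto simp: powr_minus_divide ge_one_powr_ge_zero)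
  also have "?A powr (- (2 - \<alpha>)) = ?A powr (- ((1 + \<alpha>) / 2)) * ?A powr (- (3 * (1 - \<alpha>) / 2))"
    unfolding powr_add[symmetric] by (rule arg_cong[where f = "\<lambda>q. ?A powr q"]) (simp add: field_simps)
  also have "6 powr 1 * 1 * (tt i powr \<alpha> * (?A powr (- ((1 + \<alpha>) / 2)) * ?A powr (- (3 * (1 - \<alpha>) / 2))))
      \<le> 6 powr 1 * 1 * (tt i powr \<alpha> * ((tt i * z) powr (- ((1 + \<alpha>) / 2)) * dd i powr (- (3 * (1 - \<alpha>) / 2))))"
    using alpha t d z A by (intro mult_mono powr_mono2' order.refl mult_nonneg_nonneg) auto
  also have "\<dots> = 6 * ((tt i powr \<alpha> * tt i powr (- ((1 + \<alpha>) / 2))) * dd i powr (- (3 * (1 - \<alpha>) / 2)))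
      * z powr (- ((1 + \<alpha>) / 2))"
    using t z by (simp add: powr_mult mult_ac)
  also have "tt i powr \<alpha> * tt i powr (- ((1 + \<alpha>) / 2)) = tt i powr (- (1 - \<alpha>) / 2)"
    unfolding powr_add[symmetric] by (rule arg_cong[where f = "\<lambda>q. tt i powr q"]) (simp add: field_simps)
  finally show ?thesis using r by (simp add: weight_def)
qed

text \<open>One more application of \<open>P1\<close> moves the singularity from 1 to 0, as 1 - 1 /
  (1 + x) = x / (1 + x), so that \<open>P1_pow_powr_bound\<close> applies. Raising the exponent
  \<alpha> to (1 + \<alpha>)/2 matches the right-hand case.\<close>

lemma P1_side_part_left:
  assumes nr: "\<not> right i" and x: "0 < x" "x \<le> 1"
  shows "P1 (side_part i v) x \<le> 64 * weight i * x powr (- ((1 + \<alpha>) / 2))"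
proof -
  let ?w = "tt i powr (- 2 * (1 - \<alpha>))"
  have 1: "(1 - x / (1 + x)) powr (- \<alpha>) \<le> 2 * x powr (- \<alpha>)"
  proof -
    have "1 - x / (1 + x) = 1 / (1 + x)" using x by (simp add: field_simps)
    then have "(1 - x / (1 + x)) powr (- \<alpha>) = (1 + x) powr \<alpha>"
      using x by (simp add: powr_divide powr_minus_divide)
    also have "\<dots> \<le> 2 powr \<alpha>" using alpha x by (intro powr_mono2) auto
    also have "\<dots> \<le> 2 powr 1" using alpha by (intro powr_mono) auto
    also have "\<dots> \<le> 2 * x powr (- \<alpha>)"
      using x alpha powr_mono2'[of "- \<alpha>" x 1] by simp
    finally show ?thesis .
  qed
  have 2: "(1 - 1 / (1 + x)) powr (- \<alpha>) \<le> 2 * x powr (- \<alpha>)"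
  proof -
    have "1 - 1 / (1 + x) = x / (1 + x)" using x by (simp add: field_simps)
    then have "(1 - 1 / (1 + x)) powr (- \<alpha>) = (1 + x) powr \<alpha> * x powr (- \<alpha>)"
      using x by (simp add: powr_divide powr_minus_divide)
    also have "\<dots> \<le> 2 powr \<alpha> * x powr (- \<alpha>)" using alpha x by (intro mult_right_mono powr_mono2) auto
    also have "\<dots> \<le> 2 powr 1 * x powr (- \<alpha>)" using alpha by (intro mult_right_mono powr_mono) auto
    finally show ?thesis by simp
  qed
  have "P1 (side_part i v) x = (side_part i v (x / (1 + x)) + side_part i v (1 / (1 + x))) / (1 + x)\<^sup>2"
    by (rule P1_eq)
  also have "\<dots> \<le> (side_part i v (x / (1 + x)) + side_part i v (1 / (1 + x))) / 1"
    using x by (intro divide_left_mono add_nonneg_nonneg side_part_v_nonneg) (auto simp: one_le_power)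
  also have "\<dots> \<le> 16 * ?w * (1 - x / (1 + x)) powr (- \<alpha>) + 16 * ?w * (1 - 1 / (1 + x)) powr (- \<alpha>)"
    unfolding div_by_1 using x by (intro add_mono side_part_left[OF nr]) (auto simp: field_simps)
  also have "\<dots> \<le> 16 * ?w * (2 * x powr (- \<alpha>)) + 16 * ?w * (2 * x powr (- \<alpha>))"
    by (intro add_mono mult_left_mono 1 2) auto
  also have "\<dots> = 64 * ?w * x powr (- \<alpha>)" by simp
  also have "\<dots> \<le> 64 * ?w * x powr (- ((1 + \<alpha>) / 2))"
    using x alpha by (intro mult_left_mono powr_mono') auto
  finally show ?thesis using nr by (simp add: weight_def)
qed

text \<open>Both branches take the value 1/2 at 1.\<close>

lemma side_part_at_1: "side_part i f 1 = main_part (Suc i) f 1"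
  by (simp add: side_part_def main_part_Suc branch_def)

text \<open>For a left step with \<open>Suc i = n\<close> no application of \<open>P1\<close> is
  left to move the singularity away from 1. If k \<ge> 2, the point 1/k is at distance at least 1/2
  from 1; if k = 1, the side part equals the main part, which accounts for the extra term.\<close>

lemma side_part_bound:
  assumes k: "k \<ge> 1"
  obtains C where "C > 0" "\<And>i n. i < n \<Longrightarrow> (right i \<Longrightarrow> 2/3 \<le> pt i) \<Longrightarrow>
    (P1 ^^ (n - Suc i)) (side_part i v) (1 / real k)
      \<le> C * weight i / ln (real (n - i) + 1) + (if Suc i = n then main_part n v (1 / real k) else 0)"
proof -
  let ?p = "(1 + \<alpha>) / 2"
  let ?w = "\<lambda>x::real. x powr (- ?p)"
  have p: "0 < ?p" "?p < 1" using alpha by auto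
  obtain C0 where C0: "C0 > 0" "\<And>n k. k \<ge> 1 \<Longrightarrow> (P1 ^^ n) ?w (1 / real k) \<le> C0 * real k / ln (real n + 3)"
    using P1_pow_powr_bound[OF p] by blast
  define C where "C = 64 * (C0 + 1) * real k"
  have C: "C > 0" using C0 k by (simp add: C_def)
  have x: "1 / real k \<in> {0<..1}" using k by auto
  show ?thesis
  proof (rule that[OF C])
    fix i n :: nat assume i: "i < n" and r: "right i \<Longrightarrow> 2/3 \<le> pt i"
    have ln: "ln (real (n - i) + 1) > 0" using i by simp
    let ?lhs = "(P1 ^^ (n - Suc i)) (side_part i v) (1 / real k)"
    consider "right i" | "\<not> right i" "Suc i < n" | "\<not> right i" "Suc i = n" "k = 1"
      | "\<not> right i" "Suc i = n" "k \<ge> 2" using i k by linarith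
    then show "?lhs \<le> C * weight i / ln (real (n - i) + 1) + (if Suc i = n then main_part n v (1 / real k) else 0)"
    proof cases
      case 1
      have "?lhs \<le> (P1 ^^ (n - Suc i)) (\<lambda>z. (6 * weight i) * ?w z) (1 / real k)"
        using side_part_right[OF 1 r[OF 1]] by (intro P1_pow_mono[OF branch_closed_Ioc _ x]) auto
      also have "\<dots> = 6 * weight i * (P1 ^^ (n - Suc i)) ?w (1 / real k)" by (rule P1_pow_cmult)
      also have "\<dots> \<le> 6 * weight i * (C0 * real k / ln (real (n - Suc i) + 3))"
        using weight_nonneg[of i] C0 k by (intro mult_left_mono) auto
      also have "\<dots> \<le> 64 * weight i * ((C0 + 1) * real k / ln (real (n - i) + 1))"
      proof (intro mult_mono frac_le)
        have "real (n - Suc i) + 3 \<ge> real (n - i) + 1" by simp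
        then show "ln (real (n - i) + 1) \<le> ln (real (n - Suc i) + 3)" by simp
      qed (use weight_nonneg[of i] C0 k ln in auto)
      finally have "?lhs \<le> C * weight i / ln (real (n - i) + 1)" by (simp add: C_def mult_ac)
      then show ?thesis using main_part_v_nonneg by (simp add: add_increasing2)
    next
      case 2
      define m where "m = n - Suc (Suc i)"
      have m: "n - Suc i = Suc m" "real m + 3 = real (n - i) + 1" using 2 by (auto simp: m_def)
      have "?lhs = (P1 ^^ m) (P1 (side_part i v)) (1 / real k)"
        unfolding m(1) by (simp add: funpow_swap1)
      also have "\<dots> \<le> (P1 ^^ m) (\<lambda>z. (64 * weight i) * ?w z) (1 / real k)"
        using P1_side_part_left[OF 2(1)] by (intro P1_pow_mono[OF branch_closed_Ioc _ x]) auto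
      also have "\<dots> = 64 * weight i * (P1 ^^ m) ?w (1 / real k)" by (rule P1_pow_cmult)
      also have "\<dots> \<le> 64 * weight i * (C0 * real k / ln (real m + 3))"
        using weight_nonneg[of i] C0 k by (intro mult_left_mono) auto
      also have "\<dots> \<le> 64 * weight i * ((C0 + 1) * real k / ln (real (n - i) + 1))"
        unfolding m(2) using weight_nonneg[of i] C0 k ln by (intro mult_mono frac_le) auto
      finally show ?thesis using 2 by (simp add: C_def mult_ac)
    next
      case 3
      have "?lhs = main_part n v (1 / real k)" using 3 side_part_at_1[of i v] by auto
      then show ?thesis using 3 C weight_nonneg[of i] ln by simp
    next
      case 4
      have "?lhs = side_part i v (1 / real k)" using 4 by auto
      also have "\<dots> \<le> 16 * tt i powr (- 2 * (1 - \<alpha>)) * (1 - 1 / real k) powr (- \<alpha>)"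
        using 4 by (intro side_part_left) auto
      also have "\<dots> \<le> 16 * weight i * (1/2) powr (- \<alpha>)"
        using 4 alpha by (simp add: weight_def, intro mult_left_mono powr_mono2') (auto simp: field_simps)
      also have "\<dots> \<le> 16 * weight i * 2"
        using alpha weight_nonneg[of i] powr_mono[of \<alpha> 1 2]
        by (intro mult_left_mono) (auto simp: powr_divide powr_minus_divide)
      also have "\<dots> \<le> C * weight i / ln (real (n - i) + 1)"
      proof -
        have "ln (real (n - i) + 1) \<le> 1" using 4 ln_le_minus_one[of 2] by auto
        then have "C * weight i / 1 \<le> C * weight i / ln (real (n - i) + 1)"
          using C weight_nonneg[of i] ln by (intro divide_left_mono) auto
        moreover have "1 * 1 \<le> (C0 + 1) * real k" using C0 k by (intro mult_mono) auto
        then have "32 \<le> C" unfolding C_def by linarith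
        then have "32 * weight i \<le> C * weight i" by (intro mult_right_mono weight_nonneg)
        ultimately show ?thesis by simp
      qed
      finally show ?thesis using main_part_v_nonneg by (simp add: add_increasing2)
    qed
  qed
qed

end

section \<open>Upper and lower bounds up to the main branch\<close>

lemma vfun_set_integrable:
  assumes "0 < \<alpha>" "\<alpha> < 1" "0 < \<beta>" "\<beta> < 1"
  shows "set_integrable lborel {0..1} (vfun \<beta> \<alpha>)"
proof -
  define \<phi> where "\<phi> x = indicator {0..1} x *\<^sub>R (x powr (- \<alpha>))" for x :: real
  have "(\<lambda>x. x powr (- \<alpha>)) integrable_on {0..1}"
    using integrable_on_powr_from_0[of "- \<alpha>" 1] assms by simp
  then have "(\<lambda>x. x powr (- \<alpha>)) absolutely_integrable_on {0..1}"
    by (intro nonnegative_absolutely_integrable_1) auto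
  then have "integrable (completion lborel) \<phi>"
    by (simp add: set_integrable_def \<phi>_def[abs_def])
  then have \<phi>: "integrable lborel \<phi>"
    by (subst (asm) integrable_completion) (simp_all add: \<phi>_def[abs_def])
  \<comment> \<open>The two summands are the singularity to the right of \<beta> and its reflection
    to the left; together they dominate \<open>vfun\<close> on [0, 1].\<close>
  have "integrable lborel (\<lambda>x. \<phi> (- \<beta> + 1 * x) + \<phi> (\<beta> + (- 1) * x))"
    by (intro Bochner_Integration.integrable_add lborel_integrable_real_affine \<phi>) auto
  then show ?thesis
    unfolding set_integrable_def
    by (rule Bochner_Integration.integrable_bound)
       (use assms in \<open>auto simp: vfun_def[abs_def] \<phi>_def indicator_def\<close>)
qed

context typed_point
begin

text \<open>Unlike \<open>min M v\<close>, this truncation is continuous at \<open>\<beta>\<close>, where \<open>v \<beta> = 0\<close> because \<open>0 powr a = 0\<close>.\<close>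

definition trunc :: "real \<Rightarrow> real \<Rightarrow> real" where
  "trunc \<delta> x = (max \<bar>\<beta> - x\<bar> \<delta>) powr (- \<alpha>)"

definition mass :: real where "mass = (LINT x:{0..1}|lborel. v x)"

lemma v_integrable: "set_integrable lborel {0..1} v"
  using vfun_set_integrable alpha beta by auto

lemma continuous_on_trunc: "\<delta> > 0 \<Longrightarrow> continuous_on {0..1} (trunc \<delta>)"
  unfolding trunc_def[abs_def] by (intro continuous_intros) auto

lemma trunc_le_v: "\<delta> > 0 \<Longrightarrow> x \<noteq> \<beta> \<Longrightarrow> trunc \<delta> x \<le> v x"
  unfolding trunc_def vfun_def using alpha by (intro powr_mono2') auto

lemma trunc_eq_v: "\<delta> \<le> \<bar>\<beta> - x\<bar> \<Longrightarrow> trunc \<delta> x = v x"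
  by (simp add: trunc_def vfun_def max_def)

lemma trunc_nonneg: "0 \<le> trunc \<delta> x"
  by (simp add: trunc_def)

lemma trunc_le: "\<delta> > 0 \<Longrightarrow> trunc \<delta> x \<le> \<delta> powr (- \<alpha>)"
  unfolding trunc_def using alpha by (intro powr_mono2') auto

lemma trunc_integrable: "\<delta> > 0 \<Longrightarrow> set_integrable lborel {0..1} (trunc \<delta>)"
  by (intro borel_integrable_atLeastAtMost' continuous_on_trunc)

lemma integral_trunc: "\<delta> > 0 \<Longrightarrow> integral {0..1} (trunc \<delta>) = (LINT x:{0..1}|lborel. trunc \<delta> x)"
  using set_borel_integral_eq_integral(2)[OF trunc_integrable] by simp

lemma AE_neq_beta: "AE x in lborel. x \<noteq> \<beta>"
  by (rule AE_lborel_singleton)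

lemma integral_trunc_le:
  assumes "\<delta> > 0"
  shows "integral {0..1} (trunc \<delta>) \<le> mass"
  unfolding integral_trunc[OF assms] mass_def
proof (rule set_integral_mono_AE[OF trunc_integrable[OF assms] v_integrable])
  show "AE x \<in> {0..1} in lborel. trunc \<delta> x \<le> v x"
    using AE_neq_beta by eventually_elim (simp add: trunc_le_v assms)
qed

lemma integral_trunc_ge:
  assumes "e > 0"
  obtains \<delta> where "\<delta> > 0" "integral {0..1} (trunc \<delta>) > mass - e"
proof -
  define d where "d m = 1 / real (Suc m)" for m
  have d: "d m > 0" for m by (simp add: d_def)
  have "(\<lambda>m. LINT x|lborel. indicator {0..1} x *\<^sub>R trunc (d m) x) \<longlonglongrightarrow> (LINT x|lborel. indicator {0..1} x *\<^sub>R v x)"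
  proof (rule integral_dominated_convergence[where w = "\<lambda>x. indicator {0..1} x *\<^sub>R v x"])
    show "integrable lborel (\<lambda>x. indicator {0..1} x *\<^sub>R v x)"
      using v_integrable by (simp add: set_integrable_def)
    show "(\<lambda>x. indicator {0..1} x *\<^sub>R v x) \<in> borel_measurable lborel"
      using v_integrable by (simp add: set_integrable_def borel_measurable_integrable)
    show "(\<lambda>x. indicator {0..1} x *\<^sub>R trunc (d m) x) \<in> borel_measurable lborel" for m
      using trunc_integrable[OF d[of m]] by (simp add: set_integrable_def borel_measurable_integrable)
    show "AE x in lborel. (\<lambda>m. indicator {0..1} x *\<^sub>R trunc (d m) x) \<longlonglongrightarrow> indicator {0..1} x *\<^sub>R v x"
      using AE_neq_beta
    proof eventually_elim
      case (elim x)
      have "d \<longlonglongrightarrow> 0" unfolding d_def[abs_def] by real_asymp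
      then have "\<forall>\<^sub>F m in sequentially. d m < \<bar>\<beta> - x\<bar>" using elim by (intro order_tendstoD) auto
      then have "\<forall>\<^sub>F m in sequentially. indicator {0..1} x *\<^sub>R trunc (d m) x = indicator {0..1} x *\<^sub>R v x"
        by eventually_elim (simp add: trunc_eq_v)
      then show ?case by (rule tendsto_eventually)
    qed
    show "AE x in lborel. norm (indicator {0..1} x *\<^sub>R trunc (d m) x) \<le> indicator {0..1} x *\<^sub>R v x" for m
      using AE_neq_beta
      by eventually_elim (auto simp: indicator_def trunc_nonneg trunc_le_v[OF d])
  qed
  then have "(\<lambda>m. integral {0..1} (trunc (d m))) \<longlonglongrightarrow> mass"
    unfolding integral_trunc[OF d] mass_def set_lebesgue_integral_def .
  then have "\<forall>\<^sub>F m in sequentially. integral {0..1} (trunc (d m)) > mass - e"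
    using assms by (intro order_tendstoD) auto
  then obtain m where "integral {0..1} (trunc (d m)) > mass - e"
    by (auto simp: eventually_sequentially)
  then show ?thesis using that d by blast
qed

lemma mass_nonneg: "0 \<le> mass"
proof -
  have "0 \<le> integral {0..1} (trunc 1)"
    by (intro integral_nonneg integrable_continuous_real continuous_on_trunc) (auto simp: trunc_nonneg)
  then show ?thesis using integral_trunc_le[of 1] by simp
qed

lemma ln_over_tt_tendsto_0:
  assumes "p > 0"
  shows "(\<lambda>n. ln (real n) * tt n powr (- p)) \<longlonglongrightarrow> 0"
proof (rule tendsto_sandwich[where f = "\<lambda>_. 0" and h = "\<lambda>n. ln (real n) * (real n + 1) powr (- p)"])
  show "(\<lambda>n. ln (real n) * (real n + 1) powr (- p)) \<longlonglongrightarrow> 0" using assms by real_asymp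
  show "\<forall>\<^sub>F n in sequentially. 0 \<le> ln (real n) * tt n powr (- p)"
    using eventually_ge_at_top[of 1] by eventually_elim auto
  show "\<forall>\<^sub>F n in sequentially. ln (real n) * tt n powr (- p) \<le> ln (real n) * (real n + 1) powr (- p)"
    using eventually_ge_at_top[of 1]
    by eventually_elim (use assms tt_ge in \<open>auto intro!: mult_left_mono powr_mono2'\<close>)
qed auto

text \<open>The main part is one of the nonnegative summands of the iterate. The set S allows
  nonnegativity on rational points only: \<open>v\<close> minus its truncation is negative at
  \<beta>.\<close>

lemma main_part_le_P1_pow:
  assumes "branch_closed S" "\<And>x. x \<in> S \<Longrightarrow> 0 \<le> f x" "x \<in> S"
  shows "main_part n f x \<le> (P1 ^^ n) f x"
  using assms(3)
proof (induction n arbitrary: x)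
  case 0
  show ?case by (simp add: main_part_def)
next
  case (Suc n)
  have x: "0 \<le> x" "x / (1 + x) \<in> S" "1 / (1 + x) \<in> S"
    using Suc.prems assms(1) by (auto simp: branch_closed_def)
  have "main_part n f (branch (right n) x) \<le> (P1 ^^ n) f (branch (right n) x)"
    using x by (intro Suc.IH) (auto simp: branch_def)
  also have "\<dots> \<le> (P1 ^^ n) f (x / (1 + x)) + (P1 ^^ n) f (1 / (1 + x))"
    using P1_pow_nonneg[OF assms(1,2) x(2)] P1_pow_nonneg[OF assms(1,2) x(3)]
    by (auto simp: branch_def)
  finally show ?case
    unfolding P1_pow_Suc main_part_Suc[OF x(1)] by (intro divide_right_mono) auto
qed

text \<open>The truncation equidistributes with integral close to \<open>mass\<close>. Of the
  nonnegative remainder only the main part is kept, and the main part of the truncation vanishes in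
  the limit.\<close>

lemma lower_bound:
  assumes k: "k \<ge> 1" and e: "e > 0"
  shows "\<forall>\<^sub>F n in sequentially. real k * mass - e + ln (real n) * main_part n v (1 / real k)
     \<le> ln (real n) * (P1 ^^ n) v (1 / real k)"
proof -
  let ?x = "1 / real k"
  have x: "?x \<in> {0..1} \<inter> \<rat>" "?x \<in> {0..1}" using k by auto
  obtain \<delta> where \<delta>: "\<delta> > 0" "integral {0..1} (trunc \<delta>) > mass - e / (2 * real k)"
    using integral_trunc_ge[of "e / (2 * real k)"] e k by auto
  have "real k * (mass - e / (2 * real k)) < real k * integral {0..1} (trunc \<delta>)"
    using \<delta> k by (intro mult_strict_left_mono) auto
  then have I: "real k * mass - e / 2 < real k * integral {0..1} (trunc \<delta>)"
    using k by (simp add: right_diff_distrib)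
  have "equidist k (trunc \<delta>)" by (intro equidist_continuous continuous_on_trunc \<delta> k)
  then have 1: "\<forall>\<^sub>F n in sequentially. real k * mass - e / 2 < ln (real n) * (P1 ^^ n) (trunc \<delta>) ?x"
    using I unfolding equidist_def by (intro order_tendstoD)
  \<comment> \<open>By \<open>den_ge_tt\<close> the denominator at 1/k is at least tt n / k, which
    produces the square of k.\<close>
  define D where "D = \<delta> powr (- \<alpha>) * (real k)\<^sup>2"
  have "(\<lambda>n. D * (ln (real n) * tt n powr (- 2))) \<longlonglongrightarrow> D * 0"
    by (intro tendsto_mult_left ln_over_tt_tendsto_0) auto
  then have 2: "\<forall>\<^sub>F n in sequentially. D * (ln (real n) * tt n powr (- 2)) < e / 2"
    using e by (intro order_tendstoD) auto
  show ?thesis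
    using 1 2 eventually_ge_at_top[of 1]
  proof eventually_elim
    case (elim n)
    have ln: "ln (real n) \<ge> 0" using elim by simp
    have "main_part n (\<lambda>x. v x - trunc \<delta> x) ?x \<le> (P1 ^^ n) (\<lambda>x. v x - trunc \<delta> x) ?x"
    proof (rule main_part_le_P1_pow[OF branch_closed_Rats _ x(1)])
      fix y :: real assume "y \<in> {0..1} \<inter> \<rat>"
      then have "y \<noteq> \<beta>" using beta by auto
      then show "0 \<le> v y - trunc \<delta> y" using trunc_le_v[OF \<delta>(1)] by simp
    qed
    then have 3: "main_part n v ?x - main_part n (trunc \<delta>) ?x \<le> (P1 ^^ n) v ?x - (P1 ^^ n) (trunc \<delta>) ?x"
      unfolding P1_pow_diff by (simp add: main_part_def diff_divide_distrib)
    have "main_part n (trunc \<delta>) ?x \<le> \<delta> powr (- \<alpha>) / (tt n / real k)\<^sup>2"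
      unfolding main_part_def
    proof (intro frac_le power_mono)
      show "tt n / real k \<le> cc n * ?x + dd n" using den_ge_tt[of ?x n] k by simp
    qed (use trunc_le \<delta> tt_pos[of n] k in auto)
    also have "\<dots> = D * tt n powr (- 2)"
      using tt_pos[of n] by (simp add: D_def power_divide powr_minus divide_simps)
    finally have "ln (real n) * main_part n (trunc \<delta>) ?x \<le> ln (real n) * (D * tt n powr (- 2))"
      using ln by (intro mult_left_mono)
    also have "\<dots> = D * (ln (real n) * tt n powr (- 2))" by (rule mult.left_commute)
    finally have 4: "ln (real n) * main_part n (trunc \<delta>) ?x \<le> D * (ln (real n) * tt n powr (- 2))" .
    have "ln (real n) * (main_part n v ?x - main_part n (trunc \<delta>) ?x)
       \<le> ln (real n) * ((P1 ^^ n) v ?x - (P1 ^^ n) (trunc \<delta>) ?x)"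
      using 3 ln by (intro mult_left_mono)
    with 4 elim show ?case unfolding right_diff_distrib by linarith
  qed
qed

text \<open>At a right step the orbit point is 1 / (1 + x) with x the next Gauss iterate. A
  following digit of at least 2 gives x \<le> 1/2, whence 2/3.\<close>

lemma right_pt_eventually: "\<forall>\<^sub>F i in sequentially. right i \<longrightarrow> 2/3 \<le> pt i"
proof -
  obtain J where J: "\<And>j. j \<ge> J \<Longrightarrow> 2 \<le> cf_a \<beta> (Suc j)"
    using digits_eventually[of 2] by (auto simp: eventually_sequentially)
  have "right i \<longrightarrow> 2/3 \<le> pt i" if i: "i \<ge> blk J" for i
  proof
    assume r: "right i"
    obtain j s where js: "s < cf_a \<beta> (Suc j)" "i = blk j + s" using blk_decompose by blast
    have "blk J < blk (Suc j)" using i js by (simp add: blk_Suc)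
    then have "J < Suc j" using strict_mono_less[OF blk_strict_mono] by blast
    then have a: "2 \<le> cf_a \<beta> (Suc (Suc j))" by (intro J) auto
    then have "2 \<le> 1 / xg (Suc j)" using cf_a_xg[of "Suc j"] xg_pos[of "Suc (Suc j)"] by linarith
    then have xle: "xg (Suc j) \<le> 1/2" using xg_pos[of "Suc j"] by (simp add: field_simps)
    have "Suc s = cf_a \<beta> (Suc j)" using right_orbit js r by auto
    then have "cf_a \<beta> (Suc j) - s = 1" by simp
    then have "pt i = 1 / (1 + xg (Suc j))" using orbit(1)[OF js(1)] js(2) by simp
    moreover have "2/3 \<le> 1 / (1 + xg (Suc j))" using xle xg_pos[of "Suc j"] by (simp add: field_simps)
    ultimately show "2/3 \<le> pt i" by simp
  qed
  then show ?thesis by (auto simp: eventually_sequentially)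
qed

text \<open>The sibling image lies on the other side of 1/2 from \<open>pt i\<close>, and
  \<open>pt i\<close> is irrational, hence different from 1/2. By \<open>inv_branch_dist\<close> the
  preimages leaving at time i keep a positive distance r i from \<beta>, and finitely many times
  admit a common \<delta>.\<close>

lemma side_part_trunc_eq_0:
  obtains \<delta> where "\<delta> > 0" "\<And>i z. i < I \<Longrightarrow> z \<in> {0..1} \<Longrightarrow> side_part i (\<lambda>x. v x - trunc \<delta> x) z = 0"
proof -
  define r where "r i = \<bar>pt i - 1/2\<bar> / (tt i * tt i)" for i
  have rpos: "r i > 0" for i using pt_neq_half[of i] tt_pos[of i] by (simp add: r_def)
  define \<delta> where "\<delta> = Min (insert 1 (r ` {..<I}))"
  have "\<delta> > 0" unfolding \<delta>_def using rpos by (subst Min_gr_iff) auto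
  moreover have "side_part i (\<lambda>x. v x - trunc \<delta> x) z = 0" if i: "i < I" and z: "z \<in> {0..1}" for i z
  proof -
    define y where "y = branch (\<not> right i) z"
    have y: "y \<in> {0..1}" unfolding y_def using z by (rule branch_range)
    have far: "\<bar>pt i - 1/2\<bar> \<le> \<bar>pt i - y\<bar>"
    proof (cases "right i")
      case True
      have "z / (1 + z) \<le> 1/2" using z by (simp add: field_simps)
      then show ?thesis using True by (simp add: y_def branch_def right_def)
    next
      case False
      have "1/2 \<le> 1 / (1 + z)" using z by (simp add: field_simps)
      then show ?thesis using False by (simp add: y_def branch_def right_def)
    qed
    have "\<delta> \<le> r i" unfolding \<delta>_def using i by (intro Min_le) auto
    also have "r i \<le> \<bar>pt i - y\<bar> / ((cc i * y + dd i) * (cc i * pt i + dd i))"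
      unfolding r_def using far y den_le_tt[of y i] den_le_tt[of "pt i" i] den_pos[of y i] den_pos[of "pt i" i]
        pt_pos[of i] pt_less_1[of i] tt_pos[of i]
      by (intro frac_le mult_mono mult_pos_pos) auto
    also have "\<dots> = \<bar>\<beta> - inv_branch i y\<bar>" using inv_branch_dist[OF y] by simp
    finally have "trunc \<delta> (inv_branch i y) = v (inv_branch i y)" by (rule trunc_eq_v)
    then show ?thesis by (simp add: side_part_def main_part_def y_def)
  qed
  ultimately show ?thesis using that by blast
qed

text \<open>The cut I is chosen first, so that the tail of the weights from I on is small, and
  \<delta> afterwards, so that the remainder \<open>v\<close> minus truncation has no side parts
  before I. The factor 2 counts the main part itself and the extra term of
  \<open>side_part_bound\<close> for i = n - 1.\<close>

lemma upper_bound: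
  assumes k: "k \<ge> 1" and e: "e > 0"
  shows "\<forall>\<^sub>F n in sequentially. ln (real n) * (P1 ^^ n) v (1 / real k)
     \<le> real k * mass + e + 2 * (ln (real n) * main_part n v (1 / real k))"
proof -
  let ?x = "1 / real k"
  have x: "?x \<in> {0..1}" using k by auto
  obtain C where C: "C > 0" "\<And>i n. i < n \<Longrightarrow> (right i \<Longrightarrow> 2/3 \<le> pt i) \<Longrightarrow>
    (P1 ^^ (n - Suc i)) (side_part i v) ?x
      \<le> C * weight i / ln (real (n - i) + 1) + (if Suc i = n then main_part n v ?x else 0)"
    using side_part_bound[OF k] by blast
  let ?B = "\<lambda>i. weight i * ln (real i + 2)"
  have Bnn: "?B i \<ge> 0" for i by (intro mult_nonneg_nonneg weight_nonneg) auto
  define C' where "C' = C * (2 / ln 2)"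
  have C': "C' > 0" using C by (simp add: C'_def)
  have "\<exists>N. \<forall>m\<ge>N. \<forall>n\<ge>m. norm (sum ?B {m..<n}) < e / (2 * C')"
    using summable_weight e C' unfolding summable_Cauchy by (meson divide_pos_pos mult_pos_pos zero_less_numeral)
  then obtain I1 where I1: "\<And>m n. m \<ge> I1 \<Longrightarrow> sum ?B {m..<n} < e / (2 * C')"
  proof (rule exE)
    fix N assume N: "\<forall>m\<ge>N. \<forall>n\<ge>m. norm (sum ?B {m..<n}) < e / (2 * C')"
    have "sum ?B {m..<n} < e / (2 * C')" if "m \<ge> N" for m n
    proof (cases "n \<ge> m")
      case True
      then have "norm (sum ?B {m..<n}) < e / (2 * C')" using N that by blast
      then show ?thesis by simp
    next
      case False
      then show ?thesis using e C' by simp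
    qed
    then show thesis using that by blast
  qed
  obtain I2 where I2: "\<And>i. i \<ge> I2 \<Longrightarrow> right i \<Longrightarrow> 2/3 \<le> pt i"
    using right_pt_eventually by (auto simp: eventually_sequentially)
  define I where "I = max I1 I2"
  obtain \<delta> where \<delta>: "\<delta> > 0" "\<And>i z. i < I \<Longrightarrow> z \<in> {0..1} \<Longrightarrow> side_part i (\<lambda>x. v x - trunc \<delta> x) z = 0"
    using side_part_trunc_eq_0 by blast
  have "real k * integral {0..1} (trunc \<delta>) \<le> real k * mass"
    by (intro mult_left_mono integral_trunc_le \<delta>) auto
  then have I: "real k * integral {0..1} (trunc \<delta>) < real k * mass + e / 2" using e by linarith
  have "equidist k (trunc \<delta>)" by (intro equidist_continuous continuous_on_trunc \<delta> k)
  then have 1: "\<forall>\<^sub>F n in sequentially. ln (real n) * (P1 ^^ n) (trunc \<delta>) ?x < real k * mass + e / 2"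
    using I unfolding equidist_def by (intro order_tendstoD)
  show ?thesis
    using 1 eventually_ge_at_top[of "max 1 (Suc I)"]
  proof eventually_elim
    case (elim n)
    let ?u = "\<lambda>x. v x - trunc \<delta> x"
    have n: "n \<ge> 1" "n > I" using elim by auto
    have ln: "ln (real n) \<ge> 0" using n by simp
    have uv: "main_part m ?u z \<le> main_part m v z" for m z
      unfolding main_part_def by (intro divide_right_mono) (auto simp: trunc_nonneg)
    then have suv: "side_part m ?u z \<le> side_part m v z" for m z
      unfolding side_part_def by (intro divide_right_mono) auto
    have dec: "(P1 ^^ n) ?u ?x = main_part n ?u ?x + (\<Sum>i<n. (P1 ^^ (n - Suc i)) (side_part i ?u) ?x)"
      by (rule P1_pow_decompose[OF x])
    have "(\<Sum>i<n. (P1 ^^ (n - Suc i)) (side_part i ?u) ?x)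
        = (\<Sum>i=I..<n. (P1 ^^ (n - Suc i)) (side_part i ?u) ?x)"
    proof (rule sum.mono_neutral_right)
      show "\<forall>i\<in>{..<n} - {I..<n}. (P1 ^^ (n - Suc i)) (side_part i ?u) ?x = 0"
      proof
        fix i assume "i \<in> {..<n} - {I..<n}"
        then have "i < I" by auto
        then have "(P1 ^^ (n - Suc i)) (side_part i ?u) ?x = (P1 ^^ (n - Suc i)) (\<lambda>x. 0) ?x"
          by (intro P1_pow_cong[OF branch_closed_Icc _ x] \<delta>(2))
        then show "(P1 ^^ (n - Suc i)) (side_part i ?u) ?x = 0" by (simp add: P1_pow_zero)
      qed
    qed auto
    also have "\<dots> \<le> (\<Sum>i=I..<n. C * weight i / ln (real (n - i) + 1) + (if Suc i = n then main_part n v ?x else 0))"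
    proof (intro sum_mono)
      fix i assume i: "i \<in> {I..<n}"
      have "(P1 ^^ (n - Suc i)) (side_part i ?u) ?x \<le> (P1 ^^ (n - Suc i)) (side_part i v) ?x"
        by (intro P1_pow_mono[OF branch_closed_Icc _ x] suv)
      also have "\<dots> \<le> C * weight i / ln (real (n - i) + 1) + (if Suc i = n then main_part n v ?x else 0)"
        using i I2[of i] by (intro C(2)) (auto simp: I_def)
      finally show "(P1 ^^ (n - Suc i)) (side_part i ?u) ?x
        \<le> C * weight i / ln (real (n - i) + 1) + (if Suc i = n then main_part n v ?x else 0)" .
    qed
    also have "\<dots> = (\<Sum>i=I..<n. C * weight i / ln (real (n - i) + 1))
        + (\<Sum>i=I..<n. if Suc i = n then main_part n v ?x else 0)"
      by (rule sum.distrib)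
    finally have side: "(\<Sum>i<n. (P1 ^^ (n - Suc i)) (side_part i ?u) ?x)
        \<le> (\<Sum>i=I..<n. C * weight i / ln (real (n - i) + 1))
        + (\<Sum>i=I..<n. if Suc i = n then main_part n v ?x else 0)" .
    have "(\<Sum>i=I..<n. if Suc i = n then main_part n v ?x else 0)
        = (\<Sum>i=I..<n. if i = n - 1 then main_part n v ?x else 0)"
      using n by (intro sum.cong refl if_cong) auto
    also have "\<dots> = main_part n v ?x"
      using n by auto
    finally have 2: "(P1 ^^ n) ?u ?x \<le> 2 * main_part n v ?x + (\<Sum>i=I..<n. C * weight i / ln (real (n - i) + 1))"
      using dec side uv[of n ?x] by linarith
    have "ln (real n) * (\<Sum>i=I..<n. C * weight i / ln (real (n - i) + 1)) \<le> (\<Sum>i=I..<n. C' * ?B i)"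
      unfolding sum_distrib_left
    proof (intro sum_mono)
      fix i assume i: "i \<in> {I..<n}"
      then have lni: "ln (real (n - i) + 1) > 0" by simp
      have "ln (real n) * (C * weight i / ln (real (n - i) + 1))
          \<le> (2 / ln 2 * (ln (real i + 2) * ln (real (n - i) + 1))) * (C * weight i / ln (real (n - i) + 1))"
        using i C weight_nonneg[of i] lni by (intro mult_right_mono ln_le_product divide_nonneg_nonneg) auto
      also have "\<dots> = C' * ?B i" using lni by (simp add: C'_def)
      finally show "ln (real n) * (C * weight i / ln (real (n - i) + 1)) \<le> C' * ?B i" .
    qed
    also have "\<dots> = C' * sum ?B {I..<n}" by (simp add: sum_distrib_left)
    also have "\<dots> \<le> C' * (e / (2 * C'))"
      using I1[of I n] C' by (intro mult_left_mono) (auto simp: I_def)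
    also have "\<dots> = e / 2" using C' by simp
    finally have 3: "ln (real n) * (\<Sum>i=I..<n. C * weight i / ln (real (n - i) + 1)) \<le> e / 2" .
    have "ln (real n) * ((P1 ^^ n) v ?x - (P1 ^^ n) (trunc \<delta>) ?x)
      \<le> ln (real n) * (2 * main_part n v ?x + (\<Sum>i=I..<n. C * weight i / ln (real (n - i) + 1)))"
      using 2 ln unfolding P1_pow_diff by (intro mult_left_mono)
    with 3 elim(1) show ?case unfolding right_diff_distrib distrib_left by linarith
  qed
qed

end

context typed_point
begin

section \<open>Resonant times and the dichotomy\<close>

text \<open>This makes the definite description in \<open>nkj\<close> well defined. A repetition
  would confine the orbit to finitely many positive values, hence above a positive bound; but
  \<open>xg j\<close> tends to 0 as the digits tend to infinity.\<close>

lemma pt_inj: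
  assumes "pt n = pt m"
  shows "n = m"
proof -
  have False if nm: "n < m" "pt n = pt m" for n m
  proof -
    have shift: "pt (n + t) = pt (m + t)" for t
      using nm(2) by (induction t) (simp_all add: pt_def)
    define \<mu> where "\<mu> = Min (pt ` {n..<m})"
    have \<mu>: "\<mu> > 0" unfolding \<mu>_def using nm pt_pos by (subst Min_gr_iff) auto
    have ge: "\<mu> \<le> pt i" if "i \<ge> n" for i
      using that
    proof (induction i rule: less_induct)
      case (less i)
      show ?case
      proof (cases "i < m")
        case True
        then show ?thesis unfolding \<mu>_def using less.prems by (intro Min_le) auto
      next
        case False
        have "pt i = pt (n + (i - m))" using shift[of "i - m"] False by simp
        moreover have "\<mu> \<le> pt (n + (i - m))" using False nm less.prems by (intro less.IH) auto
        ultimately show ?thesis by simp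
      qed
    qed
    obtain J where J: "\<And>j. j \<ge> J \<Longrightarrow> nat \<lceil>1 / \<mu>\<rceil> \<le> cf_a \<beta> (Suc j)"
      using digits_eventually[of "nat \<lceil>1 / \<mu>\<rceil>"] unfolding eventually_sequentially by blast
    define j where "j = max J n"
    have "\<mu> \<le> xg j" using ge[of "blk j"] blk_ge[of j] orbit_block[of j] by (simp add: j_def)
    then have "1 / xg j \<le> 1 / \<mu>" using \<mu> by (intro divide_left_mono) (auto simp: xg_pos)
    moreover have "1 / \<mu> \<le> real (cf_a \<beta> (Suc j))" using J[of j] by (simp add: j_def)
    moreover have "real (cf_a \<beta> (Suc j)) < 1 / xg j" using cf_a_xg[of j] xg_pos[of "Suc j"] by simp
    ultimately show False by linarith
  qed
  then show ?thesis using assms by (metis nat_neq_iff)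
qed

text \<open>The time in block j at which the leading digit, lowered by one at each step, has come
  down to k; the difference is meant for k at most that digit.\<close>

definition res_time :: "nat \<Rightarrow> nat \<Rightarrow> nat" where
  "res_time k j = blk j + (cf_a \<beta> (Suc j) - k)"

text \<open>The index shifts by one: block j runs down the digit of index j + 1, so the tail behind
  k is the Gauss iterate of order j + 1.\<close>

lemma nkj_eq:
  assumes "k \<ge> 1" "k \<le> cf_a \<beta> (Suc j)"
  shows "nkj \<beta> k (Suc j) = res_time k j"
proof -
  have s: "cf_a \<beta> (Suc j) - k < cf_a \<beta> (Suc j)" using assms by auto
  have p: "pt (res_time k j) = 1 / (real k + (gauss ^^ Suc j) \<beta>)"
    unfolding res_time_def orbit(1)[OF s] using assms by (simp add: xg_def)
  show ?thesis
    unfolding nkj_def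
  proof (rule the_equality)
    show "(farey ^^ res_time k j) \<beta> = 1 / (real k + (gauss ^^ Suc j) \<beta>)"
      using p by (simp add: pt_def)
    fix n assume "(farey ^^ n) \<beta> = 1 / (real k + (gauss ^^ Suc j) \<beta>)"
    then have "pt n = pt (res_time k j)" using p by (simp add: pt_def)
    then show "n = res_time k j" by (rule pt_inj)
  qed
qed

lemma res_time_ge: "j \<le> res_time k j"
  using blk_ge[of j] by (simp add: res_time_def)

text \<open>At a resonant time the denominator at 1/k equals \<open>cf_q \<beta> (Suc j)\<close> / k
  exactly, and its value at \<open>pt n\<close> has the same order. The distance from
  \<open>pt n\<close> to 1/k is of order \<open>xg (Suc j)\<close>, that is, of the reciprocal of
  the following digit. The powers \<alpha> and -(2 - \<alpha>) of the two denominators combine to -2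
  * (1 - \<alpha>).\<close>

lemma main_part_resonant:
  assumes k: "k \<ge> 1" "k \<le> cf_a \<beta> (Suc j)"
  defines "n \<equiv> res_time k j"
  defines "W \<equiv> real (cf_q \<beta> (Suc j)) powr (- 2 * (1 - \<alpha>)) * real (cf_a \<beta> (Suc (Suc j))) powr \<alpha>"
  shows "main_part n v (1 / real k) \<le> (real k powr (2 * (1 - \<alpha>)) * (2 * real k * (real k + 1)) powr \<alpha>) * W"
    and "(real k powr (2 - \<alpha>) / (real k + 1) powr \<alpha>) * W \<le> main_part n v (1 / real k)"
proof -
  let ?K = "real k" and ?q = "real (cf_q \<beta> (Suc j))" and ?a = "real (cf_a \<beta> (Suc (Suc j)))" and ?x = "xg (Suc j)"
  define s where "s = cf_a \<beta> (Suc j) - k"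
  have s: "s < cf_a \<beta> (Suc j)" "cf_a \<beta> (Suc j) - s = k" "n = blk j + s"
    using k by (auto simp: s_def n_def res_time_def)
  have pt: "pt n = 1 / (?K + ?x)" and c: "cc n = real s * real (cf_q \<beta> j) + real (cf_qprev j)"
    and d: "dd n = real (cf_q \<beta> j)"
    using orbit[OF s(1)] s by auto
  have K: "?K \<ge> 1" using k by simp
  have x: "0 < ?x" "?x < 1" by (auto simp: xg_pos xg_less_1)
  have q: "?q \<ge> 1" using cf_q_ge_1[of "Suc j"] by simp
  have a: "?a \<ge> 1" using cf_a_ge_1[of "Suc j"] by simp
  have "real (cf_a \<beta> (Suc j)) = real s + ?K" using k by (simp add: s_def)
  \<comment> \<open>The offset s is the digit minus k, so adding k times d restores the full digit
    in the recursion for \<open>cf_q\<close>.\<close>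
  then have ckd: "cc n + ?K * dd n = ?q" unfolding c d cf_q_rec by (simp add: algebra_simps)
  have cd: "0 \<le> cc n" "0 < dd n" using cc_nonneg[of n] dd_ge_1[of n] by auto
  have den: "cc n * (1 / ?K) + dd n = ?q / ?K" using ckd K by (simp add: field_simps)
  have xa: "1 / (2 * ?a) \<le> ?x" "?x \<le> 1 / ?a"
  proof -
    have e: "1 / ?x = ?a + xg (Suc (Suc j))" by (rule cf_a_xg)
    have ex: "?x = 1 / (?a + xg (Suc (Suc j)))" unfolding e[symmetric] by simp
    show "1 / (2 * ?a) \<le> ?x" unfolding ex
      using a xg_pos[of "Suc (Suc j)"] xg_less_1[of "Suc (Suc j)"] by (intro divide_left_mono) auto
    show "?x \<le> 1 / ?a" unfolding ex
      using a xg_pos[of "Suc (Suc j)"] by (intro divide_left_mono) auto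
  qed
  have dist: "\<bar>pt n - 1 / ?K\<bar> = ?x / (?K * (?K + ?x))"
  proof -
    have "pt n - 1 / ?K = - (?x / (?K * (?K + ?x)))" unfolding pt using K x by (simp add: field_simps)
    then show ?thesis using K x by simp
  qed
  have M: "main_part n v (1 / ?K)
      = (cc n * pt n + dd n) powr \<alpha> * (?q / ?K) powr (- (2 - \<alpha>)) * (?x / (?K * (?K + ?x))) powr (- \<alpha>)"
    using main_part_v[of "1 / ?K" n] K unfolding dist den by simp
  have B1: "cc n * pt n + dd n \<le> ?q / ?K"
    unfolding den[symmetric] pt using K x cd by (intro add_mono mult_left_mono divide_left_mono) auto
  have B2: "?q / (?K + 1) \<le> cc n * pt n + dd n"
  proof -
    have "?q / (?K + 1) = cc n * (1 / (?K + 1)) + ?K / (?K + 1) * dd n"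
      unfolding ckd[symmetric] by (simp add: add_divide_distrib)
    also have "\<dots> \<le> cc n * pt n + 1 * dd n"
      unfolding pt using K x cd by (intro add_mono mult_left_mono mult_right_mono divide_left_mono) auto
    finally show ?thesis by simp
  qed
  have D1: "1 / (2 * ?K * (?K + 1) * ?a) \<le> ?x / (?K * (?K + ?x))"
  proof -
    have "1 / (2 * ?K * (?K + 1) * ?a) = (1 / (2 * ?a)) / (?K * (?K + 1))" by (simp add: mult_ac)
    also have "\<dots> \<le> ?x / (?K * (?K + ?x))"
      using xa K x a by (intro frac_le mult_left_mono) auto
    finally show ?thesis .
  qed
  have D2: "?x / (?K * (?K + ?x)) \<le> 1 / ?a"
  proof -
    have "1 * 1 \<le> ?K * (?K + ?x)" using K x by (intro mult_mono) auto
    then have "?x / (?K * (?K + ?x)) \<le> ?x / 1" using x by (intro divide_left_mono) auto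
    then show ?thesis using xa by simp
  qed
  have "main_part n v (1 / ?K) \<le> (?q / ?K) powr \<alpha> * (?q / ?K) powr (- (2 - \<alpha>))
      * (1 / (2 * ?K * (?K + 1) * ?a)) powr (- \<alpha>)"
    unfolding M using alpha B1 D1 K q a cd pt_pos[of n]
    by (intro mult_mono powr_mono2 powr_mono2') (auto intro!: add_nonneg_nonneg)
  also have "\<dots> = (?q / ?K) powr (- (2 * (1 - \<alpha>))) * (2 * ?K * (?K + 1) * ?a) powr \<alpha>"
  proof -
    have "(1 / A) powr (- \<alpha>) = A powr \<alpha>" if "A > 0" for A :: real
      using powr_divide_minus[of 1 A \<alpha>] that by simp
    moreover have "(?q / ?K) powr \<alpha> * (?q / ?K) powr (- (2 - \<alpha>)) = (?q / ?K) powr (- (2 * (1 - \<alpha>)))"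
      unfolding powr_add[symmetric] by (rule arg_cong[where f = "\<lambda>p. (?q / ?K) powr p"]) simp
    moreover have "2 * ?K * (?K + 1) * ?a > 0" using K a by (intro mult_pos_pos) auto
    ultimately show ?thesis by metis
  qed
  also have "(?q / ?K) powr (- (2 * (1 - \<alpha>))) = ?q powr (- (2 * (1 - \<alpha>))) * ?K powr (2 * (1 - \<alpha>))"
    using K q by (intro powr_divide_minus) auto
  also have "(2 * ?K * (?K + 1) * ?a) powr \<alpha> = (2 * ?K * (?K + 1)) powr \<alpha> * ?a powr \<alpha>"
    using K a by (intro powr_mult)
  finally show "main_part n v (1 / ?K) \<le> (?K powr (2 * (1 - \<alpha>)) * (2 * ?K * (?K + 1)) powr \<alpha>) * W"
    by (simp add: W_def mult_ac)
  have "(?K powr (2 - \<alpha>) / (?K + 1) powr \<alpha>) * W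
      = (?q powr \<alpha> / (?K + 1) powr \<alpha>) * (?q powr (- (2 - \<alpha>)) * ?K powr (2 - \<alpha>)) * ?a powr \<alpha>"
  proof -
    have "?q powr (- 2 * (1 - \<alpha>)) = ?q powr \<alpha> * ?q powr (- (2 - \<alpha>))"
      unfolding powr_add[symmetric] by (rule arg_cong[where f = "\<lambda>p. ?q powr p"]) simp
    then show ?thesis unfolding W_def by simp
  qed
  also have "\<dots> = (?q / (?K + 1)) powr \<alpha> * (?q / ?K) powr (- (2 - \<alpha>)) * (1 / ?a) powr (- \<alpha>)"
    using powr_divide_minus[of ?q ?K "2 - \<alpha>"] powr_divide_minus[of 1 ?a \<alpha>] K q a
    by (simp add: powr_divide)
  also have "\<dots> \<le> main_part n v (1 / ?K)"
    unfolding M using alpha B2 D2 K q a x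
    by (intro mult_mono powr_mono2 powr_mono2') auto
  finally show "(?K powr (2 - \<alpha>) / (?K + 1) powr \<alpha>) * W \<le> main_part n v (1 / ?K)" .
qed

lemma main_part_resonant_Skj:
  assumes k: "k \<ge> 1"
  obtains U L where "U > 0" "L > 0"
    "\<And>j. k \<le> cf_a \<beta> (Suc j) \<Longrightarrow>
       ln (real (res_time k j)) * main_part (res_time k j) v (1 / real k) \<le> U * Skj \<alpha> \<beta> k (Suc j)"
    "\<And>j. k \<le> cf_a \<beta> (Suc j) \<Longrightarrow>
       L * Skj \<alpha> \<beta> k (Suc j) \<le> ln (real (res_time k j)) * main_part (res_time k j) v (1 / real k)"
proof -
  define U where "U = real k powr (2 * (1 - \<alpha>)) * (2 * real k * (real k + 1)) powr \<alpha>"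
  define L where "L = real k powr (2 - \<alpha>) / (real k + 1) powr \<alpha>"
  have ln: "0 \<le> ln (real m)" for m :: nat by (cases "m = 0") auto
  define W where "W j = real (cf_q \<beta> (Suc j)) powr (- 2 * (1 - \<alpha>)) * real (cf_a \<beta> (Suc (Suc j))) powr \<alpha>" for j
  have S: "Skj \<alpha> \<beta> k (Suc j) = ln (real (res_time k j)) * W j" if "k \<le> cf_a \<beta> (Suc j)" for j
  proof -
    have "real (cf_q \<beta> (Suc j)) powr (- 2 * (1 - \<alpha>)) = 1 / real (cf_q \<beta> (Suc j)) powr (2 * (1 - \<alpha>))"
      using powr_minus_divide[of "real (cf_q \<beta> (Suc j))" "2 * (1 - \<alpha>)"] by simp
    then show ?thesis
      unfolding Skj_def W_def nkj_eq[OF k that] by (simp add: mult_ac)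
  qed
  show ?thesis
  proof (rule that[of U L])
    show "U > 0" "L > 0" using k by (auto simp: U_def L_def)
    fix j assume j: "k \<le> cf_a \<beta> (Suc j)"
    have "ln (real (res_time k j)) * main_part (res_time k j) v (1 / real k) \<le> ln (real (res_time k j)) * (U * W j)"
      using main_part_resonant(1)[OF k j] ln unfolding U_def W_def by (intro mult_left_mono)
    then show "ln (real (res_time k j)) * main_part (res_time k j) v (1 / real k) \<le> U * Skj \<alpha> \<beta> k (Suc j)"
      unfolding S[OF j] by (simp add: mult_ac)
    have "ln (real (res_time k j)) * (L * W j) \<le> ln (real (res_time k j)) * main_part (res_time k j) v (1 / real k)"
      using main_part_resonant(2)[OF k j] ln unfolding L_def W_def by (intro mult_left_mono)
    then show "L * Skj \<alpha> \<beta> k (Suc j) \<le> ln (real (res_time k j)) * main_part (res_time k j) v (1 / real k)"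
      unfolding S[OF j] by (simp add: mult_ac)
  qed
qed

text \<open>A leading digit different from k keeps \<open>pt\<close> at a distance of at least 1 /
  (2 * k^2) from 1/k. The bound on \<open>xg (Suc j)\<close> matters for the digit k - 1, where the
  orbit point 1 / (k - 1 + x) approaches 1/k as x approaches 1.\<close>

lemma main_part_nonresonant:
  assumes k: "k \<ge> 1" and s: "s < cf_a \<beta> (Suc j)" "cf_a \<beta> (Suc j) - s \<noteq> k" and x: "xg (Suc j) \<le> 1/2"
  shows "main_part (blk j + s) v (1 / real k)
    \<le> (real k powr (2 - \<alpha>) * (2 * (real k)\<^sup>2) powr \<alpha>) * tt (blk j + s) powr (- (2 * (1 - \<alpha>)))"
proof -
  let ?n = "blk j + s" and ?K = "real k" and ?x = "xg (Suc j)" and ?r = "real (cf_a \<beta> (Suc j) - s)"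
  have K: "?K \<ge> 1" using k by simp
  have x0: "?x > 0" by (rule xg_pos)
  have pt: "pt ?n = 1 / (?r + ?x)" by (rule orbit(1)[OF s(1)])
  have r: "?r \<ge> 1" using s(1) by simp
  have dist: "1 / (2 * ?K\<^sup>2) \<le> \<bar>pt ?n - 1 / ?K\<bar>"
  proof (cases "cf_a \<beta> (Suc j) - s < k")
    case True
    then have "?r + ?x \<le> ?K - 1/2" using x by linarith
    then have "1 / (?K - 1/2) \<le> pt ?n" unfolding pt using r x0 by (intro divide_left_mono) auto
    moreover have "1 / ?K + 1 / (2 * ?K\<^sup>2) \<le> 1 / (?K - 1/2)"
      using K by (simp add: divide_simps power2_eq_square) (simp add: algebra_simps)
    ultimately show ?thesis by linarith
  next
    case False
    then have "?K + 1 \<le> ?r + ?x" using s(2) x0 by linarith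
    then have "pt ?n \<le> 1 / (?K + 1)" unfolding pt using K by (intro divide_left_mono) auto
    moreover have "1 / (?K + 1) + 1 / (2 * ?K\<^sup>2) \<le> 1 / ?K"
      using K by (simp add: divide_simps power2_eq_square) (simp add: algebra_simps)
    ultimately show ?thesis by linarith
  qed
  have t: "tt ?n > 0" by (rule tt_pos)
  have "main_part ?n v (1 / ?K) \<le> tt ?n powr \<alpha> * (tt ?n / ?K) powr (- (2 - \<alpha>)) * (1 / (2 * ?K\<^sup>2)) powr (- \<alpha>)"
    using K t dist den_ge_tt[of "1 / ?K" ?n] by (intro main_part_v_le) auto
  also have "(tt ?n / ?K) powr (- (2 - \<alpha>)) = tt ?n powr (- (2 - \<alpha>)) * ?K powr (2 - \<alpha>)"
    using t K by (intro powr_divide_minus) auto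
  also have "(1 / (2 * ?K\<^sup>2)) powr (- \<alpha>) = 1 powr (- \<alpha>) * (2 * ?K\<^sup>2) powr \<alpha>"
    using K by (intro powr_divide_minus) auto
  also have "tt ?n powr \<alpha> * (tt ?n powr (- (2 - \<alpha>)) * ?K powr (2 - \<alpha>)) * (1 powr (- \<alpha>) * (2 * ?K\<^sup>2) powr \<alpha>)
    = (?K powr (2 - \<alpha>) * (2 * ?K\<^sup>2) powr \<alpha>) * (tt ?n powr \<alpha> * tt ?n powr (- (2 - \<alpha>)))"
    by simp
  also have "tt ?n powr \<alpha> * tt ?n powr (- (2 - \<alpha>)) = tt ?n powr (- (2 * (1 - \<alpha>)))"
    unfolding powr_add[symmetric] by (rule arg_cong[where f = "\<lambda>p. tt ?n powr p"]) simp
  finally show ?thesis .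
qed

definition resonant :: "nat \<Rightarrow> nat \<Rightarrow> bool" where
  "resonant k n \<longleftrightarrow> (\<exists>j. k \<le> cf_a \<beta> (Suc j) \<and> n = res_time k j)"

lemma nonresonant_small:
  assumes k: "k \<ge> 1" and e: "e > 0"
  shows "\<forall>\<^sub>F n in sequentially. \<not> resonant k n \<longrightarrow> ln (real n) * main_part n v (1 / real k) < e"
proof -
  define W where "W = real k powr (2 - \<alpha>) * (2 * (real k)\<^sup>2) powr \<alpha>"
  obtain J where J: "\<And>j. j \<ge> J \<Longrightarrow> 2 \<le> cf_a \<beta> (Suc j)"
    using digits_eventually[of 2] by (auto simp: eventually_sequentially)
  have "(\<lambda>n. W * (ln (real n) * tt n powr (- (2 * (1 - \<alpha>))))) \<longlonglongrightarrow> W * 0"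
    using alpha by (intro tendsto_mult_left ln_over_tt_tendsto_0) auto
  then have "\<forall>\<^sub>F n in sequentially. W * (ln (real n) * tt n powr (- (2 * (1 - \<alpha>)))) < e"
    using e by (intro order_tendstoD) auto
  then show ?thesis
    using eventually_ge_at_top[of "max 1 (blk J)"]
  proof eventually_elim
    case (elim n)
    show ?case
    proof
      assume nr: "\<not> resonant k n"
      obtain j s where js: "s < cf_a \<beta> (Suc j)" "n = blk j + s" using blk_decompose by blast
      have "blk J < blk (Suc j)" using elim(2) js by (simp add: blk_Suc)
      then have "J < Suc j" using strict_mono_less[OF blk_strict_mono] by blast
      then have "2 \<le> cf_a \<beta> (Suc (Suc j))" by (intro J) auto
      then have "2 \<le> 1 / xg (Suc j)" using cf_a_xg[of "Suc j"] xg_pos[of "Suc (Suc j)"] by linarith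
      then have x: "xg (Suc j) \<le> 1/2" using xg_pos[of "Suc j"] by (simp add: field_simps)
      have "cf_a \<beta> (Suc j) - s \<noteq> k"
      proof
        assume "cf_a \<beta> (Suc j) - s = k"
        then have "k \<le> cf_a \<beta> (Suc j)" "n = res_time k j" using js by (auto simp: res_time_def)
        then show False using nr by (auto simp: resonant_def)
      qed
      from main_part_nonresonant[OF k js(1) this x]
      have "main_part n v (1 / real k) \<le> W * tt n powr (- (2 * (1 - \<alpha>)))"
        unfolding W_def js(2) .
      then have "ln (real n) * main_part n v (1 / real k) \<le> ln (real n) * (W * tt n powr (- (2 * (1 - \<alpha>))))"
        using elim(2) by (intro mult_left_mono) auto
      also have "\<dots> < e" using elim(1) by (simp add: mult.left_commute)
      finally show "ln (real n) * main_part n v (1 / real k) < e" .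
    qed
  qed
qed

text \<open>A late resonant time is followed by a non-resonant one: resonant times lie k before the
  end of a block, and the ends of late blocks are at least k + 2 apart.\<close>

lemma nonresonant_frequently:
  assumes k: "k \<ge> 1"
  shows "\<exists>n\<ge>N. \<not> resonant k n"
proof -
  obtain J where J: "\<And>j. j \<ge> J \<Longrightarrow> k + 2 \<le> cf_a \<beta> (Suc j)"
    using digits_eventually[of "k + 2"] by (auto simp: eventually_sequentially)
  define j where "j = max J N"
  have a: "k + 2 \<le> cf_a \<beta> (Suc j)" "k + 2 \<le> cf_a \<beta> (Suc (Suc j))" using J[of j] J[of "Suc j"] by (auto simp: j_def)
  let ?n = "Suc (res_time k j)"
  have "\<not> resonant k ?n"
  proof
    assume "resonant k ?n"
    then obtain i where i: "k \<le> cf_a \<beta> (Suc i)" "?n = res_time k i" by (auto simp: resonant_def)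
    have *: "blk (Suc i) = Suc (blk (Suc j))" using i a by (simp add: res_time_def blk_Suc)
    then have "blk (Suc j) < blk (Suc i)" by simp
    then have "Suc j < Suc i" using strict_mono_less[OF blk_strict_mono] by blast
    then have "blk (Suc (Suc j)) \<le> blk (Suc i)"
      using strict_mono_less_eq[OF blk_strict_mono] by auto
    then show False using * a by (simp add: blk_Suc)
  qed
  moreover have "N \<le> ?n" using res_time_ge[of j k] by (simp add: j_def)
  ultimately show ?thesis by blast
qed

lemma Skj_nonneg: "0 \<le> Skj \<alpha> \<beta> k j"
proof -
  have "0 \<le> ln (real m)" for m :: nat by (cases "m = 0") auto
  then show ?thesis by (simp add: Skj_def)
qed

theorem dichotomy:
  assumes k: "k \<ge> 1"
  defines "y \<equiv> \<lambda>n. ln (real n) * (P1 ^^ n) v (1 / real k)"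
  shows "limsup (\<lambda>j. ereal (Skj \<alpha> \<beta> k j)) = 0 \<Longrightarrow> y \<longlonglongrightarrow> real k * mass"
    and "limsup (\<lambda>j. ereal (Skj \<alpha> \<beta> k j)) \<noteq> 0 \<Longrightarrow> liminf (\<lambda>n. ereal (y n)) = ereal (real k * mass)"
    and "limsup (\<lambda>j. ereal (Skj \<alpha> \<beta> k j)) \<noteq> 0 \<Longrightarrow> limsup (\<lambda>n. ereal (y n)) > ereal mass"
proof -
  let ?z = "\<lambda>n. ln (real n) * main_part n v (1 / real k)"
  let ?S = "\<lambda>j. Skj \<alpha> \<beta> k j"
  have lower: "\<forall>\<^sub>F n in sequentially. real k * mass - e + ?z n \<le> y n" if "e > 0" for e
    unfolding y_def using lower_bound[OF k that] .
  have upper: "\<forall>\<^sub>F n in sequentially. y n \<le> real k * mass + e + 2 * ?z n" if "e > 0" for e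
    unfolding y_def using upper_bound[OF k that] .
  have z_nonneg: "0 \<le> ?z n" for n
    by (cases "n = 0") (auto intro: mult_nonneg_nonneg main_part_v_nonneg)
  obtain U L where UL: "U > 0" "L > 0"
    "\<And>j. k \<le> cf_a \<beta> (Suc j) \<Longrightarrow> ?z (res_time k j) \<le> U * ?S (Suc j)"
    "\<And>j. k \<le> cf_a \<beta> (Suc j) \<Longrightarrow> L * ?S (Suc j) \<le> ?z (res_time k j)"
    using main_part_resonant_Skj[OF k] by blast
  have below: "\<forall>\<^sub>F n in sequentially. a < y n" if "a < real k * mass" for a
    using lower[of "(real k * mass - a) / 2"] that
    by (auto elim!: eventually_mono simp: field_simps intro: less_le_trans dest: order.strict_trans2)
       (smt (verit) z_nonneg mult.commute mult_nonneg_nonneg)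
  {
    assume S0: "limsup (\<lambda>j. ereal (?S j)) = 0"
    show "y \<longlonglongrightarrow> real k * mass"
    proof (rule order_tendstoI[OF below])
      fix a assume a: "real k * mass < a"
      \<comment> \<open>Once ?z n < e, the upper bound gives y n < real k * mass + 3 * e, which is
        less than a.\<close>
      define e where "e = (a - real k * mass) / 4"
      have e: "e > 0" using a by (simp add: e_def)
      have "limsup (\<lambda>j. ereal (?S j)) < ereal (e / U)" using S0 e UL by simp
      then have "\<forall>\<^sub>F j in sequentially. ereal (?S j) < ereal (e / U)" by (rule Limsup_lessD)
      then obtain J where J: "\<And>j. j \<ge> J \<Longrightarrow> ?S j < e / U" by (auto simp: eventually_sequentially)
      have "\<forall>\<^sub>F n in sequentially. ?z n < e"
        using nonresonant_small[OF k e] eventually_ge_at_top[of "blk J"]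
      proof eventually_elim
        case (elim n)
        show ?case
        proof (cases "resonant k n")
          case True
          then obtain j where j: "k \<le> cf_a \<beta> (Suc j)" "n = res_time k j" by (auto simp: resonant_def)
          have "blk J < blk (Suc j)" using elim(2) j k by (simp add: blk_Suc res_time_def)
          then have "J < Suc j" using strict_mono_less[OF blk_strict_mono] by blast
          then have "?S (Suc j) < e / U" by (intro J) auto
          then have "U * ?S (Suc j) < e" using UL(1) by (simp add: field_simps)
          then show ?thesis using UL(3)[OF j(1)] j(2) by auto
        qed (use elim in auto)
      qed
      with upper[OF e] show "\<forall>\<^sub>F n in sequentially. y n < a"
        by eventually_elim (use a in \<open>simp add: e_def field_simps\<close>)
    qed
  }
  {
    assume S0: "limsup (\<lambda>j. ereal (?S j)) \<noteq> 0"
    show "liminf (\<lambda>n. ereal (y n)) = ereal (real k * mass)"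
    proof (rule antisym)
      show "ereal (real k * mass) \<le> liminf (\<lambda>n. ereal (y n))"
        unfolding le_Liminf_iff
      proof (intro allI impI)
        fix c assume c: "c < ereal (real k * mass)"
        show "\<forall>\<^sub>F n in sequentially. c < ereal (y n)"
        proof (cases c)
          case (real r)
          then have "r < real k * mass" using c by simp
          from below[OF this] show ?thesis using real by simp
        qed (use c in auto)
      qed
      \<comment> \<open>A larger lower limit would make every late time resonant, since at late
        non-resonant times \<open>y n\<close> is at most slightly above real k * mass.\<close>
      show "liminf (\<lambda>n. ereal (y n)) \<le> ereal (real k * mass)"
      proof (rule ccontr)
        assume "\<not> liminf (\<lambda>n. ereal (y n)) \<le> ereal (real k * mass)"
        then have "ereal (real k * mass) < liminf (\<lambda>n. ereal (y n))" by simp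
        then obtain r where r: "ereal (real k * mass) < ereal r" "ereal r < liminf (\<lambda>n. ereal (y n))"
          using ereal_dense2 by blast
        define e where "e = (r - real k * mass) / 4"
        have e: "e > 0" using r by (simp add: e_def)
        have "\<forall>\<^sub>F n in sequentially. ereal r < ereal (y n)" using r(2) by (rule less_LiminfD)
        with upper[OF e] nonresonant_small[OF k e]
        have "\<forall>\<^sub>F n in sequentially. resonant k n"
        proof eventually_elim
          case (elim n)
          show ?case
          proof (rule ccontr)
            assume "\<not> resonant k n"
            then have "?z n < e" "y n \<le> real k * mass + e + 2 * ?z n" "r < y n" using elim by auto
            moreover have "4 * e = r - real k * mass" by (simp add: e_def)
            moreover have False if "Z < e" "Y \<le> M + e + 2 * Z" "r < Y" "4 * e = r - M" for Z Y M :: real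
              using that e by linarith
            ultimately show False by blast
          qed
        qed
        then show False
          using nonresonant_frequently[OF k] by (auto simp: eventually_sequentially)
      qed
    qed
    show "limsup (\<lambda>n. ereal (y n)) > ereal mass"
    proof (rule ccontr)
      assume neg: "\<not> limsup (\<lambda>n. ereal (y n)) > ereal mass"
      have "0 \<le> limsup (\<lambda>j. ereal (?S j))"
        using Skj_nonneg by (intro le_Limsup) (auto intro!: always_eventually)
      then have "0 < limsup (\<lambda>j. ereal (?S j))" using S0 by simp
      then obtain s where s: "0 < ereal s" "ereal s < limsup (\<lambda>j. ereal (?S j))"
        using ereal_dense2 by blast
      have s0: "s > 0" using s by simp
      have freq: "\<exists>j\<ge>J. s < ?S j" for J
      proof (rule ccontr)
        assume "\<not> ?thesis"
        then have "\<forall>j\<ge>J. ?S j \<le> s" by (auto simp: not_less)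
        then have "\<forall>\<^sub>F j in sequentially. ereal (?S j) \<le> ereal s" by (auto simp: eventually_sequentially)
        then have "limsup (\<lambda>j. ereal (?S j)) \<le> ereal s" by (rule Limsup_bounded)
        then show False using s by simp
      qed
      have "limsup (\<lambda>n. ereal (y n)) \<le> ereal mass" using neg by simp
      \<comment> \<open>The margin L * s is halved: one half goes into this threshold, the other
        into the error of the lower bound. Together they force ?z n < L * s at all late n, against
        the resonant times at which \<open>Skj\<close> exceeds s.\<close>
      also have "ereal mass < ereal (mass + L * s / 2)" using UL s0 by simp
      finally have "\<forall>\<^sub>F n in sequentially. ereal (y n) < ereal (mass + L * s / 2)" by (rule Limsup_lessD)
      moreover have "\<forall>\<^sub>F n in sequentially. real k * mass - L * s / 2 + ?z n \<le> y n"
        using UL s0 by (intro lower) auto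
      ultimately have "\<forall>\<^sub>F n in sequentially. ?z n < L * s"
      proof eventually_elim
        case (elim n)
        have "1 * mass \<le> real k * mass" using k mass_nonneg by (intro mult_right_mono) auto
        then show ?case using elim by simp
      qed
      then obtain N where N: "\<And>n. n \<ge> N \<Longrightarrow> ?z n < L * s" by (auto simp: eventually_sequentially)
      obtain J where J: "\<And>j. j \<ge> J \<Longrightarrow> k \<le> cf_a \<beta> (Suc j)"
        using digits_eventually[of k] by (auto simp: eventually_sequentially)
      \<comment> \<open>The successor ensures that j' has a predecessor j beyond both J and N, as
        the resonant estimates are indexed by \<open>Suc j\<close>.\<close>
      obtain j' where j': "j' \<ge> Suc (max J N)" "s < ?S j'" using freq by blast
      then obtain j where j: "j' = Suc j" "j \<ge> J" "j \<ge> N" by (cases j') auto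
      have "L * s < L * ?S (Suc j)" using j' j UL by simp
      also have "\<dots> \<le> ?z (res_time k j)" using UL(4) J j by auto
      also have "\<dots> < L * s" using N res_time_ge[of j k] j by auto
      finally show False .
    qed
  }
qed

end

theorem theorem3p3:
  fixes \<alpha> \<beta> :: real and k :: nat
  assumes "0 < \<alpha>" "\<alpha> < 1"
    and "0 < \<beta>" "\<beta> \<le> 1" "\<beta> \<notin> \<rat>"
    and "intermediate_type \<alpha> \<beta>"
    and "filterlim (cf_a \<beta>) at_top sequentially"
    and "k \<ge> 1"
  shows "(limsup (\<lambda>j. ereal (Skj \<alpha> \<beta> k j)) = 0 \<longrightarrow>
           (\<lambda>n. ln (real n) * (P1 ^^ n) (vfun \<beta> \<alpha>) (1 / real k))
             \<longlonglongrightarrow> (LINT x:{0..1}|lborel. vfun \<beta> \<alpha> x) * h1 (1 / real k))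
       \<and> (limsup (\<lambda>j. ereal (Skj \<alpha> \<beta> k j)) \<noteq> 0 \<longrightarrow>
           liminf (\<lambda>n. ereal (ln (real n) * (P1 ^^ n) (vfun \<beta> \<alpha>) (1 / real k)))
             = ereal ((LINT x:{0..1}|lborel. vfun \<beta> \<alpha> x) * h1 (1 / real k))
           \<and> limsup (\<lambda>n. ereal (ln (real n) * (P1 ^^ n) (vfun \<beta> \<alpha>) (1 / real k)))
             > ereal (LINT x:{0..1}|lborel. vfun \<beta> \<alpha> x))"
proof -
  have "\<beta> \<noteq> 1" using assms(5) by auto
  then interpret typed_point \<beta> \<alpha> using assms by unfold_locales auto
  have h: "(LINT x:{0..1}|lborel. vfun \<beta> \<alpha> x) * h1 (1 / real k) = real k * mass"
    by (simp add: h1_def mass_def)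
  show ?thesis
    unfolding h using dichotomy[OF assms(8)] by (simp add: mass_def)
qed

end
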